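(* The semifields isotopic to some $B(2,m,s,0,t)$ with $s\notin\{0,m\}$ and $t$ legitimate are precisely the finite semifields of characteristic $2$ which are quadratic (i.e. two-dimensional) over their left nucleus and quadratic over their right nucleus.
   Context: A (finite) presemifield is a finite additive abelian group with a multiplication that is distributive on both sides over addition and has no zero divisors; it is a semifield if it also has a multiplicative identity. Two presemifields $(F,+,* )$ and $(F,+,\circ)$ are isotopic if there are additive bijections $\alpha_1,\alpha_2,\beta$ with $\beta(\alpha_1(x)*\alpha_2(y))=x\circ y$ for all $x,y$. The left nucleus of a semifield $(F,+,* )$ is the set of $x$ with $x*(y*w)=(x*y)*w$ for all $y,w$; the right nucleus is the set of $w$ with $x*(y*w)=(x*y)*w$ for all $x,y$. For $m\ge 1$, $L=GF(2^m)$, $0\le s<2m$ and $\sigma=2^s$, a quadruple $t=[p_1,p_2,p_3,p_4]\in L^4$ is legitimate if $p_1\neq0$ and $p_1X^{\sigma+1}+p_2X^{\sigma}+p_3X+p_4$ has no root in $L$. $B(2,m,s,0,t)$ is the presemifield on $L\times L$ with multiplication $$(a,b)\circ(c,d)=(p_1ac^{\sigma}+p_2bc^{\sigma}+p_3ad^{\sigma}+p_4bd^{\sigma},\ ad+bc).$$ *)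

theory Defs
  imports "HOL-Algebra.Multiplicative_Group"
begin

text \<open>The field \<^const>\<open>one\<close> of the record is ignored here. Multiplication need not be
  associative. The structure with the single element zero is not excluded.\<close>

locale presemifield = abelian_group F for F (structure) +
  assumes finite_carrier: "finite (carrier F)"
    and mult_closed: "\<lbrakk>x \<in> carrier F; y \<in> carrier F\<rbrakk> \<Longrightarrow> x \<otimes> y \<in> carrier F"
    and distrib_right:
      "\<lbrakk>x \<in> carrier F; y \<in> carrier F; z \<in> carrier F\<rbrakk> \<Longrightarrow> (x \<oplus> y) \<otimes> z = x \<otimes> z \<oplus> y \<otimes> z"
    and distrib_left:
      "\<lbrakk>x \<in> carrier F; y \<in> carrier F; z \<in> carrier F\<rbrakk> \<Longrightarrow> z \<otimes> (x \<oplus> y) = z \<otimes> x \<oplus> z \<otimes> y"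
    and no_zero_divisors:
      "\<lbrakk>x \<in> carrier F; y \<in> carrier F; x \<otimes> y = \<zero>\<rbrakk> \<Longrightarrow> x = \<zero> \<or> y = \<zero>"

locale semifield = presemifield F for F (structure) +
  assumes one_in_carrier: "\<one> \<in> carrier F"
    and one_mult: "x \<in> carrier F \<Longrightarrow> \<one> \<otimes> x = x"
    and mult_one: "x \<in> carrier F \<Longrightarrow> x \<otimes> \<one> = x"

definition isotopic :: "('a, 'm) ring_scheme \<Rightarrow> ('b, 'n) ring_scheme \<Rightarrow> bool" where
  "isotopic F G \<longleftrightarrow>
    (\<exists>\<alpha>\<^sub>1 \<in> iso (add_monoid G) (add_monoid F). \<exists>\<alpha>\<^sub>2 \<in> iso (add_monoid G) (add_monoid F).
     \<exists>\<beta> \<in> iso (add_monoid F) (add_monoid G).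
       \<forall>x \<in> carrier G. \<forall>y \<in> carrier G. \<beta> (\<alpha>\<^sub>1 x \<otimes>\<^bsub>F\<^esub> \<alpha>\<^sub>2 y) = x \<otimes>\<^bsub>G\<^esub> y)"

text \<open>The characteristic is the additive order of the identity; it is 1 for the zero structure.\<close>

definition characteristic :: "('a, 'm) ring_scheme \<Rightarrow> nat" where
  "characteristic F = group.ord (add_monoid F) \<one>\<^bsub>F\<^esub>"

definition left_nucleus :: "('a, 'm) ring_scheme \<Rightarrow> 'a set" where
  "left_nucleus F = {x \<in> carrier F. \<forall>y \<in> carrier F. \<forall>w \<in> carrier F.
     x \<otimes>\<^bsub>F\<^esub> (y \<otimes>\<^bsub>F\<^esub> w) = (x \<otimes>\<^bsub>F\<^esub> y) \<otimes>\<^bsub>F\<^esub> w}"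

definition right_nucleus :: "('a, 'm) ring_scheme \<Rightarrow> 'a set" where
  "right_nucleus F = {w \<in> carrier F. \<forall>x \<in> carrier F. \<forall>y \<in> carrier F.
     x \<otimes>\<^bsub>F\<^esub> (y \<otimes>\<^bsub>F\<^esub> w) = (x \<otimes>\<^bsub>F\<^esub> y) \<otimes>\<^bsub>F\<^esub> w}"

text \<open>A semifield is a left vector space over its left nucleus and a right vector space over its
  right nucleus. In a basis, coordinates exist and are unique; extensional functions make
  uniqueness meaningful.\<close>

definition left_basis :: "('a, 'm) ring_scheme \<Rightarrow> 'a set \<Rightarrow> bool" where
  "left_basis F E \<longleftrightarrow> finite E \<and> E \<subseteq> carrier F \<and>
     (\<forall>x \<in> carrier F. \<exists>!c. c \<in> E \<rightarrow>\<^sub>E left_nucleus F \<and> x = (\<Oplus>\<^bsub>F\<^esub>e\<in>E. c e \<otimes>\<^bsub>F\<^esub> e))"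

definition right_basis :: "('a, 'm) ring_scheme \<Rightarrow> 'a set \<Rightarrow> bool" where
  "right_basis F E \<longleftrightarrow> finite E \<and> E \<subseteq> carrier F \<and>
     (\<forall>x \<in> carrier F. \<exists>!c. c \<in> E \<rightarrow>\<^sub>E right_nucleus F \<and> x = (\<Oplus>\<^bsub>F\<^esub>e\<in>E. e \<otimes>\<^bsub>F\<^esub> c e))"

definition quadratic_over_left_nucleus :: "('a, 'm) ring_scheme \<Rightarrow> bool" where
  "quadratic_over_left_nucleus F \<longleftrightarrow> (\<exists>E. left_basis F E \<and> card E = 2)"

definition quadratic_over_right_nucleus :: "('a, 'm) ring_scheme \<Rightarrow> bool" where
  "quadratic_over_right_nucleus F \<longleftrightarrow> (\<exists>E. right_basis F E \<and> card E = 2)"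

text \<open>Here \<open>L\<close> is a field with \<open>2 ^ m\<close> elements and \<open>\<sigma> = 2 ^ s\<close>.\<close>

definition legitimate ::
    "('b, 'n) ring_scheme \<Rightarrow> nat \<Rightarrow> 'b \<times> 'b \<times> 'b \<times> 'b \<Rightarrow> bool" where
  "legitimate L s = (\<lambda>(p\<^sub>1, p\<^sub>2, p\<^sub>3, p\<^sub>4).
     p\<^sub>1 \<in> carrier L \<and> p\<^sub>2 \<in> carrier L \<and> p\<^sub>3 \<in> carrier L \<and> p\<^sub>4 \<in> carrier L \<and> p\<^sub>1 \<noteq> \<zero>\<^bsub>L\<^esub> \<and>
     (let \<sigma> = 2 ^ s :: nat in
       \<not> (\<exists>x \<in> carrier L.
         p\<^sub>1 \<otimes>\<^bsub>L\<^esub> x [^]\<^bsub>L\<^esub> (\<sigma> + 1) \<oplus>\<^bsub>L\<^esub> p\<^sub>2 \<otimes>\<^bsub>L\<^esub> x [^]\<^bsub>L\<^esub> \<sigma> \<oplus>\<^bsub>L\<^esub> p\<^sub>3 \<otimes>\<^bsub>L\<^esub> x \<oplus>\<^bsub>L\<^esub> p\<^sub>4 = \<zero>\<^bsub>L\<^esub>)))"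

text \<open>\<open>B(2,m,s,0,t)\<close> on \<open>L \<times> L\<close>. It has no identity in general, hence the arbitrary value of
  \<^const>\<open>one\<close>.\<close>

definition B_presemifield ::
    "('b, 'n) ring_scheme \<Rightarrow> nat \<Rightarrow> 'b \<times> 'b \<times> 'b \<times> 'b \<Rightarrow> ('b \<times> 'b) ring" where
  "B_presemifield L s = (\<lambda>(p\<^sub>1, p\<^sub>2, p\<^sub>3, p\<^sub>4). let \<sigma> = 2 ^ s :: nat in
     \<lparr>carrier = carrier L \<times> carrier L,
      mult = (\<lambda>(a, b) (c, d).
        (p\<^sub>1 \<otimes>\<^bsub>L\<^esub> a \<otimes>\<^bsub>L\<^esub> c [^]\<^bsub>L\<^esub> \<sigma> \<oplus>\<^bsub>L\<^esub> p\<^sub>2 \<otimes>\<^bsub>L\<^esub> b \<otimes>\<^bsub>L\<^esub> c [^]\<^bsub>L\<^esub> \<sigma> \<oplus>\<^bsub>L\<^esub>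
         p\<^sub>3 \<otimes>\<^bsub>L\<^esub> a \<otimes>\<^bsub>L\<^esub> d [^]\<^bsub>L\<^esub> \<sigma> \<oplus>\<^bsub>L\<^esub> p\<^sub>4 \<otimes>\<^bsub>L\<^esub> b \<otimes>\<^bsub>L\<^esub> d [^]\<^bsub>L\<^esub> \<sigma>,
         a \<otimes>\<^bsub>L\<^esub> d \<oplus>\<^bsub>L\<^esub> b \<otimes>\<^bsub>L\<^esub> c)),
      one = undefined,
      zero = (\<zero>\<^bsub>L\<^esub>, \<zero>\<^bsub>L\<^esub>),
      add = (\<lambda>(a, b) (a', b'). (a \<oplus>\<^bsub>L\<^esub> a', b \<oplus>\<^bsub>L\<^esub> b'))\<rparr>)"

text \<open>\<open>GF(2^m)\<close> is any field with \<open>2 ^ m\<close> elements. The carrier may be taken inside \<^typ>\<open>nat\<close>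
  without loss: finite fields of equal order are isomorphic, and each is isomorphic to one
  carried by a set of natural numbers.\<close>

definition isotopic_to_some_B :: "('a, 'm) ring_scheme \<Rightarrow> bool" where
  "isotopic_to_some_B F \<longleftrightarrow>
    (\<exists>m s t. \<exists>L :: nat ring. m \<ge> 1 \<and> field L \<and> order L = 2 ^ m \<and>
       s < 2 * m \<and> s \<notin> {0, m} \<and> legitimate L s t \<and> isotopic F (B_presemifield L s t))"

end

theory Submission
  imports Defs "HOL-Algebra.Weak_Morphisms" "HOL-Algebra.Subrings" "HOL-Algebra.Sylow" "HOL-Number_Theory.Residues"
begin

text \<open>The nuclei of a finite semifield are finite skew fields, hence fields by Wedderburn's theorem. Right
  multiplication by a generator of the right nucleus \<open>M\<close> commutes with the action of the left nucleus
  \<open>N\<close>, so a discrete Fourier transform over \<open>N\<close> splits \<open>F\<close> into eigenspaces \<open>N u \<oplus> N v\<close>. Each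
  eigenvector yields an isomorphism \<open>M \<rightarrow> N\<close>, and the two isomorphisms differ by an automorphism
  \<open>x \<mapsto> x\<^sup>\<sigma>\<close> of \<open>N\<close>, nontrivial because otherwise \<open>F\<close> would be a field equal to its nuclei. Reading
  the product in coordinates gives \<open>B(2,m,s,0,t)\<close>, and the absence of zero divisors is legitimacy.
  Conversely, scalar multiplications on \<open>L \<times> L\<close> embed \<open>L\<close> into both nuclei, and a nucleus can only be
  larger if \<open>F\<close> is a field, in which case the two copies of \<open>L\<close> coincide and force \<open>\<sigma> = 1\<close>.\<close>

subsection \<open>Discrete Fourier decomposition\<close>

text \<open>Since \<open>F\<close> is not associative, the Fourier transform is stated for two
  commuting additive operators with n-th power the identity, n odd, and not for ring elements. The
  same statement then also serves Wedderburn's theorem, where commutativity is missing: once to find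
  an element normalizing a given one, once in place of a count of roots of unity. Characteristic 2
  removes every division: orders of units are odd, so n copies of a vector add up to that vector. As
  both nuclei have the same order q, the one number n = q - 1 serves both generators, and no power
  of the generator of \<open>N\<close> with exponent strictly between 0 and n fixes a nonzero
  vector. The splitting therefore needs no minimal polynomial and no extension of scalars.

  On GF(2^m) the map x^(2^s) depends on s modulo m only, so within \<open>s < 2 * m\<close> exactly
  s = 0 and s = m give the identity. The construction from the nuclei always lands in 0 < s < m;
  exponents above m matter only for the converse.

  The definition asks for \<open>L\<close> of type \<open>nat ring\<close>, while the left nucleus
  lives in the type of \<open>F\<close>; the isotopism is built over the nucleus itself and
  transported at the end.\<close>

lemma (in abelian_group) finsum_cyclic_shift:
  assumes "f \<in> UNIV \<rightarrow> carrier G" and "f n = f (0::nat)"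
  shows "(\<Oplus>i\<in>{..<n}. f (Suc i)) = (\<Oplus>i\<in>{..<n}. f i)"
proof (cases n)
  case 0
  then show ?thesis by simp
next
  case (Suc k)
  have f: "f i \<in> carrier G" for i using assms(1) by auto
  have "(\<Oplus>i\<in>{..k}. f i) \<oplus> f 0 = f (Suc k) \<oplus> (\<Oplus>i\<in>{..k}. f i)"
    using assms(2) Suc f by (simp add: a_comm Pi_def)
  also have "\<dots> = (\<Oplus>i\<in>{..Suc k}. f i)" using f by simp
  also have "\<dots> = (\<Oplus>i\<in>{..k}. f (Suc i)) \<oplus> f 0" using f by (subst finsum_Suc2) auto
  finally have "(\<Oplus>i\<in>{..k}. f i) = (\<Oplus>i\<in>{..k}. f (Suc i))"
    using f by (subst (asm) add.right_cancel) (auto simp: Pi_def)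
  then show ?thesis using Suc by (simp add: lessThan_Suc_atMost)
qed

lemma (in abelian_monoid) finsum_swap:
  assumes "finite A" "finite B" and "\<And>i j. f i j \<in> carrier G"
  shows "(\<Oplus>i\<in>A. \<Oplus>j\<in>B. f i j) = (\<Oplus>j\<in>B. \<Oplus>i\<in>A. f i j)"
  using assms(1)
proof (induction A rule: finite_induct)
  case empty
  show ?case by simp
next
  case (insert x A)
  have c: "(\<Oplus>j\<in>B. f i j) \<in> carrier G" "(\<Oplus>i\<in>A. f i j) \<in> carrier G" for i j
    using assms(3) by auto
  have "(\<Oplus>i\<in>insert x A. \<Oplus>j\<in>B. f i j) = (\<Oplus>j\<in>B. f x j) \<oplus> (\<Oplus>j\<in>B. \<Oplus>i\<in>A. f i j)"
    using insert c by (simp add: Pi_def)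
  also have "\<dots> = (\<Oplus>j\<in>B. f x j \<oplus> (\<Oplus>i\<in>A. f i j))"
    using c assms(3) by (subst finsum_addf) auto
  also have "\<dots> = (\<Oplus>j\<in>B. \<Oplus>i\<in>insert x A. f i j)"
    using insert c assms(3) by (intro finsum_cong') (auto simp: Pi_def)
  finally show ?case .
qed

lemma (in abelian_group) additive_zero:
  assumes "\<And>x. x \<in> carrier G \<Longrightarrow> h x \<in> carrier G"
    and "\<And>x y. x \<in> carrier G \<Longrightarrow> y \<in> carrier G \<Longrightarrow> h (x \<oplus> y) = h x \<oplus> h y"
  shows "h \<zero> = \<zero>"
proof -
  have "h \<zero> \<oplus> h \<zero> = \<zero> \<oplus> h \<zero>" using assms(1)[of \<zero>] assms(2)[of \<zero> \<zero>] by simp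
  then show ?thesis using assms(1)[of \<zero>] by (subst (asm) add.right_cancel) auto
qed

lemma (in abelian_group) additive_finsum:
  assumes "\<And>x. x \<in> carrier G \<Longrightarrow> h x \<in> carrier G"
    and "\<And>x y. x \<in> carrier G \<Longrightarrow> y \<in> carrier G \<Longrightarrow> h (x \<oplus> y) = h x \<oplus> h y"
    and "finite A" and "\<And>i. f i \<in> carrier G"
  shows "h (\<Oplus>i\<in>A. f i) = (\<Oplus>i\<in>A. h (f i))"
  using assms(3)
proof (induction A rule: finite_induct)
  case empty
  show ?case using additive_zero[of h] assms(1,2) by simp
next
  case (insert x A)
  then show ?case using assms by (simp add: Pi_def)
qed

lemma (in abelian_monoid) finsum_property:
  assumes "finite A" and "\<And>i. i \<in> A \<Longrightarrow> f i \<in> carrier G" and "P \<zero>"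
    and "\<And>i. i \<in> A \<Longrightarrow> P (f i)"
    and "\<And>x y. x \<in> carrier G \<Longrightarrow> y \<in> carrier G \<Longrightarrow> P x \<Longrightarrow> P y \<Longrightarrow> P (x \<oplus> y)"
  shows "P (\<Oplus>i\<in>A. f i)"
  using assms(1,2,4)
proof (induction A rule: finite_induct)
  case empty
  show ?case using assms(3) by simp
next
  case (insert x A)
  then show ?case using assms(5) by (simp add: Pi_def)
qed

text \<open>The additive structure common to division rings and semifields of characteristic 2, so
  that the Fourier argument can be used in both.\<close>

locale two_torsion_group = abelian_group G for G (structure) +
  assumes double: "x \<in> carrier G \<Longrightarrow> x \<oplus> x = \<zero>"
begin

lemma add_cancel: "x \<in> carrier G \<Longrightarrow> y \<in> carrier G \<Longrightarrow> x \<oplus> (x \<oplus> y) = y"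
  by (simp add: double flip: a_assoc)

lemma sum_eq_zero_iff:
  assumes "x \<in> carrier G" "y \<in> carrier G"
  shows "x \<oplus> y = \<zero> \<longleftrightarrow> x = y"
  using add_cancel[OF assms] double assms by auto

lemma finsum_const_odd:
  assumes "odd (n::nat)" and "v \<in> carrier G"
  shows "(\<Oplus>i\<in>{..<n}. v) = v"
proof -
  have "(\<Oplus>i\<in>{..<2 * k}. v) = \<zero>" for k :: nat
    using assms(2) by (induction k) (simp_all add: lessThan_Suc add_cancel double)
  moreover obtain k where "n = Suc (2 * k)" using assms(1) by (auto elim: oddE)
  ultimately show ?thesis using assms(2) by (simp add: lessThan_Suc)
qed

text \<open>The eigenvector components of \<open>v\<close> are its discrete Fourier coefficients
  \<open>y\<^sub>j = \<Sum>\<^sub>i U\<^bsup>ij\<^esup> T\<^bsup>i\<^esup> v\<close>; they add up to \<open>n v = v\<close>.\<close>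

lemma eigenvectors_generate:
  fixes n :: nat
  assumes U: "\<And>x. x \<in> carrier G \<Longrightarrow> U x \<in> carrier G"
      "\<And>x y. x \<in> carrier G \<Longrightarrow> y \<in> carrier G \<Longrightarrow> U (x \<oplus> y) = U x \<oplus> U y"
    and T: "\<And>x. x \<in> carrier G \<Longrightarrow> T x \<in> carrier G"
      "\<And>x y. x \<in> carrier G \<Longrightarrow> y \<in> carrier G \<Longrightarrow> T (x \<oplus> y) = T x \<oplus> T y"
    and comm: "\<And>x. x \<in> carrier G \<Longrightarrow> U (T x) = T (U x)"
    and n: "odd n" "\<And>x. x \<in> carrier G \<Longrightarrow> (U ^^ n) x = x" "\<And>x. x \<in> carrier G \<Longrightarrow> (T ^^ n) x = x"
    and free: "\<And>x i. x \<in> carrier G \<Longrightarrow> 0 < i \<Longrightarrow> i < n \<Longrightarrow> (U ^^ i) x = x \<Longrightarrow> x = \<zero>"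
    and P0: "P \<zero>"
    and Padd: "\<And>x y. x \<in> carrier G \<Longrightarrow> y \<in> carrier G \<Longrightarrow> P x \<Longrightarrow> P y \<Longrightarrow> P (x \<oplus> y)"
    and Peig: "\<And>y j. y \<in> carrier G \<Longrightarrow> j < n \<Longrightarrow> (U ^^ j) (T y) = y \<Longrightarrow> P y"
    and v: "v \<in> carrier G"
  shows "P v"
proof -
  have Uc: "(U ^^ i) x \<in> carrier G" if "x \<in> carrier G" for x i
    using that U(1) by (induction i) auto
  have Tc: "(T ^^ i) x \<in> carrier G" if "x \<in> carrier G" for x i
    using that T(1) by (induction i) auto
  have Ua: "(U ^^ i) (x \<oplus> y) = (U ^^ i) x \<oplus> (U ^^ i) y"
    if "x \<in> carrier G" "y \<in> carrier G" for x y i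
    using that U Uc by (induction i) auto
  have UT: "(U ^^ i) (T x) = T ((U ^^ i) x)" if "x \<in> carrier G" for x i
    using that comm Uc by (induction i) auto
  have Un: "(U ^^ (n * k)) x = x" if "x \<in> carrier G" for x k
    using that n(2) by (induction k) (auto simp: funpow_add)
  define e where "e j i = (U ^^ (j * i)) ((T ^^ i) v)" for j i
  have e: "e j i \<in> carrier G" for j i unfolding e_def using Uc Tc v by auto
  define y where "y j = (\<Oplus>i\<in>{..<n}. e j i)" for j
  have yc: "y j \<in> carrier G" for j unfolding y_def using e by auto
  have "P (y j)" if j: "j < n" for j
  proof (rule Peig[OF yc j])
    \<comment> \<open>\<open>U ^^ j\<close> after \<open>T\<close> moves each summand of
      \<open>y j\<close> to the next one; as \<open>e j n = e j 0\<close>, the composite permutes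
      the summands cyclically and fixes \<open>y j\<close>.\<close>
    have step: "(U ^^ j) (T (e j i)) = e j (Suc i)" for i
      unfolding e_def using UT[OF Tc[OF v, of i], of "j * i"]
      by (simp add: funpow_add)
    have "(U ^^ j) (T (y j)) = (\<Oplus>i\<in>{..<n}. (U ^^ j) (T (e j i)))"
      unfolding y_def using e T U Uc Ua
      by (subst additive_finsum[of "\<lambda>x. (U ^^ j) (T x)"]) auto
    also have "\<dots> = (\<Oplus>i\<in>{..<n}. e j (Suc i))" by (simp add: step)
    also have "\<dots> = y j" unfolding y_def
    proof (rule finsum_cyclic_shift)
      show "e j n = e j 0" unfolding e_def using n(3)[OF v] Un[OF v, of j] by (simp add: mult.commute)
    qed (use e in auto)
    finally show "(U ^^ j) (T (y j)) = y j" .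
  qed
  then have "P (\<Oplus>j\<in>{..<n}. y j)"
    using yc P0 Padd by (intro finsum_property[where P = P]) auto
  also have "(\<Oplus>j\<in>{..<n}. y j) = (\<Oplus>i\<in>{..<n}. \<Oplus>j\<in>{..<n}. e j i)"
    unfolding y_def using e by (intro finsum_swap) auto
  also have "\<dots> = (\<Oplus>i\<in>{..<n}. if i = 0 then v else \<zero>)"
  proof (intro finsum_cong')
    fix i assume i: "i \<in> {..<n}"
    \<comment> \<open>Orthogonality: for 0 < i < n the sum over j is fixed by \<open>U ^^ i\<close>,
      which by \<open>free\<close> fixes only zero; for i = 0 it consists of n copies of
      \<open>v\<close>, and n is odd.\<close>
    show "(\<Oplus>j\<in>{..<n}. e j i) = (if i = 0 then v else \<zero>)"
    proof (cases "i = 0")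
      case True
      then show ?thesis using n(1) v by (simp add: e_def finsum_const_odd)
    next
      case False
      let ?s = "\<Oplus>j\<in>{..<n}. e j i"
      have "(U ^^ i) ?s = (\<Oplus>j\<in>{..<n}. (U ^^ i) (e j i))"
        using e Uc Ua by (intro additive_finsum) auto
      also have "\<dots> = (\<Oplus>j\<in>{..<n}. e (Suc j) i)"
        unfolding e_def by (simp add: funpow_add)
      also have "\<dots> = ?s"
      proof (rule finsum_cyclic_shift)
        show "e n i = e 0 i" unfolding e_def using Un[OF Tc[OF v]] by simp
      qed (use e in auto)
      finally show ?thesis using free[of ?s i] e False i by auto
    qed
  qed (use v in auto)
  also have "\<dots> = v"
    using n(1) v by (subst finsum_singleton[of 0 _ "\<lambda>_. v", simplified]) (auto simp: odd_pos eq_commute)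
  finally show ?thesis .
qed

end

subsection \<open>Wedderburn's theorem in characteristic two\<close>

text \<open>Inverses are replaced by the absence of zero divisors, which passes to every subring at
  once, in particular to centralizers; finiteness gives the inverses back.\<close>

locale char_two_division_ring = ring R for R (structure) +
  assumes finite_carrier: "finite (carrier R)"
    and one_neq_zero: "\<one> \<noteq> \<zero>"
    and no_zero_divisors: "\<lbrakk>a \<in> carrier R; b \<in> carrier R; a \<otimes> b = \<zero>\<rbrakk> \<Longrightarrow> a = \<zero> \<or> b = \<zero>"
    and one_plus_one: "\<one> \<oplus> \<one> = \<zero>"
begin

sublocale two_torsion_group R
proof
  fix x assume x: "x \<in> carrier R"
  have "x \<oplus> x = (\<one> \<oplus> \<one>) \<otimes> x" using x by (simp only: l_distr l_one one_closed)
  then show "x \<oplus> x = \<zero>" using x by (simp add: one_plus_one)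
qed

lemma mult_left_cancel:
  assumes "a \<in> carrier R" "b \<in> carrier R" "c \<in> carrier R" "a \<noteq> \<zero>" "a \<otimes> b = a \<otimes> c"
  shows "b = c"
proof -
  have "a \<otimes> (b \<oplus> c) = \<zero>" using assms by (simp add: r_distr double)
  then have "b \<oplus> c = \<zero>" using no_zero_divisors[of a "b \<oplus> c"] assms by auto
  then show ?thesis using assms sum_eq_zero_iff by blast
qed

lemma mult_right_cancel:
  assumes "a \<in> carrier R" "b \<in> carrier R" "c \<in> carrier R" "a \<noteq> \<zero>" "b \<otimes> a = c \<otimes> a"
  shows "b = c"
proof -
  have "(b \<oplus> c) \<otimes> a = \<zero>" using assms by (simp add: l_distr double)
  then have "b \<oplus> c = \<zero>" using no_zero_divisors[of "b \<oplus> c" a] assms by auto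
  then show ?thesis using assms sum_eq_zero_iff by blast
qed

lemma pow_nonzero: "a \<in> carrier R \<Longrightarrow> a \<noteq> \<zero> \<Longrightarrow> a [^] (i::nat) \<noteq> \<zero>"
  by (induction i) (use one_neq_zero no_zero_divisors in \<open>auto dest: no_zero_divisors[OF nat_pow_closed]\<close>)

text \<open>In characteristic 2, (c + 1)^2 = c^2 + 1. This is why every multiplicative order is
  odd.\<close>

lemma square_eq_one:
  assumes "c \<in> carrier R" "c \<otimes> c = \<one>"
  shows "c = \<one>"
proof -
  have "(c \<oplus> \<one>) \<otimes> (c \<oplus> \<one>) = (\<one> \<oplus> c) \<oplus> (c \<oplus> \<one>)"
    using assms by (simp only: l_distr r_distr l_one r_one one_closed a_closed)
  also have "\<dots> = \<zero>" using assms(1) a_comm[OF assms(1) one_closed] double by auto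
  finally have "c \<oplus> \<one> = \<zero>" using no_zero_divisors[of "c \<oplus> \<one>" "c \<oplus> \<one>"] assms(1) by auto
  then show ?thesis using sum_eq_zero_iff assms(1) by blast
qed

lemma obtain_order:
  assumes "a \<in> carrier R" "a \<noteq> \<zero>"
  obtains n :: nat where "odd n" "a [^] n = \<one>" "\<And>i. 0 < i \<Longrightarrow> i < n \<Longrightarrow> a [^] i \<noteq> \<one>"
proof -
  have "\<not> inj (\<lambda>i::nat. a [^] i)"
  proof
    assume "inj (\<lambda>i::nat. a [^] i)"
    then have "infinite (range (\<lambda>i::nat. a [^] i))" by (simp add: finite_image_iff)
    moreover have "range (\<lambda>i::nat. a [^] i) \<subseteq> carrier R" using assms(1) by auto
    ultimately show False using finite_carrier finite_subset by blast
  qed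
  then obtain i j :: nat where ij: "a [^] i = a [^] j" "i < j"
    unfolding inj_def by (metis linorder_neqE_nat)
  then have "a [^] i \<otimes> \<one> = a [^] i \<otimes> a [^] (j - i)"
    using nat_pow_mult[OF assms(1), of i "j - i"] ij assms(1) by simp
  then have "\<one> = a [^] (j - i)"
    using mult_left_cancel[of "a [^] i" \<one> "a [^] (j - i)"] pow_nonzero[OF assms] assms(1) by auto
  then have ex: "\<exists>n>0::nat. a [^] n = \<one>" using ij(2) by (metis zero_less_diff)
  define n where "n = (LEAST n::nat. 0 < n \<and> a [^] n = \<one>)"
  have n: "0 < n" "a [^] n = \<one>" using LeastI_ex[OF ex] unfolding n_def by auto
  have min: "a [^] i \<noteq> \<one>" if "0 < i" "i < n" for i
    using not_less_Least[of i "\<lambda>n. 0 < n \<and> a [^] n = \<one>"] that unfolding n_def by auto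
  have "odd n"
  proof
    assume "even n"
    then obtain k where "n = 2 * k" by (rule evenE)
    then have k: "n = k + k" by simp
    then have "a [^] k \<otimes> a [^] k = \<one>" using n(2) assms(1) by (simp add: nat_pow_mult)
    then have "a [^] k = \<one>" using square_eq_one[of "a [^] k"] assms(1) by auto
    then show False using min[of k] k n(1) by auto
  qed
  then show ?thesis using that n min by blast
qed

lemma obtain_inverse:
  assumes "a \<in> carrier R" "a \<noteq> \<zero>"
  obtains b where "b \<in> carrier R" "a \<otimes> b = \<one>" "b \<otimes> a = \<one>"
proof -
  obtain n :: nat where n: "odd n" "a [^] n = \<one>" using obtain_order[OF assms] by blast
  then obtain k where "n = Suc k" by (cases n) auto
  then have "a [^] k \<otimes> a = \<one>" "a \<otimes> a [^] k = \<one>"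
    using n(2) assms(1) nat_pow_Suc2[of a k] by auto
  then show ?thesis using that[of "a [^] k"] assms(1) by auto
qed

lemma Units_eq: "Units R = carrier R - {\<zero>}"
proof -
  have "\<zero> \<notin> Units R"
  proof
    assume "\<zero> \<in> Units R"
    then obtain x where "x \<in> carrier R" "x \<otimes> \<zero> = \<one>" unfolding Units_def by auto
    then show False using one_neq_zero by simp
  qed
  moreover have "a \<in> Units R" if "a \<in> carrier R" "a \<noteq> \<zero>" for a
    using obtain_inverse[OF that] that unfolding Units_def by blast
  ultimately show ?thesis by auto
qed

lemma commutative_imp_field:
  assumes "\<And>x y. x \<in> carrier R \<Longrightarrow> y \<in> carrier R \<Longrightarrow> x \<otimes> y = y \<otimes> x"
  shows "field R"
proof -
  have "cring R" using assms ring_axioms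
    by (intro cring.intro comm_monoid.intro comm_monoid_axioms.intro monoid_axioms)
  then have "domain R" using one_neq_zero no_zero_divisors
    by (intro domain.intro domain_axioms.intro) auto
  then show ?thesis using Units_eq by (intro field.intro field_axioms.intro)
qed

lemma char_two_division_ring_subring:
  assumes "subring H R"
  shows "char_two_division_ring (R\<lparr>carrier := H\<rparr>)"
proof -
  have H: "H \<subseteq> carrier R" using assms by (rule subringE(1))
  show ?thesis
    by (intro char_two_division_ring.intro char_two_division_ring_axioms.intro subring_is_ring[OF assms])
      (use H finite_subset[OF H finite_carrier] one_neq_zero no_zero_divisors one_plus_one in auto)
qed

lemma subring_centralizer:
  assumes "S \<subseteq> carrier R"
  shows "subring {x \<in> carrier R. \<forall>s\<in>S. x \<otimes> s = s \<otimes> x} R" (is "subring ?C R")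
proof (rule subringI)
  fix x y assume xy: "x \<in> ?C" "y \<in> ?C"
  show "x \<oplus> y \<in> ?C" using xy assms by (auto simp: l_distr r_distr subset_iff)
  have "x \<otimes> y \<otimes> s = s \<otimes> (x \<otimes> y)" if s: "s \<in> S" for s
  proof -
    have c: "x \<in> carrier R" "y \<in> carrier R" "s \<in> carrier R" using xy s assms by auto
    have "x \<otimes> y \<otimes> s = x \<otimes> (s \<otimes> y)" using c xy s by (simp add: m_assoc)
    also have "\<dots> = (s \<otimes> x) \<otimes> y" using c xy s by (simp flip: m_assoc)
    finally show ?thesis using c by (simp add: m_assoc)
  qed
  then show "x \<otimes> y \<in> ?C" using xy by auto
qed (use assms in \<open>auto simp: l_minus r_minus subset_iff\<close>)

lemma funpow_left_mult: "a \<in> carrier R \<Longrightarrow> x \<in> carrier R \<Longrightarrow> ((\<lambda>x. a \<otimes> x) ^^ i) x = a [^] i \<otimes> x"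
  by (induction i) (simp_all add: nat_pow_Suc2 del: nat_pow_Suc flip: m_assoc, simp add: flip: nat_pow_Suc2)

lemma funpow_right_mult: "a \<in> carrier R \<Longrightarrow> x \<in> carrier R \<Longrightarrow> ((\<lambda>x. x \<otimes> a) ^^ i) x = x \<otimes> a [^] i"
  by (induction i) (simp_all add: m_assoc)

text \<open>The Fourier lemma with \<open>U\<close> the left multiplication by the inverse of
  \<open>a\<close> and \<open>T\<close> the right multiplication by \<open>c\<close>: these commute
  by associativity, and a fixed vector of \<open>U ^^ j\<close> after \<open>T\<close> is a solution
  of y c = a^j y.\<close>

lemma eigenvectors_generate_mult:
  fixes n :: nat
  assumes a: "a \<in> carrier R" "a \<noteq> \<zero>" and n: "odd n" "a [^] n = \<one>"
    and free: "\<And>i. 0 < i \<Longrightarrow> i < n \<Longrightarrow> a [^] i \<noteq> \<one>"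
    and c: "c \<in> carrier R" "c [^] n = \<one>"
    and P0: "P \<zero>"
    and Padd: "\<And>x y. x \<in> carrier R \<Longrightarrow> y \<in> carrier R \<Longrightarrow> P x \<Longrightarrow> P y \<Longrightarrow> P (x \<oplus> y)"
    and Peig: "\<And>y j. y \<in> carrier R \<Longrightarrow> y \<otimes> c = a [^] (j::nat) \<otimes> y \<Longrightarrow> P y"
    and v: "v \<in> carrier R"
  shows "P v"
proof -
  obtain b where b: "b \<in> carrier R" "a \<otimes> b = \<one>" "b \<otimes> a = \<one>" using obtain_inverse[OF a] .
  have ab: "a [^] i \<otimes> b [^] i = \<one>" for i :: nat
    using pow_mult_distrib[of a b i] a b by simp
  have cancel: "a [^] i \<otimes> (b [^] i \<otimes> x) = x" if "x \<in> carrier R" for x and i :: nat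
    using ab[of i] that a b by (simp flip: m_assoc)
  show ?thesis
  proof (rule eigenvectors_generate[of "\<lambda>x. b \<otimes> x" "\<lambda>x. x \<otimes> c" n P, OF _ _ _ _ _ n(1)])
    show "((\<otimes>) b ^^ n) x = x" if "x \<in> carrier R" for x
      using that b ab[of n] n a by (simp add: funpow_left_mult)
    show "((\<lambda>x. x \<otimes> c) ^^ n) x = x" if "x \<in> carrier R" for x
      using that c by (simp add: funpow_right_mult)
    show "x = \<zero>" if "x \<in> carrier R" "0 < i" "i < n" "((\<otimes>) b ^^ i) x = x" for x i
    proof (rule ccontr)
      assume "x \<noteq> \<zero>"
      moreover have "a [^] i \<otimes> x = \<one> \<otimes> x"
        using cancel[of x i] that b by (simp add: funpow_left_mult)
      ultimately show False using mult_right_cancel[of x "a [^] i" \<one>] that free a by auto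
    qed
    show "P y" if "y \<in> carrier R" "j < n" "((\<otimes>) b ^^ j) (y \<otimes> c) = y" for y j
      using that cancel[of "y \<otimes> c" j] b c by (intro Peig[of y j]) (auto simp: funpow_left_mult)
  qed (use b c P0 Padd v in \<open>auto simp: l_distr r_distr m_assoc\<close>)
qed

text \<open>Herstein's lemma: if every eigenvector \<open>x\<close> of right multiplication by \<open>a\<close>, \<open>x a = a\<^sup>j x\<close>,
  commuted with \<open>a\<close>, then so would \<open>v\<close>.\<close>

lemma obtain_normalizing:
  assumes av: "a \<in> carrier R" "v \<in> carrier R" "a \<otimes> v \<noteq> v \<otimes> a"
  obtains x and j :: nat where "x \<in> carrier R" "x \<noteq> \<zero>" "x \<otimes> a = a [^] j \<otimes> x" "a [^] j \<noteq> a"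
proof -
  have "a \<noteq> \<zero>" using av by auto
  then obtain n :: nat where n: "odd n" "a [^] n = \<one>" "\<And>i. 0 < i \<Longrightarrow> i < n \<Longrightarrow> a [^] i \<noteq> \<one>"
    using obtain_order[OF av(1)] by blast
  have "\<exists>x j. x \<in> carrier R \<and> x \<noteq> \<zero> \<and> x \<otimes> a = a [^] (j::nat) \<otimes> x \<and> a [^] j \<noteq> a"
  proof (rule ccontr)
    assume neg: "\<not> ?thesis"
    have "a \<otimes> v = v \<otimes> a"
    proof (rule eigenvectors_generate_mult[of a n a "\<lambda>v. a \<otimes> v = v \<otimes> a"])
      show "a \<otimes> y = y \<otimes> a" if "y \<in> carrier R" "y \<otimes> a = a [^] j \<otimes> y" for y and j :: nat
        using neg that av(1) by (cases "y = \<zero>") (auto, metis)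
    qed (use n av \<open>a \<noteq> \<zero>\<close> in \<open>auto simp: l_distr r_distr\<close>)
    then show False using av(3) by simp
  qed
  then show ?thesis using that by blast
qed

section \<open>Commutation rules and the center of a division ring\<close>

lemma conj_pow:
  assumes "a \<in> carrier R" "b \<in> carrier R" "c \<in> carrier R" "b \<otimes> a = c \<otimes> b"
  shows "b \<otimes> a [^] (i::nat) = c [^] i \<otimes> b"
proof (induction i)
  case (Suc i)
  have "b \<otimes> a [^] Suc i = (b \<otimes> a [^] i) \<otimes> a" using assms by (simp add: m_assoc)
  also have "\<dots> = c [^] i \<otimes> (b \<otimes> a)" unfolding Suc using assms by (simp add: m_assoc)
  finally show ?case using assms by (simp add: m_assoc)
qed (use assms in simp)

lemma conj_iterate:
  assumes "a \<in> carrier R" "x \<in> carrier R" "x \<otimes> a = a [^] (j::nat) \<otimes> x"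
  shows "x [^] (k::nat) \<otimes> a = a [^] (j ^ k) \<otimes> x [^] k"
proof (induction k)
  case (Suc k)
  have "x [^] Suc k \<otimes> a = x [^] k \<otimes> a [^] j \<otimes> x" using assms by (simp add: m_assoc)
  also have "\<dots> = (a [^] (j ^ k)) [^] j \<otimes> x [^] k \<otimes> x"
    using conj_pow[OF _ _ _ Suc] assms by simp
  finally show ?case using assms by (simp add: nat_pow_pow m_assoc mult.commute)
qed (use assms in simp)

text \<open>Moving b^i past the next factor \<open>a\<close> costs l^i, so collecting all factors
  \<open>a\<close> on the left costs l to the power 0 + 1 + ... + (i - 1).\<close>

lemma quasi_commuting_pow_mult:
  assumes c: "a \<in> carrier R" "b \<in> carrier R" "l \<in> carrier R"
    and la: "l \<otimes> a = a \<otimes> l" and lb: "l \<otimes> b = b \<otimes> l" and ba: "b \<otimes> a = l \<otimes> (a \<otimes> b)"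
  shows "(a \<otimes> b) [^] (i::nat) = l [^] (\<Sum>{..<i}) \<otimes> (a [^] i \<otimes> b [^] i)"
proof (induction i)
  case (Suc i)
  have lb': "l [^] k \<otimes> b = b \<otimes> l [^] k" for k :: nat
    using group_commutes_pow[OF lb] c by simp
  have la': "l [^] j \<otimes> a [^] k = a [^] k \<otimes> l [^] j" for j k :: nat
    using group_commutes_pow[OF la, of j] group_commutes_pow[of a "l [^] j" k] c by simp
  have bia: "b [^] k \<otimes> a = l [^] k \<otimes> a \<otimes> b [^] k" for k :: nat
  proof (induction k)
    case (Suc k)
    have "b [^] Suc k \<otimes> a = b [^] k \<otimes> (b \<otimes> a)" using c by (simp add: m_assoc)
    also have "\<dots> = b [^] k \<otimes> (l \<otimes> (a \<otimes> b))" using ba by simp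
    also have "\<dots> = (b [^] k \<otimes> l) \<otimes> (a \<otimes> b)" using c by (simp add: m_assoc)
    also have "b [^] k \<otimes> l = l \<otimes> b [^] k" using group_commutes_pow[OF lb[symmetric]] c by simp
    also have "l \<otimes> b [^] k \<otimes> (a \<otimes> b) = l \<otimes> (b [^] k \<otimes> a) \<otimes> b" using c by (simp add: m_assoc)
    also have "\<dots> = l \<otimes> l [^] k \<otimes> a \<otimes> b [^] Suc k" unfolding Suc using c by (simp add: m_assoc)
    finally show ?case using c nat_pow_Suc2[of l k] by simp
  qed (use c in simp)
  have "(a \<otimes> b) [^] Suc i = l [^] (\<Sum>{..<i}) \<otimes> (a [^] i \<otimes> (b [^] i \<otimes> a) \<otimes> b)"
    using c Suc by (simp add: m_assoc)
  also have "\<dots> = l [^] (\<Sum>{..<i}) \<otimes> (a [^] i \<otimes> l [^] i \<otimes> a \<otimes> b [^] i \<otimes> b)"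
    using c by (simp add: m_assoc bia)
  also have "\<dots> = l [^] (\<Sum>{..<i}) \<otimes> (l [^] i \<otimes> a [^] i \<otimes> a \<otimes> b [^] i \<otimes> b)"
    using c by (simp add: la')
  also have "\<dots> = (l [^] (\<Sum>{..<i}) \<otimes> l [^] i) \<otimes> (a [^] Suc i \<otimes> b [^] Suc i)"
    using c by (simp add: m_assoc)
  also have "\<dots> = l [^] (\<Sum>{..<Suc i}) \<otimes> (a [^] Suc i \<otimes> b [^] Suc i)"
    using c by (simp add: nat_pow_mult lessThan_Suc add.commute)
  finally show ?case .
qed (use c in simp)

definition center :: "'a set" where
  "center = {z \<in> carrier R. \<forall>x\<in>carrier R. z \<otimes> x = x \<otimes> z}"

lemma subring_center: "subring center R"
  unfolding center_def by (rule subring_centralizer) simp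

lemma centerD: "z \<in> center \<Longrightarrow> z \<in> carrier R" "z \<in> center \<Longrightarrow> x \<in> carrier R \<Longrightarrow> z \<otimes> x = x \<otimes> z"
  unfolding center_def by auto

lemma center_pow: "z \<in> center \<Longrightarrow> z [^] (i::nat) \<in> center"
  using subringE(3,6)[OF subring_center] by (induction i) auto

lemma center_mult_cancel:
  assumes z: "z \<in> center" "z \<noteq> \<zero>" and a: "a \<in> carrier R" and za: "z \<otimes> a \<in> center"
  shows "a \<in> center"
proof -
  have "a \<otimes> x = x \<otimes> a" if x: "x \<in> carrier R" for x
  proof -
    have zc: "z \<in> carrier R" using z centerD by auto
    have "z \<otimes> (a \<otimes> x) = x \<otimes> (z \<otimes> a)" using centerD(2)[OF za x] x zc a by (simp add: m_assoc)
    also have "\<dots> = (x \<otimes> z) \<otimes> a" using zc x a by (simp add: m_assoc)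
    also have "\<dots> = z \<otimes> (x \<otimes> a)" unfolding centerD(2)[OF z(1) x, symmetric] using zc x a by (simp add: m_assoc)
    finally show ?thesis using mult_left_cancel[of z "a \<otimes> x" "x \<otimes> a"] z(2) centerD(1)[OF z(1)] x a by auto
  qed
  then show ?thesis using a by (simp add: center_def)
qed

lemma field_center: "field (R\<lparr>carrier := center\<rparr>)"
  using char_two_division_ring.commutative_imp_field[OF char_two_division_ring_subring[OF subring_center]]
    centerD by simp

lemma center_cyclic:
  obtains g where "g \<in> center" "g \<noteq> \<zero>" "\<And>z. z \<in> center \<Longrightarrow> z \<noteq> \<zero> \<Longrightarrow> \<exists>k::nat. z = g [^] k"
proof -
  let ?Z = "R\<lparr>carrier := center\<rparr>"
  have "finite (carrier ?Z)" using finite_subset[OF _ finite_carrier, of center] centerD by auto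
  from field.finite_field_mult_group_has_gen[OF field_center this]
  obtain g where g: "g \<in> carrier (mult_of ?Z)" "carrier (mult_of ?Z) = {g [^]\<^bsub>?Z\<^esub> i | i::nat. i \<in> UNIV}"
    by blast
  have "\<exists>k::nat. z = g [^] k" if "z \<in> center" "z \<noteq> \<zero>" for z
  proof -
    have "z \<in> carrier (mult_of ?Z)" using that by simp
    then show ?thesis unfolding g(2) by (auto simp flip: nat_pow_consistent)
  qed
  with g(1) show ?thesis using that by auto
qed

text \<open>Herstein's argument: with \<open>r\<close> minimal such that \<open>a\<^sup>r\<close> is central for some noncentral \<open>a\<close>, one
  finds \<open>b a = \<lambda> a b\<close> with \<open>\<lambda>\<close> a central primitive \<open>r\<close>-th root of unity. All \<open>r\<close>-th roots of unity are
  then central, but some \<open>a\<^sup>i b\<close> has the same \<open>r\<close>-th power as a central element.\<close>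

lemma commutative_if_centralizers_commutative:
  assumes centralizers: "\<And>y a b. y \<in> carrier R \<Longrightarrow> y \<notin> center \<Longrightarrow> a \<in> carrier R \<Longrightarrow> b \<in> carrier R \<Longrightarrow>
      a \<otimes> y = y \<otimes> a \<Longrightarrow> b \<otimes> y = y \<otimes> b \<Longrightarrow> a \<otimes> b = b \<otimes> a"
  shows "center = carrier R"
proof (rule ccontr)
  assume "center \<noteq> carrier R"
  then obtain a0 where a0: "a0 \<in> carrier R" "a0 \<notin> center" using centerD by blast
  have zero: "\<zero> \<in> center" unfolding center_def by auto
  have one: "\<one> \<in> center" unfolding center_def by auto
  let ?Q = "\<lambda>r::nat. 0 < r \<and> (\<exists>a\<in>carrier R. a \<notin> center \<and> a [^] r \<in> center)"
  define r where "r = (LEAST r. ?Q r)"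
  have "\<exists>r. ?Q r"
  proof -
    have "a0 \<noteq> \<zero>" using a0 zero by auto
    then obtain n :: nat where "odd n" "a0 [^] n = \<one>" using obtain_order[OF a0(1)] by blast
    then show ?thesis using one a0 by (auto intro!: exI[of _ n] bexI[of _ a0] simp: odd_pos)
  qed
  from LeastI_ex[OF this] have "?Q r" unfolding r_def .
  then obtain a where a: "a \<in> carrier R" "a \<notin> center" "a [^] r \<in> center" and r0: "0 < r" by auto
  have min: "x \<in> center" if "0 < s" "s < r" "x \<in> carrier R" "x [^] s \<in> center" for s and x
    using not_less_Least[of s ?Q] that unfolding r_def by auto
  have prime: "prime r"
  proof -
    have "r \<noteq> 1" using a by auto
    have "d = 1 \<or> d = r" if d: "d dvd r" for d
    proof (rule ccontr)
      assume n: "\<not> (d = 1 \<or> d = r)"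
      obtain e where e: "r = d * e" using d by auto
      have "d \<noteq> 0" "e \<noteq> 0" using e r0 by (metis mult_0 mult_0_right less_numeral_extra(3))+
      moreover have "d < r" using dvd_imp_le[OF d r0] n by simp
      moreover have "e < r" using e n \<open>d \<noteq> 0\<close> \<open>e \<noteq> 0\<close> by simp
      moreover have "(a [^] d) [^] e \<in> center" using a e by (simp add: nat_pow_pow)
      ultimately show False using min[of e "a [^] d"] min[of d a] a by blast
    qed
    then show ?thesis using r0 \<open>r \<noteq> 1\<close> by (auto simp: prime_nat_iff)
  qed
  have r1: "1 < r" using prime prime_gt_1_nat by auto
  have anz: "a \<noteq> \<zero>" using a zero by auto
  obtain v where v: "v \<in> carrier R" "a \<otimes> v \<noteq> v \<otimes> a" using a unfolding center_def by auto
  obtain x and j :: nat where x: "x \<in> carrier R" "x \<noteq> \<zero>" "x \<otimes> a = a [^] j \<otimes> x" "a [^] j \<noteq> a"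
    using obtain_normalizing[OF a(1) v] .
  have xa: "x \<otimes> a \<noteq> a \<otimes> x" using x a mult_right_cancel[of x "a [^] j" a] by auto
  have xnc: "x \<notin> center" using xa centerD a by auto
  have not_dvd: "\<not> r dvd j"
  proof
    assume "r dvd j"
    then have "a [^] j \<in> center" using center_pow[OF a(3)] a(1) by (auto simp: nat_pow_pow)
    then have "x \<otimes> a = x \<otimes> a [^] j" using centerD[of "a [^] j"] x by auto
    then show False using mult_left_cancel[of x a "a [^] j"] x a by auto
  qed
  \<comment> \<open>The exponent r - 1 is chosen for Fermat's theorem: conjugation by
    \<open>b\<close> sends \<open>a\<close> to a^(j^(r-1)), and j^(r-1) = 1 + r u, so the result is
    l a with l = (a^r)^u central.\<close>
  define b where "b = x [^] (r - 1)"
  have b: "b \<in> carrier R" "b \<noteq> \<zero>" unfolding b_def using x pow_nonzero by auto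
  \<comment> \<open>Minimality of r keeps \<open>b\<close>, a power of the noncentral
    \<open>x\<close> with exponent r - 1, outside the center. Its centralizer is commutative and
    contains \<open>x\<close>, so it cannot also contain \<open>a\<close>.\<close>
  have ba_neq: "b \<otimes> a \<noteq> a \<otimes> b"
  proof
    assume "b \<otimes> a = a \<otimes> b"
    moreover have "b \<otimes> x = x \<otimes> b" unfolding b_def using group_commutes_pow[of x x] x by simp
    moreover have "b \<notin> center" unfolding b_def using min[of "r - 1" x] r1 xnc x by auto
    ultimately show False using centralizers[of b x a] b x a xa by simp
  qed
  have "[j ^ (r - 1) = 1] (mod r)" by (rule fermat_theorem[OF prime not_dvd])
  moreover have "1 \<le> j ^ (r - 1)" using not_dvd by (cases j) auto
  ultimately have "r dvd j ^ (r - 1) - 1" by (simp add: cong_altdef_nat)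
  then obtain u where "j ^ (r - 1) - 1 = r * u" by (rule dvdE)
  then have u: "j ^ (r - 1) = Suc (r * u)" using \<open>1 \<le> j ^ (r - 1)\<close> by simp
  define l where "l = (a [^] r) [^] u"
  have l: "l \<in> center" unfolding l_def using a center_pow by auto
  have lc: "l \<in> carrier R" using l centerD by auto
  have lx: "l \<otimes> y = y \<otimes> l" if "y \<in> carrier R" for y using centerD l that by auto
  have ba: "b \<otimes> a = l \<otimes> (a \<otimes> b)"
    using conj_iterate[OF a(1) x(1) x(3), of "r - 1"] a x unfolding b_def l_def u
    by (simp add: nat_pow_pow m_assoc)
  have l1: "l \<noteq> \<one>" using ba ba_neq a b by auto
  have la_pow: "(l \<otimes> a) [^] i = l [^] i \<otimes> a [^] i" for i :: nat
    using pow_mult_distrib[OF lx[OF a(1)] lc a(1)] .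
  have ba_pow: "b \<otimes> a [^] i = l [^] i \<otimes> (a [^] i \<otimes> b)" for i :: nat
    using conj_pow[of a b "l \<otimes> a" i] ba a b lc by (simp add: la_pow m_assoc)
  have lr: "l [^] r = \<one>"
  proof -
    \<comment> \<open>\<open>b\<close> commutes with the central element a^r, whereas moving it past
      r factors \<open>a\<close> costs l^r.\<close>
    have "l [^] r \<otimes> (a [^] r \<otimes> b) = \<one> \<otimes> (a [^] r \<otimes> b)"
      using ba_pow[of r] centerD(2)[OF a(3) b(1)] a b lc by simp
    moreover have "a [^] r \<otimes> b \<noteq> \<zero>"
      using no_zero_divisors[of "a [^] r" b] pow_nonzero[OF a(1) anz] a b by auto
    ultimately show ?thesis using mult_right_cancel[of "a [^] r \<otimes> b" "l [^] r" \<one>] a b lc by auto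
  qed
  have lmin: "l [^] i \<noteq> \<one>" if i: "0 < i" "i < r" for i
  proof
    assume li: "l [^] i = \<one>"
    have "coprime i r" using prime i
      by (metis coprime_commute nat_dvd_not_less prime_imp_coprime)
    then obtain s t where "i * s = r * t + 1" using bezout_nat[of i r] i by auto
    then have "(l [^] i) [^] s = (l [^] r) [^] t \<otimes> l"
      using lc by (simp add: nat_pow_pow)
    then show False using li lr l1 lc by simp
  qed
  have lnz: "l \<noteq> \<zero>"
  proof
    assume "l = \<zero>"
    moreover obtain q where "r = Suc q" using r0 by (cases r) auto
    ultimately show False using lr one_neq_zero by simp
  qed
  have "odd r"
  proof
    assume "even r"
    then have "r = 2" using prime by (metis primes_dvd_imp_eq two_is_prime_nat)
    then have "l \<otimes> l = \<one>" using lr lc by (simp add: numeral_2_eq_2)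
    then show False using square_eq_one[OF lc] l1 by simp
  qed
  have roots: "c \<in> center" if c: "c \<in> carrier R" "c [^] r = \<one>" for c
  proof -
    \<comment> \<open>A polynomial over a noncommutative ring may have too many roots, so the roots
      of unity are not counted. A nonzero y with y c = l^i y satisfies y c = y l^i because l is
      central, whence c = l^i. The predicate carries \<open>v = \<zero>\<close> so that it holds at
      zero and is additive; it is evaluated at \<open>\<one>\<close>.\<close>
    have "\<one> = \<zero> \<or> c \<in> center"
    proof (rule eigenvectors_generate_mult[of l r c "\<lambda>v. v = \<zero> \<or> c \<in> center"])
      show "y = \<zero> \<or> c \<in> center" if y: "y \<in> carrier R" "y \<otimes> c = l [^] i \<otimes> y" for y and i :: nat
      proof -
        have "y \<otimes> c = y \<otimes> l [^] i" using y centerD(2)[OF center_pow[OF l]] by auto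
        then show ?thesis using mult_left_cancel[of y c "l [^] i"] y c lc center_pow[OF l] by auto
      qed
    qed (use lc lnz \<open>odd r\<close> lr lmin c in auto)
    then show ?thesis using one_neq_zero by simp
  qed
  \<comment> \<open>As l^r = 1, b^r commutes with \<open>a\<close>, and it commutes with
    \<open>b\<close>. Were it noncentral, \<open>a\<close> and \<open>b\<close> would commute inside
    its commutative centralizer.\<close>
  have br: "b [^] r \<in> center"
  proof (rule ccontr)
    assume n: "b [^] r \<notin> center"
    have "a \<otimes> b = l [^] (r - 1) \<otimes> (b \<otimes> a)"
    proof -
      have "l [^] (r - 1) \<otimes> l = \<one>" using lr r0 lc by (metis Suc_diff_1 nat_pow_Suc)
      then show ?thesis using ba a b lc by (simp flip: m_assoc)
    qed
    then have "a \<otimes> b [^] r = (l [^] (r - 1)) [^] r \<otimes> b [^] r \<otimes> a"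
      using conj_pow[of b a "l [^] (r - 1) \<otimes> b" r] a b lc lx
        pow_mult_distrib[of "l [^] (r - 1)" b r] group_commutes_pow[of l b "r - 1"] by (simp add: m_assoc)
    moreover have "(l [^] (r - 1)) [^] r = \<one>" using lr lc
      by (simp add: nat_pow_pow mult.commute[of _ r]) (simp flip: nat_pow_pow)
    ultimately have "a \<otimes> b [^] r = b [^] r \<otimes> a" using a b by simp
    moreover have "b \<otimes> b [^] r = b [^] r \<otimes> b" using b by (simp flip: nat_pow_Suc2)
    ultimately show False using centralizers[OF _ n, of a b] a b ba_neq by auto
  qed
  obtain g where g: "g \<in> center" "g \<noteq> \<zero>" "\<And>z. z \<in> center \<Longrightarrow> z \<noteq> \<zero> \<Longrightarrow> \<exists>k::nat. z = g [^] k"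
    using center_cyclic by blast
  have gc: "g \<in> carrier R" using g centerD by auto
  obtain k :: nat where k: "a [^] r = g [^] k" using g(3)[OF a(3)] pow_nonzero[OF a(1) anz] by auto
  obtain m :: nat where m: "b [^] r = g [^] m" using g(3)[OF br] pow_nonzero[OF b] by auto
  \<comment> \<open>Dividing \<open>c\<close> by the central element g^w leaves an r-th root of
    unity, which is central by \<open>roots\<close>.\<close>
  have root_central: "c \<in> center" if c: "c \<in> carrier R" "c [^] r = g [^] (r * w)" for c and w :: nat
  proof -
    have gw: "g [^] w \<in> carrier R" "g [^] w \<noteq> \<zero>" using gc pow_nonzero g by auto
    obtain h where h: "h \<in> carrier R" "g [^] w \<otimes> h = \<one>" using obtain_inverse[OF gw] by metis
    have hc: "h \<in> center" using center_mult_cancel[of "g [^] w" h] center_pow[OF g(1)] gw h one by auto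
    have hnz: "h \<noteq> \<zero>" using h one_neq_zero gw by auto
    have "(h \<otimes> c) [^] r = h [^] r \<otimes> (g [^] w) [^] r"
      using pow_mult_distrib[OF centerD(2)[OF hc c(1)] h(1) c(1)] c(2) gc
        by (simp add: nat_pow_pow mult.commute)
    also have "\<dots> = (h \<otimes> g [^] w) [^] r"
      using pow_mult_distrib[OF centerD(2)[OF hc gw(1)] h(1) gw(1)] by simp
    also have "h \<otimes> g [^] w = \<one>" using h centerD(2)[OF hc gw(1)] by simp
    finally have "h \<otimes> c \<in> center" using roots[of "h \<otimes> c"] h c by auto
    then show ?thesis using center_mult_cancel[OF hc hnz c(1)] by auto
  qed
  have "\<not> r dvd k" using root_central[OF a(1)] k a(2) by (auto elim!: dvdE)
  then have "coprime k r" using prime by (metis coprime_commute prime_imp_coprime)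
  obtain i w where iw: "k * i + m = r * w"
  proof -
    have "0 < k" using \<open>\<not> r dvd k\<close> by (cases k) auto
    then obtain s t where st: "k * s = r * t + 1"
      using bezout_nat[of k r] \<open>coprime k r\<close> by auto
    \<comment> \<open>The exponent i has to be -m/k modulo r: s inverts k, and the factor r - 1
      plays the role of -1 in the natural numbers.\<close>
    have "k * (s * m * (r - 1)) + m = r * (t * m * (r - 1) + m)"
    proof -
      obtain q where q: "r = Suc q" using r0 by (cases r) auto
      have "k * (s * m * q) + m = (k * s) * (m * q) + m" by simp
      also have "\<dots> = r * (t * m * q) + m * (q + 1)" unfolding st by (simp add: algebra_simps)
      also have "\<dots> = r * (t * m * q + m)" using q by (simp add: algebra_simps)
      finally show ?thesis using q by simp
    qed
    then show ?thesis using that by blast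
  qed
  let ?l = "l [^] i" and ?a = "a [^] i"
  have lic: "?l \<in> center" using center_pow[OF l] .
  \<comment> \<open>Oddness of r makes r divide this exponent, so the twist disappears and (a^i b)^r
    = a^(ir) b^r = g^(ki + m) = g^(rw). Hence a^i b is central, and commuting it with
    \<open>a\<close> gives a b = b a, the contradiction.\<close>
  have "(\<Sum>{..<r}) = r * ((r - 1) div 2)"
  proof -
    have "2 * (\<Sum>{..<n}) = n * (n - 1)" for n :: nat by (induction n) (auto simp: lessThan_Suc algebra_simps)
    from this[of r] show ?thesis using \<open>odd r\<close> by (auto elim!: oddE)
  qed
  then have "?l [^] (\<Sum>{..<r}) = \<one>" using lr lc
    by (simp add: nat_pow_pow mult.commute[of i] mult.assoc) (simp flip: nat_pow_pow)
  then have "(?a \<otimes> b) [^] r = ?a [^] r \<otimes> b [^] r"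
    using quasi_commuting_pow_mult[of ?a b ?l r] a b lc ba_pow[of i] centerD(2)[OF lic] by simp
  also have "?a [^] r = (a [^] r) [^] i" using a(1) by (simp add: nat_pow_pow mult.commute)
  also note k
  also have "(g [^] k) [^] i \<otimes> b [^] r = g [^] (r * w)" using gc
    by (simp add: nat_pow_pow m nat_pow_mult flip: iw)
  finally have "?a \<otimes> b \<in> center" using root_central[of "?a \<otimes> b" w] a b by auto
  then have "a \<otimes> (?a \<otimes> b) = ?a \<otimes> (b \<otimes> a)" using centerD(2)[of "?a \<otimes> b" a] a b by (simp add: m_assoc)
  moreover have "a \<otimes> (?a \<otimes> b) = ?a \<otimes> (a \<otimes> b)" using a b nat_pow_Suc2[of a i] by (simp flip: m_assoc)
  ultimately have "?a \<otimes> (a \<otimes> b) = ?a \<otimes> (b \<otimes> a)" by simp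
  then show False using mult_left_cancel[of ?a "a \<otimes> b" "b \<otimes> a"] pow_nonzero[OF a(1) anz] a b ba_neq by auto
qed

end

text \<open>Induction on the order: the centralizer of a noncentral element is a proper subring,
  hence a field by induction, which is exactly the hypothesis of Herstein's argument.\<close>

theorem wedderburn_char_two:
  assumes "char_two_division_ring R"
  shows "field R"
  using assms
proof (induction "card (carrier R)" arbitrary: R rule: less_induct)
  case less
  interpret char_two_division_ring R by (rule less.prems)
  have "center = carrier R"
  proof (rule commutative_if_centralizers_commutative)
    fix y a b
    assume y: "y \<in> carrier R" "y \<notin> center"
      and ab: "a \<in> carrier R" "b \<in> carrier R" "a \<otimes>\<^bsub>R\<^esub> y = y \<otimes>\<^bsub>R\<^esub> a" "b \<otimes>\<^bsub>R\<^esub> y = y \<otimes>\<^bsub>R\<^esub> b"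
    let ?C = "{x \<in> carrier R. \<forall>s\<in>{y}. x \<otimes>\<^bsub>R\<^esub> s = s \<otimes>\<^bsub>R\<^esub> x}"
    have C: "subring ?C R" by (rule subring_centralizer) (use y in simp)
    have "?C \<noteq> carrier R"
    proof
      assume "?C = carrier R"
      then have "\<forall>x\<in>carrier R. x \<otimes>\<^bsub>R\<^esub> y = y \<otimes>\<^bsub>R\<^esub> x" by blast
      then show False using y unfolding center_def by simp
    qed
    then have "?C \<subset> carrier R" by blast
    then have "card ?C < card (carrier R)" using finite_carrier by (rule psubset_card_mono[rotated])
    then have "field (R\<lparr>carrier := ?C\<rparr>)"
      using less.hyps[of "R\<lparr>carrier := ?C\<rparr>"] char_two_division_ring_subring[OF C] by simp
    then interpret C: field "R\<lparr>carrier := ?C\<rparr>" .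
    show "a \<otimes>\<^bsub>R\<^esub> b = b \<otimes>\<^bsub>R\<^esub> a" using C.m_comm[of a b] ab by simp
  qed
  then show "field R" using commutative_imp_field centerD by auto
qed

subsection \<open>Automorphisms of finite fields\<close>

sublocale char_two_division_ring \<subseteq> field R
  by (rule wedderburn_char_two[OF char_two_division_ring_axioms])

text \<open>An odd prime p dividing the order would give, by Sylow's theorem, a nonzero x with p x =
  0, against 2 x = 0. Applied to the left nucleus, this supplies the number m.\<close>

lemma (in two_torsion_group) card_eq_two_power:
  assumes fin: "finite (carrier G)"
  obtains k :: nat where "card (carrier G) = 2 ^ k"
proof -
  have add_even: "add_pow G (2 * k) x = \<zero>" if "x \<in> carrier G" for x and k :: nat
  proof (induction k)
    case (Suc k)
    have "add_pow G (2 * Suc k) x = add_pow G (2 * k) x \<oplus> x \<oplus> x" using that by simp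
    then show ?case using Suc that by (simp add: double)
  qed simp
  have pos: "card (carrier G) \<noteq> 0" using fin by auto
  have two: "p = 2" if p: "prime p" "p dvd card (carrier G)" for p :: nat
  proof (rule ccontr)
    assume "p \<noteq> 2"
    then have "odd p" using p(1) by (metis primes_dvd_imp_eq two_is_prime_nat)
    obtain c where c: "order (add_monoid G) = p ^ 1 * c" using p(2) by (auto simp: order_def)
    obtain H where H: "subgroup H (add_monoid G)" "card H = p ^ 1"
      using sylow_thm[OF p(1) a_group c] fin by auto
    have "\<zero> \<in> H" using subgroup.one_closed[OF H(1)] by simp
    obtain x where x: "x \<in> H" "x \<noteq> \<zero>"
    proof -
      have "\<not> H \<subseteq> {\<zero>}"
      proof
        assume "H \<subseteq> {\<zero>}"
        then have "card H \<le> 1" using card_mono[of "{\<zero>}" H] by simp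
        then show False using H(2) prime_gt_1_nat[OF p(1)] by simp
      qed
      then show ?thesis using that by auto
    qed
    have xc: "x \<in> carrier G" using subgroup.subset[OF H(1)] x by auto
    have "x [^]\<^bsub>(add_monoid G)\<lparr>carrier := H\<rparr>\<^esub> p = \<zero>"
      using group.pow_order_eq_1[OF subgroup.subgroup_is_group[OF H(1) a_group], of x] x H(2)
      by (simp add: order_def)
    then have "add_pow G p x = \<zero>"
      using monoid.nat_pow_consistent[OF a_monoid, of x p H] by (simp add: add_pow_def)
    moreover obtain k where "p = 2 * k + 1" using \<open>odd p\<close> by (rule oddE)
    ultimately show False using add_even[OF xc, of k] x xc by simp
  qed
  obtain q where q: "card (carrier G) = 2 ^ multiplicity 2 (card (carrier G)) * q" "odd q"
    using multiplicity_decompose'[of "card (carrier G)" 2] pos by auto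
  have "q = 1"
  proof (rule ccontr)
    assume "q \<noteq> 1"
    then obtain p where "prime p" "p dvd q" using prime_factor_nat by blast
    then show False using two[of p] q by (metis dvd_mult)
  qed
  then show ?thesis using q that by simp
qed

context char_two_division_ring
begin

lemma obtain_generator:
  obtains g where "g \<in> carrier R" "g \<noteq> \<zero>" "odd (card (carrier R) - 1)" "g [^] (card (carrier R) - 1) = \<one>"
    "\<And>i. 0 < i \<Longrightarrow> i < card (carrier R) - 1 \<Longrightarrow> g [^] i \<noteq> \<one>"
    "bij_betw (\<lambda>i. g [^] i) {..<card (carrier R) - 1} (carrier R - {\<zero>})"
proof -
  obtain g where g: "g \<in> carrier R" "g \<noteq> \<zero>" "\<And>x. x \<in> carrier R - {\<zero>} \<Longrightarrow> \<exists>i::nat. x = g [^] i"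
    using finite_field_mult_group_has_gen[OF finite_carrier] by (auto simp: mult_of_simps)
  obtain n :: nat where n: "odd n" "g [^] n = \<one>" "\<And>i. 0 < i \<Longrightarrow> i < n \<Longrightarrow> g [^] i \<noteq> \<one>"
    using obtain_order[OF g(1,2)] by blast
  have le: "i = j" if "g [^] i = g [^] j" "i \<le> j" "j < n" for i j
  proof (rule ccontr)
    assume "i \<noteq> j"
    have "g [^] i \<otimes> \<one> = g [^] i \<otimes> g [^] (j - i)"
      using that nat_pow_mult[OF g(1), of i "j - i"] g(1) by simp
    then have "\<one> = g [^] (j - i)"
      using mult_left_cancel[of "g [^] i" \<one> "g [^] (j - i)"] pow_nonzero[OF g(1,2)] g(1) by auto
    moreover have "0 < j - i" "j - i < n" using that \<open>i \<noteq> j\<close> by auto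
    ultimately show False using n(3)[of "j - i"] by simp
  qed
  have inj: "inj_on (\<lambda>i. g [^] i) {..<n}"
  proof (rule inj_onI)
    fix i j assume "i \<in> {..<n}" "j \<in> {..<n}" "g [^] i = g [^] j"
    then show "i = j" using le[of i j] le[of j i] by (cases "i \<le> j") auto
  qed
  have "(\<lambda>i. g [^] i) ` {..<n} = carrier R - {\<zero>}"
  proof
    show "(\<lambda>i. g [^] i) ` {..<n} \<subseteq> carrier R - {\<zero>}" using pow_nonzero[OF g(1,2)] g(1) by auto
    show "carrier R - {\<zero>} \<subseteq> (\<lambda>i. g [^] i) ` {..<n}"
    proof
      fix x assume "x \<in> carrier R - {\<zero>}"
      then obtain i :: nat where i: "x = g [^] i" using g(3) by blast
      have "g [^] (n * (i div n)) = \<one>" using n(2) g(1) by (simp flip: nat_pow_pow)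
      moreover have "x = g [^] (n * (i div n)) \<otimes> g [^] (i mod n)"
        unfolding i using g(1) by (simp only: nat_pow_mult mult_div_mod_eq)
      ultimately have "x = g [^] (i mod n)" using g(1) by simp
      then show "x \<in> (\<lambda>i. g [^] i) ` {..<n}" using n(1) by (auto simp: odd_pos)
    qed
  qed
  then have bij: "bij_betw (\<lambda>i. g [^] i) {..<n} (carrier R - {\<zero>})" using inj by (simp add: bij_betw_def)
  then have "n = card (carrier R) - 1" using bij_betw_same_card[OF bij] by simp
  then show ?thesis using that[of g] g(1,2) n bij by blast
qed

lemma pow_card_minus_one:
  assumes "x \<in> carrier R" "x \<noteq> \<zero>"
  shows "x [^] (card (carrier R) - 1) = \<one>"
proof -
  define n where "n = card (carrier R) - 1"
  obtain g where g: "g \<in> carrier R" "g [^] n = \<one>"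
    "bij_betw (\<lambda>i. g [^] i) {..<n} (carrier R - {\<zero>})"
    using obtain_generator unfolding n_def by blast
  have "x \<in> (\<lambda>i. g [^] i) ` {..<n}" using g(3) assms by (simp add: bij_betw_def)
  then obtain i :: nat where "x = g [^] i" by auto
  moreover have "(g [^] i) [^] n = (g [^] n) [^] i" using g(1) by (simp add: nat_pow_pow mult.commute)
  ultimately show ?thesis unfolding n_def[symmetric] using g(1,2) by simp
qed

lemma frobenius_add:
  assumes "x \<in> carrier R" "y \<in> carrier R"
  shows "(x \<oplus> y) [^] ((2::nat) ^ s) = x [^] ((2::nat) ^ s) \<oplus> y [^] ((2::nat) ^ s)"
proof (induction s)
  case (Suc s)
  have sq: "z [^] ((2::nat) ^ Suc s) = z [^] ((2::nat) ^ s) \<otimes> z [^] ((2::nat) ^ s)" if "z \<in> carrier R" for z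
    using that by (simp add: nat_pow_mult mult_2)
  let ?x = "x [^] ((2::nat) ^ s)" and ?y = "y [^] ((2::nat) ^ s)"
  have "(?x \<oplus> ?y) \<otimes> (?x \<oplus> ?y) = (?x \<otimes> ?x \<oplus> ?y \<otimes> ?y) \<oplus> (?x \<otimes> ?y \<oplus> ?x \<otimes> ?y)"
    using assms by (simp add: l_distr r_distr m_comm a_ac)
  also have "\<dots> = ?x \<otimes> ?x \<oplus> ?y \<otimes> ?y" using assms by (simp add: double)
  finally show ?case using assms Suc by (simp only: sq a_closed)
qed (use assms in simp)

lemma frobenius_inj:
  assumes "x \<in> carrier R" "y \<in> carrier R" "x [^] ((2::nat) ^ s) = y [^] ((2::nat) ^ s)"
  shows "x = y"
proof -
  have "(x \<oplus> y) [^] ((2::nat) ^ s) = \<zero>" using assms by (simp add: frobenius_add double)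
  then have "x \<oplus> y = \<zero>" using pow_nonzero[of "x \<oplus> y"] assms by auto
  then show ?thesis using sum_eq_zero_iff assms by simp
qed

text \<open>For a generator g, multiplication by g^k permutes the summands cyclically, so the sum
  vanishes unless g^k = 1. In that case it consists of n copies of 1, and n is odd.\<close>

lemma power_sum:
  assumes "n = card (carrier R) - 1"
  shows "(\<Oplus>x\<in>carrier R - {\<zero>}. x [^] (k::nat)) = (if n dvd k then \<one> else \<zero>)"
proof -
  obtain g where g: "g \<in> carrier R" "g \<noteq> \<zero>" "odd n" "g [^] n = \<one>"
    "\<And>i. 0 < i \<Longrightarrow> i < n \<Longrightarrow> g [^] i \<noteq> \<one>"
    "bij_betw (\<lambda>i. g [^] i) {..<n} (carrier R - {\<zero>})"
    using obtain_generator unfolding assms by blast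
  let ?f = "\<lambda>i. (g [^] (i::nat)) [^] k"
  let ?s = "\<Oplus>i\<in>{..<n}. ?f i"
  have sc: "?s \<in> carrier R" using g(1) by simp
  have "(\<Oplus>x\<in>carrier R - {\<zero>}. x [^] k) = ?s"
    using g(6) finsum_reindex[of "\<lambda>x. x [^] k" "\<lambda>i. g [^] i" "{..<n}"] g(1)
    by (auto simp: bij_betw_def)
  also have "?s = (if n dvd k then \<one> else \<zero>)"
  proof (cases "n dvd k")
    case True
    have "?f i = \<one>" for i
    proof -
      have "?f i = (g [^] k) [^] i" using g(1) by (simp add: nat_pow_pow mult.commute)
      also have "g [^] k = \<one>" using True g(1,4) by (auto simp flip: nat_pow_pow)
      finally show ?thesis by simp
    qed
    then show ?thesis using True g(3) by (simp add: finsum_const_odd)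
  next
    case False
    have "g [^] (k mod n) \<noteq> \<one>" using False g(3,5) by (metis dvd_eq_mod_eq_0 gr0I mod_less_divisor odd_pos)
    moreover have "g [^] k = g [^] (k mod n)"
    proof -
      have "g [^] (n * (k div n)) = \<one>" using g(1,4) by (simp flip: nat_pow_pow)
      moreover have "g [^] k = g [^] (n * (k div n)) \<otimes> g [^] (k mod n)"
        using g(1) by (simp only: nat_pow_mult mult_div_mod_eq)
      ultimately show ?thesis using g(1) by simp
    qed
    ultimately have gk: "g [^] k \<noteq> \<one>" by simp
    have "g [^] k \<otimes> ?s = (\<Oplus>i\<in>{..<n}. g [^] k \<otimes> ?f i)"
      using g(1) by (intro finsum_rdistr) auto
    also have "\<dots> = (\<Oplus>i\<in>{..<n}. ?f (Suc i))"
    proof (intro finsum_cong')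
      show "g [^] k \<otimes> ?f i = ?f (Suc i)" for i
        using g(1) nat_pow_pow[OF g(1), of "Suc i" k] by (simp add: nat_pow_pow nat_pow_mult)
    qed (use g(1) in auto)
    also have "\<dots> = ?s"
    proof (rule finsum_cyclic_shift)
      show "?f n = ?f 0" using g by simp
    qed (use g in auto)
    finally have "g [^] k \<otimes> ?s = \<one> \<otimes> ?s" using sc by simp
    then have "?s = \<zero>" using mult_right_cancel[of ?s "g [^] k" \<one>] gk sc g(1) by auto
    then show ?thesis using False by simp
  qed
  finally show ?thesis .
qed

text \<open>Pascal's rule is the induction step.\<close>

lemma binomial_power_sum:
  assumes n: "n = card (carrier R) - 1" and "0 < e" "e + k < 2 * n"
  shows "(\<Oplus>x\<in>carrier R - {\<zero>}. x [^] e \<otimes> (x \<oplus> \<one>) [^] k)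
    = (if e \<le> n \<and> odd (k choose (n - e)) then \<one> else \<zero>)"
  using assms(2,3)
proof (induction k arbitrary: e)
  case 0
  have "(\<Oplus>x\<in>carrier R - {\<zero>}. x [^] e \<otimes> (x \<oplus> \<one>) [^] (0::nat)) = (\<Oplus>x\<in>carrier R - {\<zero>}. x [^] e)"
    by (intro finsum_cong') auto
  also have "\<dots> = (if n dvd e then \<one> else \<zero>)" by (rule power_sum[OF n])
  \<comment> \<open>The bound \<open>e + k < 2 * n\<close>, which the induction preserves, leaves n
    as the only possible multiple of n among the exponents. So the sum isolates one binomial
    coefficient.\<close>
  also have "n dvd e \<longleftrightarrow> e = n"
  proof
    assume "n dvd e"
    then obtain c where c: "e = n * c" by auto
    with 0 have "c < 2" "0 < c" by auto
    then have "c = 1" by simp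
    then show "e = n" using c by simp
  qed simp
  finally show ?case by (cases "n - e") auto
next
  case (Suc k)
  let ?t = "\<lambda>e k x. x [^] (e::nat) \<otimes> (x \<oplus> \<one>) [^] (k::nat)"
  have "?t e (Suc k) x = ?t (Suc e) k x \<oplus> ?t e k x" if x: "x \<in> carrier R" for x
  proof -
    have "?t e (Suc k) x = (x \<oplus> \<one>) \<otimes> ?t e k x" using x by (simp add: m_ac)
    also have "\<dots> = x \<otimes> ?t e k x \<oplus> ?t e k x" using x by (subst l_distr) auto
    finally show ?thesis using x by (simp add: m_ac)
  qed
  then have "(\<Oplus>x\<in>carrier R - {\<zero>}. ?t e (Suc k) x) = (\<Oplus>x\<in>carrier R - {\<zero>}. ?t (Suc e) k x \<oplus> ?t e k x)"
    by (intro finsum_cong') auto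
  also have "\<dots> = (\<Oplus>x\<in>carrier R - {\<zero>}. ?t (Suc e) k x) \<oplus> (\<Oplus>x\<in>carrier R - {\<zero>}. ?t e k x)"
    by (intro finsum_addf) auto
  also have "\<dots> = (if Suc e \<le> n \<and> odd (k choose (n - Suc e)) then \<one> else \<zero>)
      \<oplus> (if e \<le> n \<and> odd (k choose (n - e)) then \<one> else \<zero>)"
    using Suc.IH[of "Suc e"] Suc.IH[of e] Suc.prems by simp
  also have "\<dots> = (if e \<le> n \<and> odd (Suc k choose (n - e)) then \<one> else \<zero>)"
  proof (cases "Suc e \<le> n")
    case True
    then have "n - e = Suc (n - Suc e)" by simp
    then show ?thesis using True by (auto simp: double)
  next
    case False
    then show ?thesis by (cases "e = n") auto
  qed
  finally show ?case .
qed

text \<open>On a cyclic multiplicative group \<open>\<sigma> x = x\<^sup>j\<close>. If the odd part \<open>k\<close> of \<open>j\<close> were not \<open>1\<close>, the additive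
  map \<open>x \<mapsto> x\<^sup>k\<close> would contradict the binomial coefficient \<open>k choose 1\<close> being odd.\<close>

lemma automorphism_eq_frobenius_power:
  assumes card: "card (carrier R) = 2 ^ m"
    and \<sigma>: "\<And>x. x \<in> carrier R \<Longrightarrow> \<sigma> x \<in> carrier R"
      "\<And>x y. x \<in> carrier R \<Longrightarrow> y \<in> carrier R \<Longrightarrow> \<sigma> (x \<oplus> y) = \<sigma> x \<oplus> \<sigma> y"
      "\<And>x y. x \<in> carrier R \<Longrightarrow> y \<in> carrier R \<Longrightarrow> \<sigma> (x \<otimes> y) = \<sigma> x \<otimes> \<sigma> y"
      "\<sigma> \<one> = \<one>"
  obtains s where "s < m" "\<And>x. x \<in> carrier R \<Longrightarrow> \<sigma> x = x [^] ((2::nat) ^ s)"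
proof -
  define n where "n = card (carrier R) - 1"
  obtain g where g: "g \<in> carrier R" "g \<noteq> \<zero>" "odd n" "g [^] n = \<one>"
    "bij_betw (\<lambda>i. g [^] i) {..<n} (carrier R - {\<zero>})"
    using obtain_generator unfolding n_def by blast
  have \<sigma>0: "\<sigma> \<zero> = \<zero>" using additive_zero[of \<sigma>] \<sigma>(1,2) by blast
  have \<sigma>pow: "\<sigma> (x [^] i) = \<sigma> x [^] i" if "x \<in> carrier R" for x and i :: nat
    using that \<sigma>(3,4) by (induction i) auto
  have "\<sigma> g \<noteq> \<zero>"
  proof
    assume "\<sigma> g = \<zero>"
    moreover obtain q where "n = Suc q" using g(3) by (cases n) auto
    ultimately show False using \<sigma>pow[OF g(1), of n] g(4) \<sigma>(4) one_neq_zero by simp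
  qed
  then have "\<sigma> g \<in> carrier R - {\<zero>}" using \<sigma>(1) g(1) by blast
  then have "\<sigma> g \<in> (\<lambda>i. g [^] i) ` {..<n}" using g(5) by (simp add: bij_betw_def)
  then obtain i where "i < n" "\<sigma> g = g [^] i" by auto
  \<comment> \<open>Exponent 0 is replaced by n: with j positive, x^j also vanishes at zero, and j
    has an odd part.\<close>
  then obtain j where j: "0 < j" "j \<le> n" "\<sigma> g = g [^] j"
  proof (cases "i = 0")
    case True
    then show ?thesis using that[of n] \<open>\<sigma> g = g [^] i\<close> g(3,4) by (simp add: odd_pos)
  next
    case False
    then show ?thesis using that[of i] \<open>\<sigma> g = g [^] i\<close> \<open>i < n\<close> by simp
  qed
  have \<sigma>j: "\<sigma> x = x [^] j" if x: "x \<in> carrier R" for x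
  proof (cases "x = \<zero>")
    case True
    then show ?thesis using \<sigma>0 j(1) by (cases j) auto
  next
    case False
    then have "x \<in> (\<lambda>i. g [^] i) ` {..<n}" using g(5) x by (simp add: bij_betw_def)
    then obtain i :: nat where "x = g [^] i" by auto
    then show ?thesis using \<sigma>pow[OF g(1), of i] g(1) j(3) by (simp add: nat_pow_pow mult.commute)
  qed
  obtain k where k: "j = 2 ^ multiplicity 2 j * k" "odd k"
    using multiplicity_decompose'[of j 2] j(1) by auto
  define s where "s = multiplicity 2 j"
  have jk: "j = k * 2 ^ s" unfolding s_def by (rule trans[OF k(1) mult.commute])
  \<comment> \<open>x^j is the Frobenius power 2^s of x^k, and that power map is additive and
    injective, so additivity descends from x^j to x^k.\<close>
  have additive: "(x \<oplus> y) [^] k = x [^] k \<oplus> y [^] k" if xy: "x \<in> carrier R" "y \<in> carrier R" for x y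
  proof (rule frobenius_inj[of _ _ s])
    show "((x \<oplus> y) [^] k) [^] ((2::nat) ^ s) = (x [^] k \<oplus> y [^] k) [^] ((2::nat) ^ s)"
      using \<sigma>(2)[OF xy] xy \<sigma>j by (simp add: nat_pow_pow frobenius_add flip: jk)
  qed (use xy in auto)
  have "k = 1"
  proof (rule ccontr)
    assume "k \<noteq> 1"
    then have k2: "2 \<le> k" using k(2) by (cases k) auto
    have kn: "k \<le> n" using j(2) jk by (metis dvd_imp_le dvd_triv_left j(1) le_trans)
    have ndvd: "\<not> n dvd n - 1" "\<not> n dvd n - 1 + k"
    proof -
      show "\<not> n dvd n - 1" using k2 kn by (auto dest: dvd_imp_le)
      have "n - 1 + k = n + (k - 1)" using k2 kn by simp
      moreover have "\<not> n dvd k - 1" using k2 kn by (auto dest: dvd_imp_le)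
      ultimately show "\<not> n dvd n - 1 + k" by simp
    qed
    \<comment> \<open>The factor x^(n-1) shifts the coefficient of x^1 in (x + 1)^k, namely k, to
      the exponent n seen by the power sum. Additivity leaves only the exponents n - 1 + k and n -
      1, neither divisible by n when 2 \<le> k \<le> n.\<close>
    have "(\<Oplus>x\<in>carrier R - {\<zero>}. x [^] (n - 1) \<otimes> (x \<oplus> \<one>) [^] k)
        = (\<Oplus>x\<in>carrier R - {\<zero>}. x [^] (n - 1 + k) \<oplus> x [^] (n - 1))"
      by (intro finsum_cong') (auto simp: additive r_distr nat_pow_mult)
    also have "\<dots> = (\<Oplus>x\<in>carrier R - {\<zero>}. x [^] (n - 1 + k)) \<oplus> (\<Oplus>x\<in>carrier R - {\<zero>}. x [^] (n - 1))"
      by (intro finsum_addf) auto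
    also have "\<dots> = \<zero>" using ndvd by (simp add: power_sum[OF n_def])
    finally have "\<zero> = (if n - 1 \<le> n \<and> odd (k choose (n - (n - 1))) then \<one> else \<zero>)"
      using binomial_power_sum[OF n_def, of "n - 1" k] k2 kn by simp
    also have "n - (n - 1) = 1" using k2 kn by simp
    finally show False using k(2) one_neq_zero by simp
  qed
  then have "j = 2 ^ s" using jk by simp
  moreover have "s < m"
  proof -
    have "(2::nat) ^ s < 2 ^ m" using j(2) \<open>j = 2 ^ s\<close> card unfolding n_def
      by (metis One_nat_def Suc_pred less_Suc_eq_le zero_less_numeral zero_less_power)
    then show ?thesis by simp
  qed
  ultimately show ?thesis using that \<sigma>j by blast
qed

end

subsection \<open>Nuclei of semifields of characteristic two\<close>

context presemifield
begin

lemma zero_mult: "x \<in> carrier F \<Longrightarrow> \<zero> \<otimes> x = \<zero>"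
  using additive_zero[of "\<lambda>y. y \<otimes> x"] by (simp add: mult_closed distrib_right)

lemma mult_zero: "x \<in> carrier F \<Longrightarrow> x \<otimes> \<zero> = \<zero>"
  using additive_zero[of "\<lambda>y. x \<otimes> y"] by (simp add: mult_closed distrib_left)

end

text \<open>Exchanges the nuclei and keeps the carrier and the addition, so results about the left
  nucleus and left bases turn into their right-hand versions.\<close>

definition opposite :: "('a, 'm) ring_scheme \<Rightarrow> ('a, 'm) ring_scheme" where
  "opposite F = F\<lparr>mult := \<lambda>x y. y \<otimes>\<^bsub>F\<^esub> x\<rparr>"

lemma opposite_simps [simp]:
  "carrier (opposite F) = carrier F" "x \<otimes>\<^bsub>opposite F\<^esub> y = y \<otimes>\<^bsub>F\<^esub> x"
  "\<one>\<^bsub>opposite F\<^esub> = \<one>\<^bsub>F\<^esub>" "\<zero>\<^bsub>opposite F\<^esub> = \<zero>\<^bsub>F\<^esub>"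
  "(\<oplus>\<^bsub>opposite F\<^esub>) = (\<oplus>\<^bsub>F\<^esub>)"
  by (simp_all add: opposite_def)

lemma finsum_opposite: "finsum (opposite F) = finsum F"
  by (simp add: fun_eq_iff finsum_def finprod_def)

lemma left_nucleus_opposite: "left_nucleus (opposite F) = right_nucleus F"
  unfolding left_nucleus_def right_nucleus_def by auto

lemma quadratic_over_left_nucleus_opposite:
  "quadratic_over_left_nucleus (opposite F) = quadratic_over_right_nucleus F"
  unfolding quadratic_over_left_nucleus_def quadratic_over_right_nucleus_def
    left_basis_def right_basis_def left_nucleus_opposite finsum_opposite by simp

locale char_two_semifield = semifield F for F (structure) +
  assumes one_plus_one: "\<one> \<oplus> \<one> = \<zero>" and one_neq_zero: "\<one> \<noteq> \<zero>"
begin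

sublocale two_torsion_group F
proof
  fix x assume x: "x \<in> carrier F"
  have "x \<oplus> x = (\<one> \<oplus> \<one>) \<otimes> x" using x by (simp only: distrib_right one_mult one_in_carrier)
  then show "x \<oplus> x = \<zero>" using x by (simp add: one_plus_one zero_mult)
qed

lemma char_two_semifield_opposite: "char_two_semifield (opposite F)"
proof -
  have "abelian_group (opposite F)"
    by (rule abelian_groupI) (use a_assoc a_comm double in auto)
  then show ?thesis
    by (intro char_two_semifield.intro char_two_semifield_axioms.intro semifield.intro
        semifield_axioms.intro presemifield.intro presemifield_axioms.intro)
      (auto simp: finite_carrier mult_closed distrib_left distrib_right one_in_carrier one_mult mult_one
        one_plus_one one_neq_zero dest: no_zero_divisors)
qed

lemma mult_left_cancel:
  assumes "a \<in> carrier F" "b \<in> carrier F" "c \<in> carrier F" "a \<noteq> \<zero>" "a \<otimes> b = a \<otimes> c"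
  shows "b = c"
proof -
  have "a \<otimes> (b \<oplus> c) = \<zero>" using assms by (simp add: distrib_left double mult_closed)
  then have "b \<oplus> c = \<zero>" using no_zero_divisors[of a "b \<oplus> c"] assms by auto
  then show ?thesis using assms sum_eq_zero_iff by blast
qed

lemma mult_right_cancel:
  assumes "a \<in> carrier F" "b \<in> carrier F" "c \<in> carrier F" "a \<noteq> \<zero>" "b \<otimes> a = c \<otimes> a"
  shows "b = c"
proof -
  have "(b \<oplus> c) \<otimes> a = \<zero>" using assms by (simp add: distrib_right double mult_closed)
  then have "b \<oplus> c = \<zero>" using no_zero_divisors[of "b \<oplus> c" a] assms by auto
  then show ?thesis using assms sum_eq_zero_iff by blast
qed

lemma left_nucleus_carrier: "x \<in> left_nucleus F \<Longrightarrow> x \<in> carrier F"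
  by (simp add: left_nucleus_def)

lemma left_nucleus_assoc:
  "x \<in> left_nucleus F \<Longrightarrow> y \<in> carrier F \<Longrightarrow> w \<in> carrier F \<Longrightarrow> (x \<otimes> y) \<otimes> w = x \<otimes> (y \<otimes> w)"
  by (simp add: left_nucleus_def)

lemma left_nucleus_add: "x \<in> left_nucleus F \<Longrightarrow> y \<in> left_nucleus F \<Longrightarrow> x \<oplus> y \<in> left_nucleus F"
  by (simp add: left_nucleus_def distrib_right mult_closed)

lemma left_nucleus_mult:
  assumes "x \<in> left_nucleus F" "y \<in> left_nucleus F"
  shows "x \<otimes> y \<in> left_nucleus F"
proof -
  note c = assms[THEN left_nucleus_carrier]
  have "(x \<otimes> y) \<otimes> (z \<otimes> w) = ((x \<otimes> y) \<otimes> z) \<otimes> w" if zw: "z \<in> carrier F" "w \<in> carrier F" for z w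
  proof -
    have "(x \<otimes> y) \<otimes> (z \<otimes> w) = x \<otimes> ((y \<otimes> z) \<otimes> w)"
      using left_nucleus_assoc assms c zw mult_closed by simp
    also have "\<dots> = (x \<otimes> (y \<otimes> z)) \<otimes> w"
      by (rule left_nucleus_assoc[symmetric]) (use assms c zw mult_closed in auto)
    also have "x \<otimes> (y \<otimes> z) = (x \<otimes> y) \<otimes> z"
      by (rule left_nucleus_assoc[symmetric]) (use assms c zw in auto)
    finally show ?thesis .
  qed
  then show ?thesis using c mult_closed by (simp add: left_nucleus_def)
qed

lemma one_left_nucleus: "\<one> \<in> left_nucleus F"
  by (simp add: left_nucleus_def one_in_carrier one_mult mult_closed)

lemma zero_left_nucleus: "\<zero> \<in> left_nucleus F"
  by (simp add: left_nucleus_def zero_mult mult_closed)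

lemma finite_left_nucleus: "finite (left_nucleus F)"
  using finite_subset[OF _ finite_carrier] left_nucleus_carrier by blast

lemma char_two_division_ring_left_nucleus: "char_two_division_ring (F\<lparr>carrier := left_nucleus F\<rparr>)"
proof -
  let ?N = "F\<lparr>carrier := left_nucleus F\<rparr>"
  have "abelian_group ?N"
    by (rule abelian_groupI)
      (auto simp: left_nucleus_add zero_left_nucleus left_nucleus_carrier a_ac double intro!: bexI)
  moreover have "monoid ?N"
    by (rule monoidI)
      (auto simp: left_nucleus_mult one_left_nucleus left_nucleus_carrier left_nucleus_assoc one_mult mult_one)
  ultimately have "ring ?N"
    by (rule ringI) (auto simp: left_nucleus_carrier distrib_left distrib_right)
  then show ?thesis
    by (intro char_two_division_ring.intro char_two_division_ring_axioms.intro)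
      (auto simp: finite_left_nucleus one_neq_zero one_plus_one
        dest: no_zero_divisors[OF left_nucleus_carrier left_nucleus_carrier])
qed

lemma left_nucleus_comm: "x \<in> left_nucleus F \<Longrightarrow> y \<in> left_nucleus F \<Longrightarrow> x \<otimes> y = y \<otimes> x"
proof -
  interpret N: char_two_division_ring "F\<lparr>carrier := left_nucleus F\<rparr>"
    by (rule char_two_division_ring_left_nucleus)
  show "x \<in> left_nucleus F \<Longrightarrow> y \<in> left_nucleus F \<Longrightarrow> x \<otimes> y = y \<otimes> x"
    using N.m_comm by simp
qed

lemma left_nucleus_inverse:
  assumes "x \<in> left_nucleus F" "x \<noteq> \<zero>"
  obtains y where "y \<in> left_nucleus F" "y \<otimes> x = \<one>"
proof -
  interpret N: char_two_division_ring "F\<lparr>carrier := left_nucleus F\<rparr>"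
    by (rule char_two_division_ring_left_nucleus)
  show ?thesis using N.obtain_inverse[of x] assms that by auto
qed

text \<open>The left nucleus is a field that associates from the left, so \<open>F\<close> is a left
  vector space over it, and a vector off the line of \<open>u\<close> is independent of
  \<open>u\<close>. Injectivity is kept separate because the bound on a proper nucleus uses it
  before the dimension is known.\<close>

lemma left_coordinates:
  assumes u: "u \<in> carrier F" "u \<noteq> \<zero>" and v: "v \<in> carrier F" "v \<notin> (\<lambda>a. a \<otimes> u) ` left_nucleus F"
  shows left_coordinates_inj: "inj_on (\<lambda>(a, b). a \<otimes> u \<oplus> b \<otimes> v) (left_nucleus F \<times> left_nucleus F)"
    and left_coordinates_bij: "card (carrier F) = (card (left_nucleus F))\<^sup>2 \<Longrightarrow>
      bij_betw (\<lambda>(a, b). a \<otimes> u \<oplus> b \<otimes> v) (left_nucleus F \<times> left_nucleus F) (carrier F)"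
proof -
  let ?N = "left_nucleus F" and ?f = "\<lambda>(a, b). a \<otimes> u \<oplus> b \<otimes> v"
  show inj: "inj_on ?f (?N \<times> ?N)"
  proof (rule inj_onI, clarify)
    fix a b a' b' assume N: "a \<in> ?N" "b \<in> ?N" "a' \<in> ?N" "b' \<in> ?N"
      and eq: "a \<otimes> u \<oplus> b \<otimes> v = a' \<otimes> u \<oplus> b' \<otimes> v"
    note c = N[THEN left_nucleus_carrier]
    have m: "a \<otimes> u \<in> carrier F" "b \<otimes> v \<in> carrier F" "a' \<otimes> u \<in> carrier F" "b' \<otimes> v \<in> carrier F"
      using c u v mult_closed by auto
    have "(a \<oplus> a') \<otimes> u \<oplus> (b \<oplus> b') \<otimes> v = (a \<otimes> u \<oplus> b \<otimes> v) \<oplus> (a' \<otimes> u \<oplus> b' \<otimes> v)"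
      using c u v m by (simp add: distrib_right a_ac)
    also have "\<dots> = \<zero>" unfolding eq using m by (simp add: double)
    finally have s: "(b \<oplus> b') \<otimes> v = (a \<oplus> a') \<otimes> u"
      using sum_eq_zero_iff[of "(a \<oplus> a') \<otimes> u" "(b \<oplus> b') \<otimes> v"] c u v mult_closed by auto
    have "b \<oplus> b' = \<zero>"
    proof (rule ccontr)
      assume "b \<oplus> b' \<noteq> \<zero>"
      then obtain d where d: "d \<in> ?N" "d \<otimes> (b \<oplus> b') = \<one>"
        using left_nucleus_inverse[of "b \<oplus> b'"] N left_nucleus_add by metis
      have "v = (d \<otimes> (b \<oplus> b')) \<otimes> v" using d v by (simp add: one_mult)
      also have "\<dots> = d \<otimes> ((b \<oplus> b') \<otimes> v)" by (rule left_nucleus_assoc) (use d c v in auto)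
      also note s
      also have "d \<otimes> ((a \<oplus> a') \<otimes> u) = (d \<otimes> (a \<oplus> a')) \<otimes> u" using d c u left_nucleus_assoc by simp
      finally show False using v d N left_nucleus_mult left_nucleus_add by auto
    qed
    then have b: "b = b'" using sum_eq_zero_iff c by simp
    then have "a \<otimes> u = a' \<otimes> u" using eq m by simp
    then have "a = a'" using mult_right_cancel[of u a a'] u c by simp
    then show "a = a' \<and> b = b'" using b by simp
  qed
  assume card: "card (carrier F) = (card ?N)\<^sup>2"
  have "?f ` (?N \<times> ?N) \<subseteq> carrier F" using u v mult_closed left_nucleus_carrier by auto
  moreover have "card (?f ` (?N \<times> ?N)) = card (carrier F)"
    using card_image[OF inj] card by (simp add: card_cartesian_product power2_eq_square)
  ultimately have "?f ` (?N \<times> ?N) = carrier F" by (rule card_subset_eq[OF finite_carrier])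
  then show "bij_betw ?f (?N \<times> ?N) (carrier F)" using inj by (simp add: bij_betw_def)
qed

text \<open>Reduces bases to counting. Conversely, a nucleus of square-root order is a proper subset
  because it contains 0 and 1, and 1 together with any element outside it is a basis.\<close>

lemma quadratic_over_left_nucleus_iff:
  "quadratic_over_left_nucleus F \<longleftrightarrow> card (carrier F) = (card (left_nucleus F))\<^sup>2" (is "?Q \<longleftrightarrow> ?C")
proof
  let ?N = "left_nucleus F"
  assume ?Q
  then obtain E where E: "left_basis F E" "card E = 2" unfolding quadratic_over_left_nucleus_def by auto
  then have fin: "finite E" and sub: "E \<subseteq> carrier F"
    and ex1: "\<And>x. x \<in> carrier F \<Longrightarrow> \<exists>!c. c \<in> E \<rightarrow>\<^sub>E ?N \<and> x = (\<Oplus>e\<in>E. c e \<otimes> e)"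
    unfolding left_basis_def by auto
  let ?f = "\<lambda>c. \<Oplus>e\<in>E. c e \<otimes> e"
  have closed: "?f c \<in> carrier F" if "c \<in> E \<rightarrow>\<^sub>E ?N" for c
  proof (rule finsum_closed)
    show "(\<lambda>e. c e \<otimes> e) \<in> E \<rightarrow> carrier F"
      using that sub mult_closed left_nucleus_carrier by (auto simp: PiE_iff subset_iff)
  qed
  have "bij_betw ?f (E \<rightarrow>\<^sub>E ?N) (carrier F)"
    unfolding bij_betw_def
  proof
    show "inj_on ?f (E \<rightarrow>\<^sub>E ?N)"
    proof (rule inj_onI)
      fix c d assume cd: "c \<in> E \<rightarrow>\<^sub>E ?N" "d \<in> E \<rightarrow>\<^sub>E ?N" "?f c = ?f d"
      then show "c = d" using ex1[OF closed[OF cd(1)]] by metis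
    qed
    show "?f ` (E \<rightarrow>\<^sub>E ?N) = carrier F"
    proof
      show "carrier F \<subseteq> ?f ` (E \<rightarrow>\<^sub>E ?N)" using ex1 by blast
    qed (use closed in auto)
  qed
  then have "card (E \<rightarrow>\<^sub>E ?N) = card (carrier F)" by (rule bij_betw_same_card)
  then show ?C using E(2) fin by (simp add: card_PiE)
next
  let ?N = "left_nucleus F"
  assume C: ?C
  have "card {\<zero>, \<one>} \<le> card ?N"
    using one_left_nucleus zero_left_nucleus finite_left_nucleus by (intro card_mono) auto
  then have "2 \<le> card ?N" using one_neq_zero by simp
  then have "card ?N < card (carrier F)" unfolding C by (simp add: power2_eq_square)
  then have "?N \<noteq> carrier F" by auto
  then obtain w where w: "w \<in> carrier F" "w \<notin> ?N" using left_nucleus_carrier by blast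
  have w1: "\<one> \<noteq> w" using w one_left_nucleus by auto
  have bij: "bij_betw (\<lambda>(a, b). a \<otimes> \<one> \<oplus> b \<otimes> w) (?N \<times> ?N) (carrier F)"
    using left_coordinates_bij[of \<one> w] C w one_in_carrier one_neq_zero
    by (auto simp: mult_one left_nucleus_carrier)
  have sum: "(\<Oplus>e\<in>{\<one>, w}. c e \<otimes> e) = c \<one> \<otimes> \<one> \<oplus> c w \<otimes> w" if "c \<in> {\<one>, w} \<rightarrow>\<^sub>E ?N" for c
  proof -
    have "c \<one> \<in> ?N" "c w \<in> ?N" using that by auto
    then have "c \<one> \<otimes> \<one> \<in> carrier F" "c w \<otimes> w \<in> carrier F"
      using left_nucleus_carrier mult_closed w one_in_carrier by auto
    then show ?thesis using w1 by simp
  qed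
  have "\<exists>!c. c \<in> {\<one>, w} \<rightarrow>\<^sub>E ?N \<and> x = (\<Oplus>e\<in>{\<one>, w}. c e \<otimes> e)" if x: "x \<in> carrier F" for x
  proof -
    have "x \<in> (\<lambda>(a, b). a \<otimes> \<one> \<oplus> b \<otimes> w) ` (?N \<times> ?N)" using bij x by (simp add: bij_betw_def)
    then obtain a b where ab: "a \<in> ?N" "b \<in> ?N" "x = a \<otimes> \<one> \<oplus> b \<otimes> w" by auto
    let ?c = "\<lambda>e. if e = \<one> then a else if e = w then b else undefined"
    have c: "?c \<in> {\<one>, w} \<rightarrow>\<^sub>E ?N" using ab by (auto simp: PiE_iff extensional_def)
    show ?thesis
    proof (rule ex1I[of _ ?c])
      show "?c \<in> {\<one>, w} \<rightarrow>\<^sub>E ?N \<and> x = (\<Oplus>e\<in>{\<one>, w}. ?c e \<otimes> e)"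
        using c sum[OF c] ab w1 by auto
      fix d assume d: "d \<in> {\<one>, w} \<rightarrow>\<^sub>E ?N \<and> x = (\<Oplus>e\<in>{\<one>, w}. d e \<otimes> e)"
      then have "d \<one> \<in> ?N" "d w \<in> ?N" "d \<one> \<otimes> \<one> \<oplus> d w \<otimes> w = a \<otimes> \<one> \<oplus> b \<otimes> w" using ab(3) sum[of d] by auto
      then have "(d \<one>, d w) = (a, b)"
        using inj_onD[OF bij_betw_imp_inj_on[OF bij], of "(d \<one>, d w)" "(a, b)"] ab(1,2) by simp
      then show "d = ?c" using d by (auto simp: PiE_iff extensional_def fun_eq_iff)
    qed
  qed
  then have "left_basis F {\<one>, w}" using w one_in_carrier unfolding left_basis_def by auto
  then show ?Q using w1 unfolding quadratic_over_left_nucleus_def by (intro exI[of _ "{\<one>, w}"]) simp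
qed

lemma quadratic_over_right_nucleus_iff:
  "quadratic_over_right_nucleus F \<longleftrightarrow> card (carrier F) = (card (right_nucleus F))\<^sup>2"
  using char_two_semifield.quadratic_over_left_nucleus_iff[OF char_two_semifield_opposite]
  by (simp add: left_nucleus_opposite quadratic_over_left_nucleus_opposite)

end

lemma (in semifield) characteristic_eq_two_iff: "characteristic F = 2 \<longleftrightarrow> char_two_semifield F"
proof
  assume c: "characteristic F = 2"
  have "add_pow F (2::nat) \<one> = \<zero>"
    using add.pow_ord_eq_1[OF one_in_carrier] c unfolding characteristic_def by simp
  then have "\<one> \<oplus> \<one> = \<zero>" using one_in_carrier by (simp add: numeral_2_eq_2)
  moreover have "\<one> \<noteq> \<zero>"
  proof
    assume "\<one> = \<zero>"
    then show False using c group.ord_eq_1[OF a_group, of \<one>] one_in_carrier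
      unfolding characteristic_def by simp
  qed
  ultimately show "char_two_semifield F"
    by (intro char_two_semifield.intro char_two_semifield_axioms.intro semifield_axioms)
next
  assume "char_two_semifield F"
  then interpret char_two_semifield F .
  have "add_pow F (2::nat) \<one> = \<zero>" using one_in_carrier by (simp add: numeral_2_eq_2 one_plus_one)
  then have "group.ord (add_monoid F) \<one> dvd 2"
    using group.pow_eq_id[OF a_group, of \<one> 2] one_in_carrier by (simp add: add_pow_def)
  moreover have "group.ord (add_monoid F) \<one> \<noteq> 1"
    using group.ord_eq_1[OF a_group, of \<one>] one_in_carrier one_neq_zero by simp
  ultimately show "characteristic F = 2" unfolding characteristic_def
    using two_is_prime_nat by (auto simp: prime_nat_iff)
qed

subsection \<open>From nuclei to a presemifield \<open>B\<close>\<close>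

lemma B_presemifield_simps:
  fixes L (structure)
  shows "carrier (B_presemifield L s (p\<^sub>1, p\<^sub>2, p\<^sub>3, p\<^sub>4)) = carrier L \<times> carrier L"
    and "(a, b) \<oplus>\<^bsub>B_presemifield L s (p\<^sub>1, p\<^sub>2, p\<^sub>3, p\<^sub>4)\<^esub> (a', b') = (a \<oplus> a', b \<oplus> b')"
    and "\<zero>\<^bsub>B_presemifield L s (p\<^sub>1, p\<^sub>2, p\<^sub>3, p\<^sub>4)\<^esub> = (\<zero>, \<zero>)"
    and "(a, b) \<otimes>\<^bsub>B_presemifield L s (p\<^sub>1, p\<^sub>2, p\<^sub>3, p\<^sub>4)\<^esub> (c, d) =
      (p\<^sub>1 \<otimes> a \<otimes> c [^] ((2::nat) ^ s) \<oplus> p\<^sub>2 \<otimes> b \<otimes> c [^] ((2::nat) ^ s) \<oplus>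
       p\<^sub>3 \<otimes> a \<otimes> d [^] ((2::nat) ^ s) \<oplus> p\<^sub>4 \<otimes> b \<otimes> d [^] ((2::nat) ^ s), a \<otimes> d \<oplus> b \<otimes> c)"
  by (simp_all add: B_presemifield_def Let_def)

context char_two_semifield
begin

lemmas right_nucleus_carrier =
    char_two_semifield.left_nucleus_carrier[OF char_two_semifield_opposite, simplified left_nucleus_opposite opposite_simps]
  and right_nucleus_assoc =
    char_two_semifield.left_nucleus_assoc[OF char_two_semifield_opposite, simplified left_nucleus_opposite opposite_simps]
  and right_nucleus_add =
    char_two_semifield.left_nucleus_add[OF char_two_semifield_opposite, simplified left_nucleus_opposite opposite_simps]
  and right_nucleus_mult =
    char_two_semifield.left_nucleus_mult[OF char_two_semifield_opposite, simplified left_nucleus_opposite opposite_simps]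
  and one_right_nucleus =
    char_two_semifield.one_left_nucleus[OF char_two_semifield_opposite, simplified left_nucleus_opposite opposite_simps]
  and finite_right_nucleus =
    char_two_semifield.finite_left_nucleus[OF char_two_semifield_opposite, simplified left_nucleus_opposite opposite_simps]
  and char_two_division_ring_right_nucleus =
    char_two_semifield.char_two_division_ring_left_nucleus[OF char_two_semifield_opposite, simplified left_nucleus_opposite]

end

section \<open>Simultaneous eigenvectors of the right nucleus\<close>

locale biquadratic_semifield = char_two_semifield F for F (structure) +
  assumes card_left: "card (carrier F) = (card (left_nucleus F))\<^sup>2"
    and card_right: "card (carrier F) = (card (right_nucleus F))\<^sup>2"
begin

lemma card_nuclei: "card (left_nucleus F) = card (right_nucleus F)"
  using card_left card_right by simp

text \<open>Equivalently, the left line spanned by \<open>y\<close> over the left nucleus is stable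
  under right multiplication by the right nucleus. Zero is allowed.\<close>

definition eigen :: "'a \<Rightarrow> bool" where
  "eigen y \<longleftrightarrow> y \<in> carrier F \<and> (\<forall>r\<in>right_nucleus F. \<exists>l\<in>left_nucleus F. y \<otimes> r = l \<otimes> y)"

text \<open>The Fourier lemma for left multiplication by the inverse of a generator of the left
  nucleus and right multiplication by a generator of the right nucleus. They commute because nuclear
  elements associate, and equal orders of the nuclei give a common n. An eigenvector for the
  generator is one for all its powers, hence for the whole right nucleus.\<close>

lemma eigen_generate:
  assumes P0: "P \<zero>"
    and Padd: "\<And>x y. x \<in> carrier F \<Longrightarrow> y \<in> carrier F \<Longrightarrow> P x \<Longrightarrow> P y \<Longrightarrow> P (x \<oplus> y)"
    and Peig: "\<And>y. eigen y \<Longrightarrow> P y"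
    and v: "v \<in> carrier F"
  shows "P v"
proof -
  let ?N = "F\<lparr>carrier := left_nucleus F\<rparr>" and ?M = "(opposite F)\<lparr>carrier := right_nucleus F\<rparr>"
  interpret N: char_two_division_ring ?N by (rule char_two_division_ring_left_nucleus)
  interpret M: char_two_division_ring ?M by (rule char_two_division_ring_right_nucleus)
  define n where "n = card (left_nucleus F) - 1"
  obtain h where h: "h \<in> left_nucleus F" "h \<noteq> \<zero>" "odd n" "h [^]\<^bsub>?N\<^esub> n = \<one>"
    "\<And>i. 0 < i \<Longrightarrow> i < n \<Longrightarrow> h [^]\<^bsub>?N\<^esub> i \<noteq> \<one>"
    using N.obtain_generator unfolding n_def by auto
  obtain g where g: "g \<in> right_nucleus F" "g [^]\<^bsub>?M\<^esub> n = \<one>"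
    "bij_betw (\<lambda>i. g [^]\<^bsub>?M\<^esub> i) {..<n} (right_nucleus F - {\<zero>})"
    using M.obtain_generator unfolding n_def card_nuclei by auto
  obtain b where b: "b \<in> left_nucleus F" "h \<otimes> b = \<one>"
    using N.obtain_inverse[of h] h(1,2) by auto
  note hc = left_nucleus_carrier[OF h(1)] and bc = left_nucleus_carrier[OF b(1)]
    and gc = right_nucleus_carrier[OF g(1)]
  define hp where "hp i = h [^]\<^bsub>?N\<^esub> i" for i :: nat
  define gp where "gp i = g [^]\<^bsub>?M\<^esub> i" for i :: nat
  have hp: "hp i \<in> left_nucleus F" "hp (Suc i) = hp i \<otimes> h" for i
    unfolding hp_def using N.nat_pow_closed[of h i] h(1) by simp_all
  \<comment> \<open>Powers in \<open>?M\<close> are formed with the opposite product, so peeling a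
    factor off the left there yields a right factor in \<open>F\<close>.\<close>
  have gp: "gp i \<in> right_nucleus F" "gp (Suc i) = gp i \<otimes> g" for i
    unfolding gp_def using M.nat_pow_closed[of g i] M.nat_pow_Suc2[of g i] g(1) by simp_all
  have Uc: "((\<otimes>) b ^^ i) x \<in> carrier F" if "x \<in> carrier F" for x i
    using that bc mult_closed by (induction i) auto
  have hU: "hp i \<otimes> ((\<otimes>) b ^^ i) x = x" if x: "x \<in> carrier F" for x i
  proof (induction i)
    case 0
    show ?case using x by (simp add: hp_def one_mult)
  next
    case (Suc i)
    let ?y = "((\<otimes>) b ^^ i) x"
    have y: "?y \<in> carrier F" using Uc[OF x] .
    have "hp (Suc i) \<otimes> (b \<otimes> ?y) = hp i \<otimes> (h \<otimes> (b \<otimes> ?y))"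
      unfolding hp(2) by (rule left_nucleus_assoc[OF hp(1) hc]) (use bc y mult_closed in auto)
    also have "h \<otimes> (b \<otimes> ?y) = (h \<otimes> b) \<otimes> ?y" by (rule left_nucleus_assoc[OF h(1) bc y, symmetric])
    also have "\<dots> = ?y" using b(2) y by (simp add: one_mult)
    finally show ?case using Suc by simp
  qed
  have Tg: "((\<lambda>x. x \<otimes> g) ^^ i) x = x \<otimes> gp i" if x: "x \<in> carrier F" for x i
  proof (induction i)
    case 0
    show ?case using x by (simp add: gp_def mult_one)
  next
    case (Suc i)
    then show ?case using right_nucleus_assoc[OF g(1) right_nucleus_carrier[OF gp(1)] x] gp(2) by simp
  qed
  show ?thesis
  proof (rule eigenvectors_generate[of "(\<otimes>) b" "\<lambda>x. x \<otimes> g" n P, OF _ _ _ _ _ h(3)])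
    show "b \<otimes> (x \<otimes> g) = (b \<otimes> x) \<otimes> g" if "x \<in> carrier F" for x
      using left_nucleus_assoc[OF b(1) that gc] by simp
    show "((\<otimes>) b ^^ n) x = x" if "x \<in> carrier F" for x
      using hU[OF that, of n] h(4) Uc[OF that] by (simp add: hp_def one_mult)
    show "((\<lambda>x. x \<otimes> g) ^^ n) x = x" if "x \<in> carrier F" for x
      using Tg[OF that, of n] g(2) that by (simp add: gp_def mult_one)
    show "x = \<zero>" if x: "x \<in> carrier F" "0 < i" "i < n" "((\<otimes>) b ^^ i) x = x" for x i
    proof (rule ccontr)
      assume "x \<noteq> \<zero>"
      moreover have "hp i \<otimes> x = \<one> \<otimes> x" using hU[OF x(1), of i] x(4) x(1) by (simp add: one_mult)
      ultimately have "hp i = \<one>"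
        using mult_right_cancel[of x "hp i" \<one>] x(1) left_nucleus_carrier[OF hp(1)] one_in_carrier by simp
      then show False using h(5)[OF x(2,3)] by (simp add: hp_def)
    qed
    show "P y" if y: "y \<in> carrier F" "j < n" "((\<otimes>) b ^^ j) (y \<otimes> g) = y" for y j
    proof (rule Peig)
      have yg: "y \<otimes> g = hp j \<otimes> y" using hU[of "y \<otimes> g" j] y mult_closed gc by simp
      have pow: "\<exists>l\<in>left_nucleus F. y \<otimes> gp i = l \<otimes> y" for i
      proof (induction i)
        case 0
        show ?case using one_left_nucleus y(1)
          by (intro bexI[of _ \<one>]) (simp_all add: gp_def one_mult mult_one)
      next
        case (Suc i)
        then obtain l where l: "l \<in> left_nucleus F" "y \<otimes> gp i = l \<otimes> y" by blast
        have "y \<otimes> gp (Suc i) = (y \<otimes> gp i) \<otimes> g"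
          using right_nucleus_assoc[OF g(1) right_nucleus_carrier[OF gp(1)] y(1), of i] gp(2) by simp
        also have "\<dots> = l \<otimes> (y \<otimes> g)" unfolding l(2) by (rule left_nucleus_assoc[OF l(1) y(1) gc])
        also have "\<dots> = (l \<otimes> hp j) \<otimes> y"
          unfolding yg by (rule left_nucleus_assoc[OF l(1) left_nucleus_carrier[OF hp(1)] y(1), symmetric])
        finally show ?case using left_nucleus_mult[OF l(1) hp(1)] by blast
      qed
      have "\<exists>l\<in>left_nucleus F. y \<otimes> r = l \<otimes> y" if r: "r \<in> right_nucleus F" for r
      proof (cases "r = \<zero>")
        case True
        then show ?thesis using y(1) zero_left_nucleus
          by (intro bexI[of _ \<zero>]) (simp_all add: zero_mult mult_zero)
      next
        case False
        then have "r \<in> (\<lambda>i. g [^]\<^bsub>?M\<^esub> i) ` {..<n}" using g(3) r by (simp add: bij_betw_def)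
        then obtain i where "r = gp i" unfolding gp_def by blast
        then show ?thesis using pow by blast
      qed
      then show "eigen y" using y(1) unfolding eigen_def by blast
    qed
  qed (use bc gc mult_closed distrib_left distrib_right P0 Padd v in auto)
qed

text \<open>Eigenvectors generate \<open>F\<close> additively, so they can lie neither all in the
  zero subgroup nor all on one line over the left nucleus, which has too few elements.\<close>

lemma obtain_eigen_pair:
  obtains u v where "eigen u" "u \<noteq> \<zero>" "eigen v" "v \<notin> (\<lambda>a. a \<otimes> u) ` left_nucleus F"
proof -
  have "\<exists>u. eigen u \<and> u \<noteq> \<zero>"
  proof (rule ccontr)
    assume neg: "\<not> ?thesis"
    have "\<one> = \<zero>"
      by (rule eigen_generate[of "\<lambda>x. x = \<zero>"]) (use neg one_in_carrier in auto)
    then show False using one_neq_zero by simp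
  qed
  then obtain u where u: "eigen u" "u \<noteq> \<zero>" by blast
  have uc: "u \<in> carrier F" using u(1) by (simp add: eigen_def)
  let ?D = "(\<lambda>a. a \<otimes> u) ` left_nucleus F"
  have "\<exists>v. eigen v \<and> v \<notin> ?D"
  proof (rule ccontr)
    assume neg: "\<not> ?thesis"
    have "x \<in> ?D" if x: "x \<in> carrier F" for x
    proof (rule eigen_generate[of "\<lambda>x. x \<in> ?D"])
      show "\<zero> \<in> ?D" using zero_left_nucleus uc by (intro image_eqI[of _ _ \<zero>]) (simp_all add: zero_mult)
      show "x \<oplus> y \<in> ?D" if "x \<in> ?D" "y \<in> ?D" for x y
      proof -
        obtain a b where "a \<in> left_nucleus F" "b \<in> left_nucleus F" "x = a \<otimes> u" "y = b \<otimes> u"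
          using \<open>x \<in> ?D\<close> \<open>y \<in> ?D\<close> by blast
        then show ?thesis using uc left_nucleus_add left_nucleus_carrier
          by (intro image_eqI[of _ _ "a \<oplus> b"]) (simp_all add: distrib_right)
      qed
    qed (use neg x in blast)+
    then have "card (carrier F) \<le> card ?D"
      using finite_left_nucleus by (intro card_mono) auto
    also have "\<dots> \<le> card (left_nucleus F)" by (rule card_image_le[OF finite_left_nucleus])
    finally have "(card (left_nucleus F))\<^sup>2 \<le> card (left_nucleus F)" unfolding card_left .
    moreover have "card {\<zero>, \<one>} \<le> card (left_nucleus F)"
      using one_left_nucleus zero_left_nucleus finite_left_nucleus by (intro card_mono) auto
    ultimately show False using one_neq_zero by (simp add: power2_eq_square)
  qed
  then show ?thesis using u that by blast
qed

text \<open>Cancelling \<open>y\<close> makes the eigenvalue unique, so every identity between right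
  multiplications becomes one for \<open>\<tau>\<close>; the order of products is kept since (y r)
  r' = \<tau>(r) (y r'). Injectivity and equal orders of the nuclei give surjectivity.\<close>

lemma eigen_character:
  assumes y: "eigen y" "y \<noteq> \<zero>"
  obtains \<tau> where "bij_betw \<tau> (right_nucleus F) (left_nucleus F)"
    "\<And>r. r \<in> right_nucleus F \<Longrightarrow> y \<otimes> r = \<tau> r \<otimes> y"
    "\<And>r r'. r \<in> right_nucleus F \<Longrightarrow> r' \<in> right_nucleus F \<Longrightarrow> \<tau> (r \<oplus> r') = \<tau> r \<oplus> \<tau> r'"
    "\<And>r r'. r \<in> right_nucleus F \<Longrightarrow> r' \<in> right_nucleus F \<Longrightarrow> \<tau> (r \<otimes> r') = \<tau> r \<otimes> \<tau> r'"
    "\<tau> \<one> = \<one>"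
proof -
  let ?N = "left_nucleus F" and ?M = "right_nucleus F"
  have yc: "y \<in> carrier F" using y(1) by (simp add: eigen_def)
  obtain \<tau> where \<tau>: "\<And>r. r \<in> ?M \<Longrightarrow> \<tau> r \<in> ?N" "\<And>r. r \<in> ?M \<Longrightarrow> y \<otimes> r = \<tau> r \<otimes> y"
    using y(1) unfolding eigen_def by metis
  have eq: "l = \<tau> r" if "r \<in> ?M" "l \<in> ?N" "y \<otimes> r = l \<otimes> y" for l r
    using mult_right_cancel[of y l "\<tau> r"] that \<tau>[of r] yc y(2) left_nucleus_carrier by simp
  have "inj_on \<tau> ?M"
  proof (rule inj_onI)
    fix r r' assume r: "r \<in> ?M" "r' \<in> ?M" "\<tau> r = \<tau> r'"
    then have "y \<otimes> r = y \<otimes> r'" using \<tau>(2) by simp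
    then show "r = r'" using mult_left_cancel[of y r r'] r yc y(2) right_nucleus_carrier by simp
  qed
  moreover from this have "\<tau> ` ?M = ?N"
    using card_image[of \<tau> ?M] card_nuclei \<tau>(1) by (intro card_subset_eq[OF finite_left_nucleus]) auto
  ultimately have bij: "bij_betw \<tau> ?M ?N" by (simp add: bij_betw_def)
  have add: "\<tau> (r \<oplus> r') = \<tau> r \<oplus> \<tau> r'" if r: "r \<in> ?M" "r' \<in> ?M" for r r'
  proof (rule eq[symmetric])
    show "y \<otimes> (r \<oplus> r') = (\<tau> r \<oplus> \<tau> r') \<otimes> y"
      using \<tau> r yc by (simp add: distrib_left distrib_right left_nucleus_carrier right_nucleus_carrier)
  qed (use r right_nucleus_add left_nucleus_add \<tau> in auto)
  have mult: "\<tau> (r \<otimes> r') = \<tau> r \<otimes> \<tau> r'" if r: "r \<in> ?M" "r' \<in> ?M" for r r'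
  proof (rule eq[symmetric])
    note rc = r[THEN right_nucleus_carrier]
    have "y \<otimes> (r \<otimes> r') = (y \<otimes> r) \<otimes> r'" by (rule right_nucleus_assoc[OF r(2) rc(1) yc])
    also have "\<dots> = \<tau> r \<otimes> (y \<otimes> r')"
      unfolding \<tau>(2)[OF r(1)] by (rule left_nucleus_assoc[OF \<tau>(1)[OF r(1)] yc rc(2)])
    also have "\<dots> = (\<tau> r \<otimes> \<tau> r') \<otimes> y"
      unfolding \<tau>(2)[OF r(2)]
        using left_nucleus_assoc[OF \<tau>(1)[OF r(1)] _ yc, of "\<tau> r'"] \<tau>(1)[OF r(2)] left_nucleus_carrier
      by simp
    finally show "y \<otimes> (r \<otimes> r') = (\<tau> r \<otimes> \<tau> r') \<otimes> y" .
  qed (use r right_nucleus_mult left_nucleus_mult \<tau> in auto)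
  have "\<tau> \<one> = \<one>"
    by (rule eq[symmetric]) (use one_left_nucleus one_right_nucleus yc one_mult mult_one in auto)
  then show ?thesis using that bij \<tau>(2) add mult by blast
qed

text \<open>If the whole of \<open>F\<close> belonged to one character, the two nuclei would coincide and be central, and
  a semifield of dimension two over a central nucleus is associative.\<close>

lemma nuclei_not_central:
  assumes sub: "right_nucleus F \<subseteq> left_nucleus F"
    and central: "\<And>d x. d \<in> right_nucleus F \<Longrightarrow> x \<in> carrier F \<Longrightarrow> x \<otimes> d = d \<otimes> x"
  shows False
proof -
  let ?N = "left_nucleus F"
  have eq: "right_nucleus F = ?N"
    by (rule card_subset_eq[OF finite_left_nucleus sub]) (simp add: card_nuclei)
  note c = left_nucleus_carrier
  have dl: "(d \<otimes> x) \<otimes> y = d \<otimes> (x \<otimes> y)" if "d \<in> ?N" "x \<in> carrier F" "y \<in> carrier F" for d x y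
    by (rule left_nucleus_assoc[OF that])
  have dr: "x \<otimes> (d \<otimes> y) = d \<otimes> (x \<otimes> y)" if d: "d \<in> ?N" "x \<in> carrier F" "y \<in> carrier F" for d x y
  proof -
    have "x \<otimes> (d \<otimes> y) = x \<otimes> (y \<otimes> d)" using central[of d y] d eq by simp
    also have "\<dots> = (x \<otimes> y) \<otimes> d" by (rule right_nucleus_assoc) (use d eq in auto)
    finally show ?thesis using central[of d "x \<otimes> y"] d eq mult_closed by simp
  qed
  have "card {\<zero>, \<one>} \<le> card ?N"
    using one_left_nucleus zero_left_nucleus finite_left_nucleus by (intro card_mono) auto
  then have "2 \<le> card ?N" using one_neq_zero by simp
  then have "card ?N < card (carrier F)" unfolding card_left by (simp add: power2_eq_square)
  then have "?N \<noteq> carrier F" by auto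
  then obtain w where w: "w \<in> carrier F" "w \<notin> ?N" using c by blast
  have span: "\<exists>a\<in>?N. \<exists>b\<in>?N. x = a \<oplus> b \<otimes> w" if x: "x \<in> carrier F" for x
  proof -
    have "bij_betw (\<lambda>(a, b). a \<otimes> \<one> \<oplus> b \<otimes> w) (?N \<times> ?N) (carrier F)"
      using left_coordinates_bij[of \<one> w] card_left w one_in_carrier one_neq_zero
      by (auto simp: mult_one c)
    then have "x \<in> (\<lambda>(a, b). a \<otimes> \<one> \<oplus> b \<otimes> w) ` (?N \<times> ?N)" using x by (simp add: bij_betw_def)
    then obtain a b where "a \<in> ?N" "b \<in> ?N" "x = a \<otimes> \<one> \<oplus> b \<otimes> w" by auto
    then show ?thesis using c mult_one by auto
  qed
  have ww: "w \<otimes> w \<in> carrier F" using w mult_closed by simp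
  \<comment> \<open>Associativity is extended by linearity from the triple w, w, w to w, w, z and to
    w, y, z; the last form puts \<open>w\<close> into the left nucleus, against its choice.\<close>
  have w3: "w \<otimes> (w \<otimes> w) = (w \<otimes> w) \<otimes> w"
  proof -
    obtain p q where pq: "p \<in> ?N" "q \<in> ?N" "w \<otimes> w = p \<oplus> q \<otimes> w" using span[OF ww] by blast
    note cc = pq(1,2)[THEN c]
    have "w \<otimes> (p \<oplus> q \<otimes> w) = p \<otimes> w \<oplus> q \<otimes> (w \<otimes> w)"
      using cc w dr[OF pq(2) w(1) w(1)] central[of p w] pq(1) eq by (simp add: distrib_left mult_closed)
    moreover have "(p \<oplus> q \<otimes> w) \<otimes> w = p \<otimes> w \<oplus> q \<otimes> (w \<otimes> w)"
      using cc w dl[OF pq(2) w(1) w(1)] by (simp add: distrib_right mult_closed)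
    ultimately show ?thesis using pq(3) by simp
  qed
  have wwz: "w \<otimes> (w \<otimes> z) = (w \<otimes> w) \<otimes> z" if z: "z \<in> carrier F" for z
  proof -
    obtain p q where pq: "p \<in> ?N" "q \<in> ?N" "z = p \<oplus> q \<otimes> w" using span[OF z] by blast
    note cc = pq(1,2)[THEN c]
    have "w \<otimes> z = p \<otimes> w \<oplus> q \<otimes> (w \<otimes> w)"
      unfolding pq(3) using cc w dr[OF pq(2) w(1) w(1)] central[of p w] pq(1) eq
      by (simp add: distrib_left mult_closed)
    then have "w \<otimes> (w \<otimes> z) = p \<otimes> (w \<otimes> w) \<oplus> q \<otimes> (w \<otimes> (w \<otimes> w))"
      using cc w ww dr[OF pq(1) w(1) w(1)] dr[OF pq(2) w(1) ww] by (simp add: distrib_left mult_closed)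
    moreover have "(w \<otimes> w) \<otimes> z = p \<otimes> (w \<otimes> w) \<oplus> q \<otimes> ((w \<otimes> w) \<otimes> w)"
      unfolding pq(3) using cc w ww dr[OF pq(2) ww w(1)] central[of p "w \<otimes> w"] pq(1) eq
      by (simp add: distrib_left mult_closed)
    ultimately show ?thesis using w3 by simp
  qed
  have "w \<otimes> (y \<otimes> z) = (w \<otimes> y) \<otimes> z" if yz: "y \<in> carrier F" "z \<in> carrier F" for y z
  proof -
    obtain p q where pq: "p \<in> ?N" "q \<in> ?N" "y = p \<oplus> q \<otimes> w" using span[OF yz(1)] by blast
    note cc = pq(1,2)[THEN c]
    have wz: "w \<otimes> z \<in> carrier F" using w yz mult_closed by simp
    have "y \<otimes> z = p \<otimes> z \<oplus> q \<otimes> (w \<otimes> z)"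
      unfolding pq(3) using cc w yz dl[OF pq(2) w(1) yz(2)] by (simp add: distrib_right mult_closed)
    then have "w \<otimes> (y \<otimes> z) = p \<otimes> (w \<otimes> z) \<oplus> q \<otimes> (w \<otimes> (w \<otimes> z))"
      using cc w yz wz dr[OF pq(1) w(1) yz(2)] dr[OF pq(2) w(1) wz] by (simp add: distrib_left mult_closed)
    moreover have "w \<otimes> y = p \<otimes> w \<oplus> q \<otimes> (w \<otimes> w)"
      unfolding pq(3) using cc w dr[OF pq(2) w(1) w(1)] central[of p w] pq(1) eq
      by (simp add: distrib_left mult_closed)
    then have "(w \<otimes> y) \<otimes> z = p \<otimes> (w \<otimes> z) \<oplus> q \<otimes> ((w \<otimes> w) \<otimes> z)"
      using cc w ww yz dl[OF pq(1) w(1) yz(2)] dl[OF pq(2) ww yz(2)] by (simp add: distrib_right mult_closed)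
    ultimately show ?thesis using wwz[OF yz(2)] by simp
  qed
  then have "w \<in> ?N" using w by (simp add: left_nucleus_def)
  then show False using w by simp
qed

text \<open>The coordinates: \<open>\<pi>\<^sub>1\<close>, \<open>\<pi>\<^sub>2\<close> with respect to the eigenvectors \<open>u\<close>, \<open>v\<close> describe the product,
  and the right factor is \<open>y = c' \<oplus> w \<otimes> d'\<close>, where
  \<open>c'\<close>, \<open>d'\<close> correspond to \<open>c\<close>, \<open>d\<close> under the isomorphism of the nuclei given by \<open>v\<close>. The left factor \<open>x\<close> gets the coordinates
  \<open>(\<pi>\<^sub>2 (x \<otimes> w), \<pi>\<^sub>2 x)\<close>, which turns the second coordinate of the product into \<open>a d + b c\<close>.\<close>

lemma isotopic_B_left_nucleus:
  assumes card: "card (left_nucleus F) = 2 ^ m"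
  obtains s t where "0 < s" "s < m" "legitimate (F\<lparr>carrier := left_nucleus F\<rparr>) s t"
    "isotopic F (B_presemifield (F\<lparr>carrier := left_nucleus F\<rparr>) s t)"
proof -
  let ?N = "left_nucleus F" and ?M = "right_nucleus F"
  let ?D = "F\<lparr>carrier := ?N\<rparr>"
  interpret D: char_two_division_ring ?D by (rule char_two_division_ring_left_nucleus)
  note c = left_nucleus_carrier and mc = right_nucleus_carrier
  obtain u v where uv: "eigen u" "u \<noteq> \<zero>" "eigen v" "v \<notin> (\<lambda>a. a \<otimes> u) ` ?N" by (rule obtain_eigen_pair)
  have uc: "u \<in> carrier F" and vc: "v \<in> carrier F" using uv by (auto simp: eigen_def)
  have v0: "v \<noteq> \<zero>" using uv(4) zero_left_nucleus uc by (auto simp: zero_mult intro!: image_eqI[of _ _ \<zero>])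
  obtain \<rho> where \<rho>: "bij_betw \<rho> ?M ?N" "\<And>r. r \<in> ?M \<Longrightarrow> u \<otimes> r = \<rho> r \<otimes> u"
    "\<And>r r'. r \<in> ?M \<Longrightarrow> r' \<in> ?M \<Longrightarrow> \<rho> (r \<oplus> r') = \<rho> r \<oplus> \<rho> r'"
    "\<And>r r'. r \<in> ?M \<Longrightarrow> r' \<in> ?M \<Longrightarrow> \<rho> (r \<otimes> r') = \<rho> r \<otimes> \<rho> r'" "\<rho> \<one> = \<one>"
    using eigen_character[OF uv(1,2)] by blast
  obtain \<tau> where \<tau>: "bij_betw \<tau> ?M ?N" "\<And>r. r \<in> ?M \<Longrightarrow> v \<otimes> r = \<tau> r \<otimes> v"
    "\<And>r r'. r \<in> ?M \<Longrightarrow> r' \<in> ?M \<Longrightarrow> \<tau> (r \<oplus> r') = \<tau> r \<oplus> \<tau> r'"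
    "\<And>r r'. r \<in> ?M \<Longrightarrow> r' \<in> ?M \<Longrightarrow> \<tau> (r \<otimes> r') = \<tau> r \<otimes> \<tau> r'" "\<tau> \<one> = \<one>"
    using eigen_character[OF uv(3) v0] by blast
  have \<rho>N: "\<rho> r \<in> ?N" if "r \<in> ?M" for r using \<rho>(1) that by (auto simp: bij_betw_def)
  have \<tau>N: "\<tau> r \<in> ?N" if "r \<in> ?M" for r using \<tau>(1) that by (auto simp: bij_betw_def)
  define \<kappa> where "\<kappa> = inv_into ?M \<tau>"
  have \<kappa>: "\<kappa> l \<in> ?M" "\<tau> (\<kappa> l) = l" if "l \<in> ?N" for l
    using \<tau>(1) that unfolding \<kappa>_def by (auto simp: bij_betw_def inv_into_into f_inv_into_f)
  have \<kappa>eq: "\<kappa> l = r" if "r \<in> ?M" "\<tau> r = l" for r l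
    using \<tau>(1) that unfolding \<kappa>_def by (auto simp: bij_betw_def)
  have \<kappa>add: "\<kappa> (l \<oplus> l') = \<kappa> l \<oplus> \<kappa> l'" if "l \<in> ?N" "l' \<in> ?N" for l l'
    by (rule \<kappa>eq) (use that \<kappa> \<tau>(3) right_nucleus_add in auto)
  have \<kappa>mult: "\<kappa> (l \<otimes> l') = \<kappa> l \<otimes> \<kappa> l'" if "l \<in> ?N" "l' \<in> ?N" for l l'
    by (rule \<kappa>eq) (use that \<kappa> \<tau>(4) right_nucleus_mult in auto)
  have \<kappa>one: "\<kappa> \<one> = \<one>" by (rule \<kappa>eq) (use one_right_nucleus \<tau>(5) in auto)
  \<comment> \<open>The right nucleus is identified with the left one through the character of
    \<open>v\<close>, so \<open>\<kappa> l\<close> multiplies the v-coordinate by l itself and the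
    whole twist falls on the u-coordinate.\<close>
  define \<sigma> where "\<sigma> l = \<rho> (\<kappa> l)" for l
  obtain s where s: "s < m" "\<And>l. l \<in> ?N \<Longrightarrow> \<sigma> l = l [^]\<^bsub>?D\<^esub> ((2::nat) ^ s)"
  proof (rule D.automorphism_eq_frobenius_power[of m \<sigma>])
    show "card (carrier ?D) = 2 ^ m" using card by simp
  qed (use \<rho>N \<kappa> \<kappa>add \<kappa>mult \<kappa>one \<rho> in \<open>auto simp: \<sigma>_def\<close>)
  have bij: "bij_betw (\<lambda>(a, b). a \<otimes> u \<oplus> b \<otimes> v) (?N \<times> ?N) (carrier F)"
    by (rule left_coordinates_bij[OF uc uv(2) vc uv(4) card_left])
  have span: "\<exists>a\<in>?N. \<exists>b\<in>?N. x = a \<otimes> u \<oplus> b \<otimes> v" if x: "x \<in> carrier F" for x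
  proof -
    have "x \<in> (\<lambda>(a, b). a \<otimes> u \<oplus> b \<otimes> v) ` (?N \<times> ?N)" using bij x by (simp add: bij_betw_def)
    then show ?thesis by auto
  qed
  have act: "(a \<otimes> u \<oplus> b \<otimes> v) \<otimes> r = (a \<otimes> \<rho> r) \<otimes> u \<oplus> (b \<otimes> \<tau> r) \<otimes> v"
    if "a \<in> ?N" "b \<in> ?N" "r \<in> ?M" for a b r
  proof -
    have "(a \<otimes> u) \<otimes> r = a \<otimes> (\<rho> r \<otimes> u)"
      using left_nucleus_assoc[OF that(1) uc mc[OF that(3)]] \<rho>(2) that by simp
    moreover have "(b \<otimes> v) \<otimes> r = b \<otimes> (\<tau> r \<otimes> v)"
      using left_nucleus_assoc[OF that(2) vc mc[OF that(3)]] \<tau>(2) that by simp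
    ultimately show ?thesis
      using that uc vc c mc mult_closed left_nucleus_assoc[OF that(1) c[OF \<rho>N] uc]
        left_nucleus_assoc[OF that(2) c[OF \<tau>N] vc] by (simp add: distrib_right)
  qed
  \<comment> \<open>For s = 0 the characters of \<open>u\<close> and \<open>v\<close> agree, so x r
    = \<rho>(r) x for all x; taking x = 1 gives \<rho>(r) = r. The right nucleus would then lie in
    the left one and be central.\<close>
  have "s \<noteq> 0"
  proof
    assume s0: "s = 0"
    have \<rho>\<tau>: "\<rho> r = \<tau> r" if r: "r \<in> ?M" for r
    proof -
      have "\<rho> (\<kappa> (\<tau> r)) = \<tau> r" using s(2)[OF \<tau>N[OF r]] s0 c[OF \<tau>N[OF r]] by (simp add: \<sigma>_def one_mult)
      then show ?thesis using \<kappa>eq[OF r refl] by simp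
    qed
    have all: "x \<otimes> r = \<rho> r \<otimes> x" if x: "x \<in> carrier F" and r: "r \<in> ?M" for x r
    proof -
      obtain a b where ab: "a \<in> ?N" "b \<in> ?N" "x = a \<otimes> u \<oplus> b \<otimes> v" using span[OF x] by blast
      have "x \<otimes> r = (\<rho> r \<otimes> a) \<otimes> u \<oplus> (\<rho> r \<otimes> b) \<otimes> v"
        using act[OF ab(1,2) r] ab \<rho>\<tau>[OF r] left_nucleus_comm[OF _ \<rho>N[OF r]] by simp
      also have "\<dots> = \<rho> r \<otimes> x"
        using ab uc vc c \<rho>N[OF r] mult_closed left_nucleus_assoc[OF \<rho>N[OF r]] by (simp add: distrib_left)
      finally show ?thesis .
    qed
    have rho_id: "\<rho> r = r" if r: "r \<in> ?M" for r
      using all[OF one_in_carrier r] c[OF \<rho>N[OF r]] mc[OF r] by (simp add: one_mult mult_one)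
    then have "?M \<subseteq> ?N" using \<rho>N by force
    then show False by (rule nuclei_not_central) (use all rho_id in auto)
  qed

  \<comment> \<open>Coordinates of the product\<close>
  define \<beta> where "\<beta> = inv_into (?N \<times> ?N) (\<lambda>(a, b). a \<otimes> u \<oplus> b \<otimes> v)"
  have \<beta>N: "\<beta> x \<in> ?N \<times> ?N" "(\<lambda>(a, b). a \<otimes> u \<oplus> b \<otimes> v) (\<beta> x) = x" if "x \<in> carrier F" for x
    using bij that unfolding \<beta>_def bij_betw_def by (auto intro!: inv_into_into f_inv_into_f)
  have \<beta>eq: "\<beta> x = (a, b)" if "a \<in> ?N" "b \<in> ?N" "x = a \<otimes> u \<oplus> b \<otimes> v" for x a b
    using inv_into_f_eq[OF bij_betw_imp_inj_on[OF bij], of "(a, b)" x] that unfolding \<beta>_def by simp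
  define p1 where "p1 x = fst (\<beta> x)" for x
  define p2 where "p2 x = snd (\<beta> x)" for x
  have p: "p1 x \<in> ?N" "p2 x \<in> ?N" "x = p1 x \<otimes> u \<oplus> p2 x \<otimes> v" if "x \<in> carrier F" for x
    using \<beta>N[OF that] unfolding p1_def p2_def by (auto split: prod.splits)
  have peq: "p1 x = a" "p2 x = b" if "a \<in> ?N" "b \<in> ?N" "x = a \<otimes> u \<oplus> b \<otimes> v" for x a b
    using \<beta>eq[OF that] unfolding p1_def p2_def by auto
  have padd: "p1 (x \<oplus> y) = p1 x \<oplus> p1 y" "p2 (x \<oplus> y) = p2 x \<oplus> p2 y"
    if xy: "x \<in> carrier F" "y \<in> carrier F" for x y
  proof -
    have "x \<oplus> y = (p1 x \<oplus> p1 y) \<otimes> u \<oplus> (p2 x \<oplus> p2 y) \<otimes> v"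
    proof -
      have m: "p1 x \<otimes> u \<in> carrier F" "p1 y \<otimes> u \<in> carrier F" "p2 x \<otimes> v \<in> carrier F" "p2 y \<otimes> v \<in> carrier F"
        using p xy uc vc c mult_closed by auto
      have "x \<oplus> y = (p1 x \<otimes> u \<oplus> p2 x \<otimes> v) \<oplus> (p1 y \<otimes> u \<oplus> p2 y \<otimes> v)" using p(3)[OF xy(1)] p(3)[OF xy(2)] by simp
      also have "\<dots> = (p1 x \<otimes> u \<oplus> p1 y \<otimes> u) \<oplus> (p2 x \<otimes> v \<oplus> p2 y \<otimes> v)" using m by (simp add: a_ac)
      finally show ?thesis using p xy uc vc c by (simp add: distrib_right)
    qed
    then show "p1 (x \<oplus> y) = p1 x \<oplus> p1 y" "p2 (x \<oplus> y) = p2 x \<oplus> p2 y"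
      using peq[of "p1 x \<oplus> p1 y" "p2 x \<oplus> p2 y" "x \<oplus> y"] p(1,2) xy left_nucleus_add by auto
  qed
  have pscale: "p1 (l \<otimes> x) = l \<otimes> p1 x" "p2 (l \<otimes> x) = l \<otimes> p2 x" if l: "l \<in> ?N" and x: "x \<in> carrier F" for l x
  proof -
    have "l \<otimes> x = l \<otimes> (p1 x \<otimes> u \<oplus> p2 x \<otimes> v)" using p(3)[OF x] by simp
    also have "\<dots> = (l \<otimes> p1 x) \<otimes> u \<oplus> (l \<otimes> p2 x) \<otimes> v"
      using c[OF p(1)[OF x]] c[OF p(2)[OF x]] uc vc c[OF l] mult_closed left_nucleus_assoc[OF l]
        by (simp add: distrib_left)
    finally show "p1 (l \<otimes> x) = l \<otimes> p1 x" "p2 (l \<otimes> x) = l \<otimes> p2 x"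
      using peq[of "l \<otimes> p1 x" "l \<otimes> p2 x" "l \<otimes> x"] p(1,2)[OF x] l left_nucleus_mult by auto
  qed
  have pact: "p1 (x \<otimes> \<kappa> l) = p1 x \<otimes> \<sigma> l" "p2 (x \<otimes> \<kappa> l) = p2 x \<otimes> l" if l: "l \<in> ?N" and x: "x \<in> carrier F" for l x
  proof -
    have "x \<otimes> \<kappa> l = (p1 x \<otimes> u \<oplus> p2 x \<otimes> v) \<otimes> \<kappa> l" using p(3)[OF x] by simp
    also have "\<dots> = (p1 x \<otimes> \<sigma> l) \<otimes> u \<oplus> (p2 x \<otimes> l) \<otimes> v"
      using act[OF p(1)[OF x] p(2)[OF x] \<kappa>(1)[OF l]] \<kappa>(2)[OF l] by (simp add: \<sigma>_def)
    finally show "p1 (x \<otimes> \<kappa> l) = p1 x \<otimes> \<sigma> l" "p2 (x \<otimes> \<kappa> l) = p2 x \<otimes> l"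
      using peq[of "p1 x \<otimes> \<sigma> l" "p2 x \<otimes> l" "x \<otimes> \<kappa> l"] p(1,2)[OF x] l left_nucleus_mult \<rho>N \<kappa>(1)[OF l]
        unfolding \<sigma>_def by auto
  qed
  have \<beta>p: "\<beta> x = (p1 x, p2 x)" for x unfolding p1_def p2_def by simp
  have p0: "p2 \<zero> = \<zero>" "\<And>x. x \<in> carrier F \<Longrightarrow> p1 x = \<zero> \<Longrightarrow> p2 x = \<zero> \<Longrightarrow> x = \<zero>"
    using peq[of \<zero> \<zero> \<zero>] zero_left_nucleus p(3) uc vc
      by (simp_all add: zero_mult) (metis l_zero zero_closed zero_mult)

  \<comment> \<open>Coordinates of the two factors\<close>
  have "card {\<zero>, \<one>} \<le> card ?N"
    using one_left_nucleus zero_left_nucleus finite_left_nucleus by (intro card_mono) auto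
  then have "2 \<le> card ?M" using one_neq_zero card_nuclei by simp
  then have "card ?M < card (carrier F)" unfolding card_right by (simp add: power2_eq_square)
  then have "?M \<noteq> carrier F" by auto
  then obtain w where w: "w \<in> carrier F" "w \<notin> ?M" using mc by blast
  have rbij: "bij_betw (\<lambda>(a, b). a \<oplus> w \<otimes> b) (?M \<times> ?M) (carrier F)"
  proof -
    have "w \<notin> (\<lambda>a. \<one> \<otimes> a) ` ?M" using w(2) mc one_mult by auto
    then have "bij_betw (\<lambda>(a, b). \<one> \<otimes> a \<oplus> w \<otimes> b) (?M \<times> ?M) (carrier F)"
      using char_two_semifield.left_coordinates_bij[OF char_two_semifield_opposite, of \<one> w]
        one_in_carrier one_neq_zero w(1) card_right by (simp add: left_nucleus_opposite)
    moreover have "(\<lambda>(a, b). \<one> \<otimes> a \<oplus> w \<otimes> b) z = (\<lambda>(a, b). a \<oplus> w \<otimes> b) z" if "z \<in> ?M \<times> ?M" for z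
      using that mc by (auto simp: one_mult)
    ultimately show ?thesis by (subst (asm) bij_betw_cong) auto
  qed
  define \<alpha>\<^sub>2 where "\<alpha>\<^sub>2 = (\<lambda>(c, d). \<kappa> c \<oplus> w \<otimes> \<kappa> d)"
  have \<kappa>bij: "bij_betw \<kappa> ?N ?M" unfolding \<kappa>_def by (rule bij_betw_inv_into[OF \<tau>(1)])
  have \<alpha>\<^sub>2bij: "bij_betw \<alpha>\<^sub>2 (?N \<times> ?N) (carrier F)"
  proof -
    have "bij_betw (map_prod \<kappa> \<kappa>) (?N \<times> ?N) (?M \<times> ?M)"
      using \<kappa>bij unfolding bij_betw_def by (auto simp: map_prod_inj_on map_prod_surj_on)
    from bij_betw_trans[OF this rbij] show ?thesis
      by (simp add: \<alpha>\<^sub>2_def comp_def case_prod_unfold map_prod_def)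
  qed
  have \<kappa>c: "\<kappa> l \<in> carrier F" if "l \<in> ?N" for l using mc[OF \<kappa>(1)[OF that]] .
  have prod2: "x \<otimes> \<alpha>\<^sub>2 (c, d) = x \<otimes> \<kappa> c \<oplus> (x \<otimes> w) \<otimes> \<kappa> d"
    if "x \<in> carrier F" "c \<in> ?N" "d \<in> ?N" for x c d
    using that w(1) \<kappa>c right_nucleus_assoc[OF \<kappa>(1) w(1), of d x]
      by (simp add: \<alpha>\<^sub>2_def distrib_left mult_closed)
  define A where "A x = (p2 (x \<otimes> w), p2 x)" for x
  have AN: "A x \<in> ?N \<times> ?N" if "x \<in> carrier F" for x using that p(2) w(1) mult_closed by (simp add: A_def)
  have inj: "inj_on A (carrier F)"
  proof (rule inj_onI)
    fix x x' assume x: "x \<in> carrier F" "x' \<in> carrier F" "A x = A x'"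
    let ?z = "x \<oplus> x'"
    have z: "?z \<in> carrier F" using x by simp
    have xw: "x \<otimes> w \<in> carrier F" "x' \<otimes> w \<in> carrier F" "?z \<otimes> w \<in> carrier F" using x w mult_closed by auto
    have "p2 ?z = \<zero>" using x padd(2)[OF x(1,2)] double[OF c[OF p(2)[OF x(2)]]] by (simp add: A_def)
    moreover have "p2 (?z \<otimes> w) = \<zero>"
      using x xw w padd(2)[OF xw(1,2)] double[OF c[OF p(2)[OF xw(2)]]] by (simp add: A_def distrib_right)
    \<comment> \<open>The two values of \<open>A\<close> determine the v-coordinate of every product
      with left factor z. If both vanish, no product z y equals \<open>v\<close>; but for z nonzero
      the injective map y to z y is onto.\<close>
    ultimately have ann: "p2 (?z \<otimes> y) = \<zero>" if y: "y \<in> carrier F" for y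
    proof -
      have "y \<in> \<alpha>\<^sub>2 ` (?N \<times> ?N)" using \<alpha>\<^sub>2bij y by (simp add: bij_betw_def)
      then obtain a b where ab: "a \<in> ?N" "b \<in> ?N" "y = \<alpha>\<^sub>2 (a, b)" by auto
      have "p2 (?z \<otimes> y) = p2 (?z \<otimes> \<kappa> a) \<oplus> p2 ((?z \<otimes> w) \<otimes> \<kappa> b)"
        unfolding ab(3) prod2[OF z ab(1,2)] using z xw(3) \<kappa>c ab mult_closed by (intro padd) auto
      also have "\<dots> = p2 ?z \<otimes> a \<oplus> p2 (?z \<otimes> w) \<otimes> b" using pact ab z xw(3) by simp
      finally show ?thesis using \<open>p2 ?z = \<zero>\<close> \<open>p2 (?z \<otimes> w) = \<zero>\<close> c ab by (simp add: zero_mult)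
    qed
    have "?z = \<zero>"
    proof (rule ccontr)
      assume "?z \<noteq> \<zero>"
      then have "inj_on (\<lambda>y. ?z \<otimes> y) (carrier F)"
        using mult_left_cancel[OF z] by (auto intro: inj_onI)
      then have "(\<lambda>y. ?z \<otimes> y) ` carrier F = carrier F"
        using mult_closed[OF z] by (intro endo_inj_surj[OF finite_carrier]) auto
      with vc have "v \<in> (\<lambda>y. ?z \<otimes> y) ` carrier F" by simp
      then obtain y where y: "v = ?z \<otimes> y" "y \<in> carrier F" by (rule imageE)
      have "p2 v = \<zero>" unfolding y(1) by (rule ann[OF y(2)])
      moreover have "p2 v = \<one>" using zero_left_nucleus one_left_nucleus uc vc
        by (intro peq[of \<zero>]) (simp_all add: zero_mult one_mult)
      ultimately show False using one_neq_zero by simp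
    qed
    then show "x = x'" using sum_eq_zero_iff x by simp
  qed
  have surj: "A ` carrier F = ?N \<times> ?N"
  proof (rule card_subset_eq)
    show "A ` carrier F \<subseteq> ?N \<times> ?N" using AN by blast
    show "card (A ` carrier F) = card (?N \<times> ?N)"
      using card_image[OF inj] card_left by (simp add: card_cartesian_product power2_eq_square)
  qed (simp add: finite_left_nucleus)
  \<comment> \<open>\<open>A\<close> is linear over the left nucleus, so its inverse
    \<open>\<alpha>\<^sub>1\<close> is determined by the preimages \<open>e1\<close>,
    \<open>e2\<close> of the unit vectors.\<close>
  obtain e1 where e1: "e1 \<in> carrier F" "p2 (e1 \<otimes> w) = \<one>" "p2 e1 = \<zero>"
  proof -
    have "(\<one>, \<zero>) \<in> A ` carrier F" unfolding surj using one_left_nucleus zero_left_nucleus by simp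
    then obtain x where "x \<in> carrier F" "A x = (\<one>, \<zero>)" by (metis imageE)
    then show ?thesis using that[of x] by (simp add: A_def)
  qed
  obtain e2 where e2: "e2 \<in> carrier F" "p2 (e2 \<otimes> w) = \<zero>" "p2 e2 = \<one>"
  proof -
    have "(\<zero>, \<one>) \<in> A ` carrier F" unfolding surj using one_left_nucleus zero_left_nucleus by simp
    then obtain x where "x \<in> carrier F" "A x = (\<zero>, \<one>)" by (metis imageE)
    then show ?thesis using that[of x] by (simp add: A_def)
  qed
  have e1w: "e1 \<otimes> w \<in> carrier F" and e2w: "e2 \<otimes> w \<in> carrier F" using e1 e2 w mult_closed by auto
  define \<alpha>\<^sub>1 where "\<alpha>\<^sub>1 = (\<lambda>(a, b). a \<otimes> e1 \<oplus> b \<otimes> e2)"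
  have \<alpha>\<^sub>1c: "\<alpha>\<^sub>1 (a, b) \<in> carrier F" if "a \<in> ?N" "b \<in> ?N" for a b
    using that e1 e2 c mult_closed by (simp add: \<alpha>\<^sub>1_def)
  have \<alpha>\<^sub>1w: "\<alpha>\<^sub>1 (a, b) \<otimes> w = a \<otimes> (e1 \<otimes> w) \<oplus> b \<otimes> (e2 \<otimes> w)" if "a \<in> ?N" "b \<in> ?N" for a b
    using that e1(1) e2(1) w(1) c mult_closed left_nucleus_assoc by (simp add: \<alpha>\<^sub>1_def distrib_right)
  have p_\<alpha>\<^sub>1: "p1 (\<alpha>\<^sub>1 (a, b)) = a \<otimes> p1 e1 \<oplus> b \<otimes> p1 e2" "p2 (\<alpha>\<^sub>1 (a, b)) = b"
    "p1 (\<alpha>\<^sub>1 (a, b) \<otimes> w) = a \<otimes> p1 (e1 \<otimes> w) \<oplus> b \<otimes> p1 (e2 \<otimes> w)" "p2 (\<alpha>\<^sub>1 (a, b) \<otimes> w) = a"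
    if ab: "a \<in> ?N" "b \<in> ?N" for a b
  proof -
    note cc = ab[THEN c]
    show "p1 (\<alpha>\<^sub>1 (a, b)) = a \<otimes> p1 e1 \<oplus> b \<otimes> p1 e2"
      using ab cc e1(1) e2(1) mult_closed by (simp add: \<alpha>\<^sub>1_def padd pscale)
    show "p2 (\<alpha>\<^sub>1 (a, b)) = b"
      using ab cc e1 e2 mult_closed by (simp add: \<alpha>\<^sub>1_def padd pscale mult_zero mult_one)
    show "p1 (\<alpha>\<^sub>1 (a, b) \<otimes> w) = a \<otimes> p1 (e1 \<otimes> w) \<oplus> b \<otimes> p1 (e2 \<otimes> w)"
      using ab cc e1w e2w mult_closed by (simp add: \<alpha>\<^sub>1w padd pscale)
    show "p2 (\<alpha>\<^sub>1 (a, b) \<otimes> w) = a"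
      using ab cc e1w e2w e1 e2 mult_closed by (simp add: \<alpha>\<^sub>1w padd pscale mult_zero mult_one)
  qed
  have A\<alpha>\<^sub>1: "A (\<alpha>\<^sub>1 (a, b)) = (a, b)" if "a \<in> ?N" "b \<in> ?N" for a b
    using p_\<alpha>\<^sub>1[OF that] by (simp add: A_def)
  have \<alpha>\<^sub>1bij: "bij_betw \<alpha>\<^sub>1 (?N \<times> ?N) (carrier F)"
  proof (rule bij_betw_byWitness[where f' = A])
    show "\<forall>x\<in>carrier F. \<alpha>\<^sub>1 (A x) = x"
    proof
      fix x assume x: "x \<in> carrier F"
      obtain a b where ab: "A x = (a, b)" "a \<in> ?N" "b \<in> ?N" using AN[OF x] by (cases "A x") auto
      then have "A (\<alpha>\<^sub>1 (A x)) = A x" using A\<alpha>\<^sub>1 by simp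
      then show "\<alpha>\<^sub>1 (A x) = x" using inj_onD[OF inj] \<alpha>\<^sub>1c ab x by simp
    qed
    show "A ` carrier F \<subseteq> ?N \<times> ?N" using AN by blast
  qed (use A\<alpha>\<^sub>1 \<alpha>\<^sub>1c in auto)
  \<comment> \<open>Forced by the u-coordinate of (a e1 + b e2)(c' + w d'), in which c' and d' act
    as the twists of c and d: \<open>e1\<close> and \<open>e2\<close> contribute the coefficients at
    c, their products with \<open>w\<close> those at d.\<close>
  let ?P1 = "p1 e1" and ?P2 = "p1 e2" and ?P3 = "p1 (e1 \<otimes> w)" and ?P4 = "p1 (e2 \<otimes> w)"
  have P: "?P1 \<in> ?N" "?P2 \<in> ?N" "?P3 \<in> ?N" "?P4 \<in> ?N" using p(1) e1(1) e2(1) e1w e2w by auto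
  let ?B = "B_presemifield ?D s (?P1, ?P2, ?P3, ?P4)"
  have \<sigma>N: "\<sigma> l \<in> ?N" if "l \<in> ?N" for l using that \<rho>N \<kappa>(1) by (simp add: \<sigma>_def)
  have product: "\<beta> (\<alpha>\<^sub>1 (a, b) \<otimes> \<alpha>\<^sub>2 (c, d)) = (a, b) \<otimes>\<^bsub>?B\<^esub> (c, d)"
    if N: "a \<in> ?N" "b \<in> ?N" "c \<in> ?N" "d \<in> ?N" for a b c d
  proof -
    let ?x = "\<alpha>\<^sub>1 (a, b)"
    have x: "?x \<in> carrier F" "?x \<otimes> w \<in> carrier F" using \<alpha>\<^sub>1c N w mult_closed by auto
    have xy: "?x \<otimes> \<alpha>\<^sub>2 (c, d) = ?x \<otimes> \<kappa> c \<oplus> (?x \<otimes> w) \<otimes> \<kappa> d" using prod2 x N by simp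
    have cl: "?x \<otimes> \<kappa> c \<in> carrier F" "(?x \<otimes> w) \<otimes> \<kappa> d \<in> carrier F" using x \<kappa>c N mult_closed by auto
    have "p2 (?x \<otimes> \<alpha>\<^sub>2 (c, d)) = b \<otimes> c \<oplus> a \<otimes> d"
      unfolding xy using padd(2)[OF cl] pact(2) x N p_\<alpha>\<^sub>1 by simp
    then have 2: "p2 (?x \<otimes> \<alpha>\<^sub>2 (c, d)) = a \<otimes> d \<oplus> b \<otimes> c"
      using N left_nucleus_carrier mult_closed by (simp add: a_comm)
    have "p1 (?x \<otimes> \<alpha>\<^sub>2 (c, d)) = (a \<otimes> ?P1 \<oplus> b \<otimes> ?P2) \<otimes> \<sigma> c \<oplus> (a \<otimes> ?P3 \<oplus> b \<otimes> ?P4) \<otimes> \<sigma> d"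
      unfolding xy using padd(1)[OF cl] pact(1) x N p_\<alpha>\<^sub>1 by simp
    also have "\<dots> = ?P1 \<otimes> a \<otimes> \<sigma> c \<oplus> ?P2 \<otimes> b \<otimes> \<sigma> c \<oplus> ?P3 \<otimes> a \<otimes> \<sigma> d \<oplus> ?P4 \<otimes> b \<otimes> \<sigma> d"
      using N P \<sigma>N left_nucleus_carrier mult_closed left_nucleus_comm[of a] left_nucleus_comm[of b]
      by (simp add: distrib_right a_assoc)
    finally show ?thesis using 2 s(2) N by (simp add: \<beta>p B_presemifield_simps)
  qed
  have nonzero: "(a, b) \<otimes>\<^bsub>?B\<^esub> (c, d) \<noteq> (\<zero>, \<zero>)"
    if N: "a \<in> ?N" "b \<in> ?N" "c \<in> ?N" "d \<in> ?N" and nz: "(a, b) \<noteq> (\<zero>, \<zero>)" "(c, d) \<noteq> (\<zero>, \<zero>)" for a b c d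
  proof
    assume "(a, b) \<otimes>\<^bsub>?B\<^esub> (c, d) = (\<zero>, \<zero>)"
    then have "\<beta> (\<alpha>\<^sub>1 (a, b) \<otimes> \<alpha>\<^sub>2 (c, d)) = (\<zero>, \<zero>)" using product N by simp
    moreover have cc: "\<alpha>\<^sub>1 (a, b) \<in> carrier F" "\<alpha>\<^sub>2 (c, d) \<in> carrier F"
      using \<alpha>\<^sub>1c \<alpha>\<^sub>2bij N by (auto simp: bij_betw_def)
    ultimately have "\<alpha>\<^sub>1 (a, b) \<otimes> \<alpha>\<^sub>2 (c, d) = \<zero>" using p0(2) mult_closed by (simp add: \<beta>p)
    then consider "\<alpha>\<^sub>1 (a, b) = \<zero>" | "\<alpha>\<^sub>2 (c, d) = \<zero>" using no_zero_divisors cc by blast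
    then show False
    proof cases
      case 1
      moreover have "\<alpha>\<^sub>1 (\<zero>, \<zero>) = \<zero>" using e1 e2 by (simp add: \<alpha>\<^sub>1_def zero_mult)
      ultimately show False
        using inj_onD[OF bij_betw_imp_inj_on[OF \<alpha>\<^sub>1bij], of "(a, b)" "(\<zero>, \<zero>)"] N nz zero_left_nucleus by simp
    next
      case 2
      moreover have "\<kappa> \<zero> = \<zero>"
      proof (rule \<kappa>eq)
        show "\<zero> \<in> ?M" using char_two_semifield.zero_left_nucleus[OF char_two_semifield_opposite]
          by (simp add: left_nucleus_opposite)
        then show "\<tau> \<zero> = \<zero>" using \<tau>(2)[of \<zero>] no_zero_divisors[of "\<tau> \<zero>" v] vc v0 \<tau>N left_nucleus_carrier
          by (simp add: mult_zero)
      qed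
      then have "\<alpha>\<^sub>2 (\<zero>, \<zero>) = \<zero>" using w by (simp add: \<alpha>\<^sub>2_def mult_zero)
      ultimately show False
        using inj_onD[OF bij_betw_imp_inj_on[OF \<alpha>\<^sub>2bij], of "(c, d)" "(\<zero>, \<zero>)"] N nz zero_left_nucleus by simp
    qed
  qed
  have legit: "legitimate ?D s (?P1, ?P2, ?P3, ?P4)"
  proof -
    \<comment> \<open>Both conditions of legitimacy come from squares: (1,0) squared is (p1, 0), and
      (x,1) squared is (f(x), x + x) with f the polynomial in question, where x + x = 0.\<close>
    have "?P1 \<noteq> \<zero>"
    proof
      assume P1: "?P1 = \<zero>"
      have z: "\<zero> [^]\<^bsub>?D\<^esub> ((2::nat) ^ s) = \<zero>" using D.nat_pow_zero[of "2 ^ s"] by simp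
      have "(\<one>, \<zero>) \<otimes>\<^bsub>?B\<^esub> (\<one>, \<zero>) = (\<zero>, \<zero>)"
        using P1 P c z one_in_carrier D.nat_pow_one[of "2 ^ s"]
        by (simp add: B_presemifield_simps zero_mult mult_zero mult_one mult_closed)
      then show False using nonzero[of \<one> \<zero> \<one> \<zero>] one_left_nucleus zero_left_nucleus one_neq_zero by simp
    qed
    moreover have "?P1 \<otimes> x [^]\<^bsub>?D\<^esub> ((2::nat) ^ s + 1) \<oplus> ?P2 \<otimes> x [^]\<^bsub>?D\<^esub> ((2::nat) ^ s) \<oplus> ?P3 \<otimes> x \<oplus> ?P4 \<noteq> \<zero>"
      if x: "x \<in> ?N" for x
    proof
      assume root: "?P1 \<otimes> x [^]\<^bsub>?D\<^esub> ((2::nat) ^ s + 1) \<oplus> ?P2 \<otimes> x [^]\<^bsub>?D\<^esub> ((2::nat) ^ s) \<oplus> ?P3 \<otimes> x \<oplus> ?P4 = \<zero>"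
      have xs: "x [^]\<^bsub>?D\<^esub> ((2::nat) ^ s) \<in> ?N" using D.nat_pow_closed[of x "2 ^ s"] x by simp
      have "?P1 \<otimes> x [^]\<^bsub>?D\<^esub> ((2::nat) ^ s + 1) = ?P1 \<otimes> x \<otimes> x [^]\<^bsub>?D\<^esub> ((2::nat) ^ s)"
        using D.nat_pow_Suc2[of x "2 ^ s"] D.m_assoc[of ?P1 x] x xs P by simp
      then have "(x, \<one>) \<otimes>\<^bsub>?B\<^esub> (x, \<one>) = (\<zero>, \<zero>)"
        using root P c[OF P(1)] c[OF P(2)] c[OF P(3)] c[OF P(4)] c[OF x] c[OF xs] D.nat_pow_one[of "2 ^ s"]
        by (simp add: B_presemifield_simps mult_one one_mult mult_closed double)
      then show False using nonzero[of x \<one> x \<one>] one_left_nucleus x one_neq_zero by simp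
    qed
    ultimately show ?thesis using P unfolding legitimate_def by (auto simp: Let_def)
  qed
  have i1: "\<alpha>\<^sub>1 \<in> iso (add_monoid ?B) (add_monoid F)"
  proof -
    have "\<alpha>\<^sub>1 ((a, b) \<oplus>\<^bsub>?B\<^esub> (a', b')) = \<alpha>\<^sub>1 (a, b) \<oplus> \<alpha>\<^sub>1 (a', b')"
      if "a \<in> ?N" "b \<in> ?N" "a' \<in> ?N" "b' \<in> ?N" for a b a' b'
      using that[THEN c] e1 e2 mult_closed by (simp add: B_presemifield_simps \<alpha>\<^sub>1_def distrib_right a_ac)
    then show ?thesis using \<alpha>\<^sub>1bij \<alpha>\<^sub>1c by (auto simp: iso_def hom_def B_presemifield_simps(1))
  qed
  have i2: "\<alpha>\<^sub>2 \<in> iso (add_monoid ?B) (add_monoid F)"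
  proof -
    have "\<alpha>\<^sub>2 ((a, b) \<oplus>\<^bsub>?B\<^esub> (a', b')) = \<alpha>\<^sub>2 (a, b) \<oplus> \<alpha>\<^sub>2 (a', b')"
      if "a \<in> ?N" "b \<in> ?N" "a' \<in> ?N" "b' \<in> ?N" for a b a' b'
      using that[THEN \<kappa>c] that w mult_closed
        by (simp add: B_presemifield_simps \<alpha>\<^sub>2_def \<kappa>add distrib_left a_ac)
    then show ?thesis using \<alpha>\<^sub>2bij by (auto simp: iso_def hom_def B_presemifield_simps(1) bij_betw_def)
  qed
  have i3: "\<beta> \<in> iso (add_monoid F) (add_monoid ?B)"
  proof -
    have "bij_betw \<beta> (carrier F) (?N \<times> ?N)" unfolding \<beta>_def by (rule bij_betw_inv_into[OF bij])
    then show ?thesis using p by (auto simp: iso_def hom_def \<beta>p padd B_presemifield_simps(1,2))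
  qed
  have "\<beta> (\<alpha>\<^sub>1 x \<otimes> \<alpha>\<^sub>2 y) = x \<otimes>\<^bsub>?B\<^esub> y" if "x \<in> carrier ?B" "y \<in> carrier ?B" for x y
    using that product by (auto simp: B_presemifield_simps(1))
  then have "isotopic F ?B" unfolding isotopic_def using i1 i2 i3 by blast
  then show ?thesis using that[of s] \<open>s \<noteq> 0\<close> s(1) legit by blast
qed

end

section \<open>Transport of the presemifield along a field isomorphism\<close>

lemma ring_hom_nat_pow:
  assumes "monoid R" "f \<in> ring_hom R S" "x \<in> carrier R"
  shows "f (x [^]\<^bsub>R\<^esub> (n::nat)) = f x [^]\<^bsub>S\<^esub> n"
  using assms by (induction n) (auto simp: ring_hom_one ring_hom_mult monoid.nat_pow_closed)

lemma isotopic_iso_right: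
  assumes iso: "isotopic F G" and bij: "bij_betw f (carrier G) (carrier H)"
    and add: "\<And>x y. x \<in> carrier G \<Longrightarrow> y \<in> carrier G \<Longrightarrow> f (x \<oplus>\<^bsub>G\<^esub> y) = f x \<oplus>\<^bsub>H\<^esub> f y"
    and mult: "\<And>x y. x \<in> carrier G \<Longrightarrow> y \<in> carrier G \<Longrightarrow> f (x \<otimes>\<^bsub>G\<^esub> y) = f x \<otimes>\<^bsub>H\<^esub> f y"
    and closed: "\<And>x y. x \<in> carrier G \<Longrightarrow> y \<in> carrier G \<Longrightarrow> x \<oplus>\<^bsub>G\<^esub> y \<in> carrier G"
  shows "isotopic F H"
proof -
  obtain \<alpha>\<^sub>1 \<alpha>\<^sub>2 \<beta> where i: "\<alpha>\<^sub>1 \<in> iso (add_monoid G) (add_monoid F)" "\<alpha>\<^sub>2 \<in> iso (add_monoid G) (add_monoid F)"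
    "\<beta> \<in> iso (add_monoid F) (add_monoid G)"
    and eq: "\<And>x y. x \<in> carrier G \<Longrightarrow> y \<in> carrier G \<Longrightarrow> \<beta> (\<alpha>\<^sub>1 x \<otimes>\<^bsub>F\<^esub> \<alpha>\<^sub>2 y) = x \<otimes>\<^bsub>G\<^esub> y"
    using iso unfolding isotopic_def by blast
  define g where "g = inv_into (carrier G) f"
  have gbij: "bij_betw g (carrier H) (carrier G)" unfolding g_def by (rule bij_betw_inv_into[OF bij])
  have gc: "g x \<in> carrier G" "f (g x) = x" if "x \<in> carrier H" for x
    using that gbij bij unfolding g_def by (auto simp: bij_betw_def f_inv_into_f)
  have gadd: "g (x \<oplus>\<^bsub>H\<^esub> y) = g x \<oplus>\<^bsub>G\<^esub> g y" if "x \<in> carrier H" "y \<in> carrier H" for x y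
    unfolding g_def by (rule inv_into_f_eq[OF bij_betw_imp_inj_on[OF bij]])
      (use that gc closed add in \<open>auto simp flip: g_def\<close>)
  have giso: "g \<in> iso (add_monoid H) (add_monoid G)"
    using gbij gc gadd by (auto simp: iso_def hom_def)
  have fiso: "f \<in> iso (add_monoid G) (add_monoid H)"
    using bij add by (auto simp: iso_def hom_def bij_betw_def)
  have comp: "\<And>\<alpha>. \<alpha> \<in> iso (add_monoid G) (add_monoid F) \<Longrightarrow> \<alpha> \<circ> g \<in> iso (add_monoid H) (add_monoid F)"
    by (rule iso_set_trans[OF giso])
  have "f \<circ> \<beta> \<in> iso (add_monoid F) (add_monoid H)" by (rule iso_set_trans[OF i(3) fiso])
  moreover have "(f \<circ> \<beta>) ((\<alpha>\<^sub>1 \<circ> g) x \<otimes>\<^bsub>F\<^esub> (\<alpha>\<^sub>2 \<circ> g) y) = x \<otimes>\<^bsub>H\<^esub> y"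
    if "x \<in> carrier H" "y \<in> carrier H" for x y
    using that gc eq mult by simp
  ultimately show ?thesis unfolding isotopic_def using comp[OF i(1)] comp[OF i(2)] by blast
qed

text \<open>Apply \<open>f\<close> to both coordinates. That \<open>f\<close> respects zero is a
  separate hypothesis because \<open>L'\<close> is an arbitrary record here, not known to be a
  ring.\<close>

lemma B_presemifield_transfer:
  assumes L: "field L" and f: "f \<in> ring_iso L L'" and f0: "f \<zero>\<^bsub>L\<^esub> = \<zero>\<^bsub>L'\<^esub>"
    and legit: "legitimate L s (p\<^sub>1, p\<^sub>2, p\<^sub>3, p\<^sub>4)" and iso: "isotopic F (B_presemifield L s (p\<^sub>1, p\<^sub>2, p\<^sub>3, p\<^sub>4))"
  shows "legitimate L' s (f p\<^sub>1, f p\<^sub>2, f p\<^sub>3, f p\<^sub>4)"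
    and "isotopic F (B_presemifield L' s (f p\<^sub>1, f p\<^sub>2, f p\<^sub>3, f p\<^sub>4))"
proof -
  interpret L: field L by (rule L)
  have hom: "f \<in> ring_hom L L'" and bij: "bij_betw f (carrier L) (carrier L')"
    using f by (auto simp: ring_iso_def)
  have fc: "f x \<in> carrier L'" if "x \<in> carrier L" for x using ring_hom_closed[OF hom that] .
  have feq: "f x = f y \<longleftrightarrow> x = y" if "x \<in> carrier L" "y \<in> carrier L" for x y
    using bij that by (auto simp: bij_betw_def inj_on_eq_iff)
  note h = ring_hom_add[OF hom] ring_hom_mult[OF hom] ring_hom_nat_pow[OF L.monoid_axioms hom]
  have p: "p\<^sub>1 \<in> carrier L" "p\<^sub>2 \<in> carrier L" "p\<^sub>3 \<in> carrier L" "p\<^sub>4 \<in> carrier L" "p\<^sub>1 \<noteq> \<zero>\<^bsub>L\<^esub>"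
    and root: "\<And>x. x \<in> carrier L \<Longrightarrow> p\<^sub>1 \<otimes>\<^bsub>L\<^esub> x [^]\<^bsub>L\<^esub> ((2::nat) ^ s + 1) \<oplus>\<^bsub>L\<^esub> p\<^sub>2 \<otimes>\<^bsub>L\<^esub> x [^]\<^bsub>L\<^esub> ((2::nat) ^ s)
      \<oplus>\<^bsub>L\<^esub> p\<^sub>3 \<otimes>\<^bsub>L\<^esub> x \<oplus>\<^bsub>L\<^esub> p\<^sub>4 \<noteq> \<zero>\<^bsub>L\<^esub>"
    using legit unfolding legitimate_def by (auto simp: Let_def)
  show "legitimate L' s (f p\<^sub>1, f p\<^sub>2, f p\<^sub>3, f p\<^sub>4)"
  proof -
    have "f p\<^sub>1 \<noteq> \<zero>\<^bsub>L'\<^esub>" using feq[of p\<^sub>1 "\<zero>\<^bsub>L\<^esub>"] p f0 by simp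
    moreover have "f p\<^sub>1 \<otimes>\<^bsub>L'\<^esub> y [^]\<^bsub>L'\<^esub> ((2::nat) ^ s + 1) \<oplus>\<^bsub>L'\<^esub> f p\<^sub>2 \<otimes>\<^bsub>L'\<^esub> y [^]\<^bsub>L'\<^esub> ((2::nat) ^ s)
      \<oplus>\<^bsub>L'\<^esub> f p\<^sub>3 \<otimes>\<^bsub>L'\<^esub> y \<oplus>\<^bsub>L'\<^esub> f p\<^sub>4 \<noteq> \<zero>\<^bsub>L'\<^esub>" if y: "y \<in> carrier L'" for y
    proof -
      have "y \<in> f ` carrier L" using bij y by (simp add: bij_betw_def)
      then obtain x where x: "y = f x" "x \<in> carrier L" by (rule imageE)
      have "f (p\<^sub>1 \<otimes>\<^bsub>L\<^esub> x [^]\<^bsub>L\<^esub> ((2::nat) ^ s + 1) \<oplus>\<^bsub>L\<^esub> p\<^sub>2 \<otimes>\<^bsub>L\<^esub> x [^]\<^bsub>L\<^esub> ((2::nat) ^ s)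
          \<oplus>\<^bsub>L\<^esub> p\<^sub>3 \<otimes>\<^bsub>L\<^esub> x \<oplus>\<^bsub>L\<^esub> p\<^sub>4) \<noteq> f \<zero>\<^bsub>L\<^esub>"
        using root[OF x(2)] x p by (subst feq) auto
      then show ?thesis unfolding f0 x(1) using x(2) p by (simp add: h)
    qed
    ultimately show ?thesis using p fc unfolding legitimate_def by (auto simp: Let_def)
  qed
  let ?B = "B_presemifield L s (p\<^sub>1, p\<^sub>2, p\<^sub>3, p\<^sub>4)" and ?B' = "B_presemifield L' s (f p\<^sub>1, f p\<^sub>2, f p\<^sub>3, f p\<^sub>4)"
  show "isotopic F ?B'"
  proof (rule isotopic_iso_right[OF iso])
    show "bij_betw (map_prod f f) (carrier ?B) (carrier ?B')"
      using bij unfolding bij_betw_def B_presemifield_simps by (auto simp: map_prod_inj_on map_prod_surj_on)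
  qed (use p in \<open>auto simp: B_presemifield_simps h\<close>)
qed

text \<open>Any injection of the finite carrier into the natural numbers carries the field structure
  along, which moves \<open>L\<close> to the type demanded by
  \<open>isotopic_to_some_B\<close>.\<close>

lemma isotopic_to_some_B_finite_field:
  fixes L :: "('b, 'n) ring_scheme"
  assumes L: "field L" "finite (carrier L)" "card (carrier L) = 2 ^ m" and s: "0 < s" "s < m"
    and t: "legitimate L s t" "isotopic F (B_presemifield L s t)"
  shows "isotopic_to_some_B F"
proof -
  obtain f :: "'b \<Rightarrow> nat" where f: "inj_on f (carrier L)"
    using finite_imp_inj_to_nat_seg[OF L(2)] by blast
  let ?L = "image_ring f L"
  have iso: "f \<in> ring_iso L ?L" by (rule inj_imp_image_ring_iso[OF f])
  have "field ?L" by (rule field.inj_imp_image_ring_is_field[OF L(1) f])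
  moreover have "order ?L = 2 ^ m" using card_image[OF f] L(3) by (simp add: order_def image_ring_carrier)
  moreover obtain p\<^sub>1 p\<^sub>2 p\<^sub>3 p\<^sub>4 where tp: "t = (p\<^sub>1, p\<^sub>2, p\<^sub>3, p\<^sub>4)" by (cases t) auto
  have "f \<zero>\<^bsub>L\<^esub> = \<zero>\<^bsub>?L\<^esub>" by (simp add: image_ring_zero)
  note B_presemifield_transfer[OF L(1) iso this t[unfolded tp]]
  moreover have "m \<ge> 1" "s < 2 * m" "s \<notin> {0, m}" using s by auto
  ultimately show ?thesis unfolding isotopic_to_some_B_def by blast
qed

lemma (in char_two_semifield) quadratic_imp_isotopic:
  assumes "quadratic_over_left_nucleus F" "quadratic_over_right_nucleus F"
  shows "isotopic_to_some_B F"
proof -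
  interpret biquadratic_semifield F
    using assms unfolding quadratic_over_left_nucleus_iff quadratic_over_right_nucleus_iff
    by unfold_locales
  let ?D = "F\<lparr>carrier := left_nucleus F\<rparr>"
  interpret D: char_two_division_ring ?D by (rule char_two_division_ring_left_nucleus)
  obtain m :: nat where m: "card (left_nucleus F) = 2 ^ m"
    using D.card_eq_two_power[OF D.finite_carrier] by auto
  obtain s t where "0 < s" "s < m" "legitimate ?D s t" "isotopic F (B_presemifield ?D s t)"
    using isotopic_B_left_nucleus[OF m] by blast
  then show ?thesis
    using isotopic_to_some_B_finite_field[OF D.field_axioms D.finite_carrier, of m s t F] m by simp
qed

subsection \<open>From a presemifield \<open>B\<close> to nuclei\<close>

text \<open>An autotopism of the presemifield which fixes the right factor is left multiplication by an
  element of the left nucleus of the isotopic semifield: put the right factor equal to \<open>\<one>\<close>.\<close>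

lemma (in char_two_semifield) autotopism_left_nucleus:
  assumes \<alpha>\<^sub>1: "\<alpha>\<^sub>1 ` C = carrier F" and \<alpha>\<^sub>2: "\<alpha>\<^sub>2 ` C = carrier F" and \<beta>: "bij_betw \<beta> (carrier F) C"
    and iso: "\<And>x y. x \<in> C \<Longrightarrow> y \<in> C \<Longrightarrow> \<beta> (\<alpha>\<^sub>1 x \<otimes> \<alpha>\<^sub>2 y) = f x y"
    and S: "\<And>x. x \<in> C \<Longrightarrow> S x \<in> C"
    and ST: "\<And>x y. x \<in> C \<Longrightarrow> y \<in> C \<Longrightarrow> f (S x) y = T (f x y)"
  shows "\<exists>n\<in>left_nucleus F. \<forall>x\<in>carrier F. \<beta> (n \<otimes> x) = T (\<beta> x)"
proof -
  have "\<exists>z\<in>carrier F. \<forall>y\<in>carrier F. \<beta> (z \<otimes> y) = T (\<beta> (x \<otimes> y))" if x: "x \<in> carrier F" for x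
  proof -
    have "x \<in> \<alpha>\<^sub>1 ` C" using x \<alpha>\<^sub>1 by simp
    then obtain x' where x': "x = \<alpha>\<^sub>1 x'" "x' \<in> C" by (rule imageE)
    have "\<beta> (\<alpha>\<^sub>1 (S x') \<otimes> y) = T (\<beta> (x \<otimes> y))" if "y \<in> carrier F" for y
    proof -
      have "y \<in> \<alpha>\<^sub>2 ` C" using that \<alpha>\<^sub>2 by simp
      then obtain y' where y': "y = \<alpha>\<^sub>2 y'" "y' \<in> C" by (rule imageE)
      show ?thesis unfolding x'(1) y'(1) using x'(2) y'(2) S iso ST by simp
    qed
    moreover have "\<alpha>\<^sub>1 (S x') \<in> carrier F" using imageI[OF S[OF x'(2)], of \<alpha>\<^sub>1] \<alpha>\<^sub>1 by simp
    ultimately show ?thesis by blast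
  qed
  then obtain M where M: "\<And>x. x \<in> carrier F \<Longrightarrow> M x \<in> carrier F"
    "\<And>x y. x \<in> carrier F \<Longrightarrow> y \<in> carrier F \<Longrightarrow> \<beta> (M x \<otimes> y) = T (\<beta> (x \<otimes> y))" by metis
  have M1: "\<beta> (M x) = T (\<beta> x)" if "x \<in> carrier F" for x
    using M(1)[OF that] M(2)[OF that one_in_carrier] that by (simp add: mult_one)
  have Mm: "M x \<otimes> y = M (x \<otimes> y)" if "x \<in> carrier F" "y \<in> carrier F" for x y
    using inj_onD[OF bij_betw_imp_inj_on[OF \<beta>], of "M x \<otimes> y" "M (x \<otimes> y)"] M(1) M(2)[OF that] M1 that mult_closed
    by simp
  \<comment> \<open>The relation \<open>Mm\<close> says that \<open>M\<close> commutes with all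
    right multiplications; at x = 1 it makes \<open>M\<close> the left multiplication by
    \<open>M \<one>\<close>, and read back it is the nucleus condition for that element.\<close>
  have n: "M \<one> \<otimes> x = M x" if "x \<in> carrier F" for x
    using Mm[OF one_in_carrier that] that by (simp add: one_mult)
  have "M \<one> \<in> left_nucleus F"
    using M(1)[OF one_in_carrier] n Mm mult_closed by (simp add: left_nucleus_def)
  moreover have "\<forall>x\<in>carrier F. \<beta> (M \<one> \<otimes> x) = T (\<beta> x)" using n M1 by simp
  ultimately show ?thesis by blast
qed

text \<open>The 2^k-fold sum of 1 is (1 + 1)^k. By Lagrange it vanishes for k = m, and a field has
  no nilpotents.\<close>

lemma (in field) char_two_division_ringI:
  assumes fin: "finite (carrier R)" and card: "card (carrier R) = 2 ^ m"
  shows "char_two_division_ring R"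
proof -
  have pow: "add_pow R ((2::nat) ^ k) \<one> = (\<one> \<oplus> \<one>) [^] k" for k :: nat
  proof (induction k)
    case (Suc k)
    have "add_pow R ((2::nat) ^ Suc k) \<one> = add_pow R ((2::nat) ^ k) \<one> \<oplus> add_pow R ((2::nat) ^ k) \<one>"
      using add.nat_pow_mult[OF one_closed, of "2 ^ k" "2 ^ k"] by (simp add: mult_2)
    then show ?case using Suc by (simp add: r_distr)
  qed simp
  have "add_pow R (card (carrier R)) \<one> = \<zero>"
    using add.pow_order_eq_1[of \<one>] by (simp add: order_def)
  then have "(\<one> \<oplus> \<one>) [^] m = \<zero>" using pow[of m] card by simp
  then have "\<one> \<oplus> \<one> = \<zero>"
  proof (induction m)
    case (Suc m)
    then show ?case using integral[of "(\<one> \<oplus> \<one>) [^] m" "\<one> \<oplus> \<one>"] by auto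
  qed simp
  then show ?thesis using fin integral
    by (intro char_two_division_ring.intro char_two_division_ring_axioms.intro ring_axioms) auto
qed

text \<open>A generator has order 2^m - 1, which exceeds 2^r - 1 > 0 for 0 < r < m. For s above m,
  g^(2^m) = g reduces the claim to the exponent s - m.\<close>

lemma (in char_two_division_ring) frobenius_power_nontrivial:
  assumes card: "card (carrier R) = 2 ^ m" and s: "s < 2 * m" "s \<noteq> 0" "s \<noteq> m"
  obtains x where "x \<in> carrier R" "x \<noteq> \<zero>" "x [^] ((2::nat) ^ s) \<noteq> x"
proof -
  obtain g where g: "g \<in> carrier R" "g \<noteq> \<zero>" "g [^] (card (carrier R) - 1) = \<one>"
    "\<And>i. 0 < i \<Longrightarrow> i < card (carrier R) - 1 \<Longrightarrow> g [^] i \<noteq> \<one>"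
    using obtain_generator by blast
  have small: "g [^] ((2::nat) ^ r) \<noteq> g" if r: "0 < r" "r < m" for r
  proof
    assume eq: "g [^] ((2::nat) ^ r) = g"
    have r2: "(2::nat) ^ 1 \<le> 2 ^ r" by (rule power_increasing) (use r in auto)
    have rm: "(2::nat) ^ r < 2 ^ m" using r by simp
    then have "g [^] (2 ^ r - 1 :: nat) \<otimes> g = g [^] ((2::nat) ^ r)"
      using nat_pow_mult[OF g(1), of "2 ^ r - 1" 1] g(1) by simp
    then have "g [^] (2 ^ r - 1 :: nat) = \<one>"
      using mult_right_cancel[of g "g [^] (2 ^ r - 1 :: nat)" \<one>] eq g(1,2) by simp
    moreover have "0 < (2 ^ r - 1 :: nat)" "(2 ^ r - 1 :: nat) < card (carrier R) - 1"
      unfolding card using r2 diff_less_mono[OF rm, of 1] by simp_all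
    ultimately show False using g(4) by blast
  qed
  have "g [^] ((2::nat) ^ s) \<noteq> g"
  proof (cases "s < m")
    case True
    then show ?thesis using small s by simp
  next
    case False
    then have sm: "0 < s - m" "s - m < m" "s = m + (s - m)" using s by auto
    have "g [^] ((2::nat) ^ m) = g"
    proof -
      have "g [^] (card (carrier R) - 1) \<otimes> g = g [^] ((2::nat) ^ m)"
        using nat_pow_mult[OF g(1), of "2 ^ m - 1" 1] g(1) unfolding card by simp
      then show ?thesis using g(1,3) by simp
    qed
    then have "g [^] ((2::nat) ^ s) = g [^] ((2::nat) ^ (s - m))"
      using nat_pow_pow[OF g(1), of "2 ^ m" "2 ^ (s - m)"] sm(3) by (metis power_add)
    then show ?thesis using small[OF sm(1,2)] by simp
  qed
  then show ?thesis using that g(1,2) by blast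
qed

text \<open>An element outside the nucleus is independent of 1, so the dimension is at least
  two.\<close>

lemma (in char_two_semifield) card_left_nucleus_le:
  assumes "left_nucleus F \<noteq> carrier F"
  shows "(card (left_nucleus F))\<^sup>2 \<le> card (carrier F)"
proof -
  obtain w where w: "w \<in> carrier F" "w \<notin> left_nucleus F" using assms left_nucleus_carrier by blast
  let ?f = "\<lambda>(a, b). a \<otimes> \<one> \<oplus> b \<otimes> w"
  have "w \<notin> (\<lambda>a. a \<otimes> \<one>) ` left_nucleus F" using w left_nucleus_carrier by (auto simp: mult_one)
  then have inj: "inj_on ?f (left_nucleus F \<times> left_nucleus F)"
    using left_coordinates_inj[of \<one> w] one_in_carrier one_neq_zero w(1) by blast
  have "card (?f ` (left_nucleus F \<times> left_nucleus F)) \<le> card (carrier F)"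
    using w(1) one_in_carrier left_nucleus_carrier mult_closed by (intro card_mono finite_carrier) auto
  then show ?thesis using card_image[OF inj] by (simp add: card_cartesian_product power2_eq_square)
qed

text \<open>If \<open>F\<close> were associative, it would be a field by Wedderburn's theorem, and the two copies of \<open>L\<close>
  inside its nuclei would coincide, being the solutions of \<open>x\<^bsup>q\<^esup> = x\<close>.\<close>

lemma (in char_two_semifield) isotopic_imp_quadratic:
  assumes L: "field L" "order L = 2 ^ m" and s: "s < 2 * m" "s \<noteq> 0" "s \<noteq> m"
    and legit: "legitimate L s t" and isot: "isotopic F (B_presemifield L s t)"
  shows "quadratic_over_left_nucleus F" "quadratic_over_right_nucleus F"
proof -
  interpret L: field L by (rule L(1))
  have finL: "finite (carrier L)" using L(2) by (intro card_ge_0_finite) (simp add: order_def)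
  interpret L: char_two_division_ring L
    by (rule L.char_two_division_ringI[OF finL, of m]) (use L(2) in \<open>simp add: order_def\<close>)
  obtain p\<^sub>1 p\<^sub>2 p\<^sub>3 p\<^sub>4 where t: "t = (p\<^sub>1, p\<^sub>2, p\<^sub>3, p\<^sub>4)" by (cases t) auto
  have p: "p\<^sub>1 \<in> carrier L" "p\<^sub>2 \<in> carrier L" "p\<^sub>3 \<in> carrier L" "p\<^sub>4 \<in> carrier L"
    using legit unfolding t legitimate_def by (auto simp: Let_def)
  let ?B = "B_presemifield L s (p\<^sub>1, p\<^sub>2, p\<^sub>3, p\<^sub>4)" and ?C = "carrier L \<times> carrier L"
  obtain \<alpha>\<^sub>1 \<alpha>\<^sub>2 \<beta> where \<alpha>\<^sub>1: "\<alpha>\<^sub>1 ` ?C = carrier F" and \<alpha>\<^sub>2: "\<alpha>\<^sub>2 ` ?C = carrier F"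
    and \<beta>: "bij_betw \<beta> (carrier F) ?C"
    and eq: "\<And>x y. x \<in> ?C \<Longrightarrow> y \<in> ?C \<Longrightarrow> \<beta> (\<alpha>\<^sub>1 x \<otimes> \<alpha>\<^sub>2 y) = x \<otimes>\<^bsub>?B\<^esub> y"
    using isot unfolding t isotopic_def by (auto simp: iso_def bij_betw_def B_presemifield_simps(1))
  have \<beta>inj: "x = y" if "x \<in> carrier F" "y \<in> carrier F" "\<beta> x = \<beta> y" for x y
    using inj_onD[OF bij_betw_imp_inj_on[OF \<beta>]] that by blast
  have \<beta>C: "\<beta> x \<in> ?C" if "x \<in> carrier F" for x using \<beta> that by (auto simp: bij_betw_def)
  define q where "q = card (carrier L)"
  have cardF: "card (carrier F) = q\<^sup>2"
    using bij_betw_same_card[OF \<beta>] by (simp add: q_def card_cartesian_product power2_eq_square)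
  have "\<exists>n\<in>left_nucleus F. \<forall>x\<in>carrier F. \<beta> (n \<otimes> x) = map_prod (\<lambda>a. l \<otimes>\<^bsub>L\<^esub> a) (\<lambda>a. l \<otimes>\<^bsub>L\<^esub> a) (\<beta> x)"
    if l: "l \<in> carrier L" for l
  proof (rule autotopism_left_nucleus[OF \<alpha>\<^sub>1 \<alpha>\<^sub>2 \<beta> eq, where S = "map_prod (\<lambda>a. l \<otimes>\<^bsub>L\<^esub> a) (\<lambda>a. l \<otimes>\<^bsub>L\<^esub> a)"])
    show "map_prod ((\<otimes>\<^bsub>L\<^esub>) l) ((\<otimes>\<^bsub>L\<^esub>) l) x \<otimes>\<^bsub>?B\<^esub> y = map_prod ((\<otimes>\<^bsub>L\<^esub>) l) ((\<otimes>\<^bsub>L\<^esub>) l) (x \<otimes>\<^bsub>?B\<^esub> y)"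
      if "x \<in> ?C" "y \<in> ?C" for x y
      using that l p by (auto simp: B_presemifield_simps L.r_distr L.m_ac)
  qed (use l in auto)
  then obtain n where n: "\<And>l. l \<in> carrier L \<Longrightarrow> n l \<in> left_nucleus F"
    "\<And>l x. l \<in> carrier L \<Longrightarrow> x \<in> carrier F \<Longrightarrow> \<beta> (n l \<otimes> x) = map_prod (\<lambda>a. l \<otimes>\<^bsub>L\<^esub> a) (\<lambda>a. l \<otimes>\<^bsub>L\<^esub> a) (\<beta> x)"
    by metis
  define \<sigma> where "\<sigma> l = l [^]\<^bsub>L\<^esub> ((2::nat) ^ s)" for l
  have \<sigma>c: "\<sigma> l \<in> carrier L" if "l \<in> carrier L" for l using that by (simp add: \<sigma>_def)
  \<comment> \<open>The right factor (c, d) enters the first coordinate through \<sigma> and the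
    second one linearly, so scaling it by l multiplies the product by (\<sigma> l, l), whereas
    scaling the left factor multiplies it by (l, l).\<close>
  have "\<exists>n\<in>left_nucleus (opposite F). \<forall>x\<in>carrier (opposite F).
      \<beta> (n \<otimes>\<^bsub>opposite F\<^esub> x) = map_prod (\<lambda>a. \<sigma> l \<otimes>\<^bsub>L\<^esub> a) (\<lambda>a. l \<otimes>\<^bsub>L\<^esub> a) (\<beta> x)"
    if l: "l \<in> carrier L" for l
  proof (rule char_two_semifield.autotopism_left_nucleus[OF char_two_semifield_opposite,
        of \<alpha>\<^sub>2 ?C \<alpha>\<^sub>1 \<beta> "\<lambda>y x. x \<otimes>\<^bsub>?B\<^esub> y" "map_prod (\<lambda>a. l \<otimes>\<^bsub>L\<^esub> a) (\<lambda>a. l \<otimes>\<^bsub>L\<^esub> a)"])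
    show "y \<otimes>\<^bsub>?B\<^esub> map_prod ((\<otimes>\<^bsub>L\<^esub>) l) ((\<otimes>\<^bsub>L\<^esub>) l) x = map_prod ((\<otimes>\<^bsub>L\<^esub>) (\<sigma> l)) ((\<otimes>\<^bsub>L\<^esub>) l) (y \<otimes>\<^bsub>?B\<^esub> x)"
      if "x \<in> ?C" "y \<in> ?C" for x y
      using that l p by (auto simp: B_presemifield_simps \<sigma>_def L.nat_pow_distrib L.r_distr L.m_ac)
  qed (use l \<alpha>\<^sub>1 \<alpha>\<^sub>2 \<beta> eq in auto)
  then obtain r where r: "\<And>l. l \<in> carrier L \<Longrightarrow> r l \<in> right_nucleus F"
    "\<And>l x. l \<in> carrier L \<Longrightarrow> x \<in> carrier F \<Longrightarrow> \<beta> (x \<otimes> r l) = map_prod (\<lambda>a. \<sigma> l \<otimes>\<^bsub>L\<^esub> a) (\<lambda>a. l \<otimes>\<^bsub>L\<^esub> a) (\<beta> x)"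
    unfolding left_nucleus_opposite opposite_simps by metis
  \<comment> \<open>The preimage of (1,1) is a test vector: the two actions of l send it to (l, l)
    and (\<sigma> l, l), which shows that both are faithful and tells them apart.\<close>
  have "(\<one>\<^bsub>L\<^esub>, \<one>\<^bsub>L\<^esub>) \<in> \<beta> ` carrier F" using \<beta> by (simp add: bij_betw_def)
  then obtain e where e: "(\<one>\<^bsub>L\<^esub>, \<one>\<^bsub>L\<^esub>) = \<beta> e" "e \<in> carrier F" by (rule imageE)
  have ne: "\<beta> (n l \<otimes> e) = (l, l)" if "l \<in> carrier L" for l using n(2)[OF that e(2)] that by (simp flip: e(1))
  have re: "\<beta> (e \<otimes> r l) = (\<sigma> l, l)" if "l \<in> carrier L" for l
    using r(2)[OF that e(2)] that \<sigma>c by (simp flip: e(1))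
  have ninj: "inj_on n (carrier L)" by (rule inj_onI) (metis ne prod.inject)
  have rinj: "inj_on r (carrier L)" by (rule inj_onI) (metis re prod.inject)
  have ql: "q \<le> card (left_nucleus F)"
    unfolding q_def using n(1) by (intro card_inj_on_le[OF ninj _ finite_left_nucleus]) auto
  have qr: "q \<le> card (right_nucleus F)"
    unfolding q_def using r(1) by (intro card_inj_on_le[OF rinj _ finite_right_nucleus]) auto
  have nonassoc: "left_nucleus F \<noteq> carrier F"
  proof
    assume N: "left_nucleus F = carrier F"
    let ?D = "F\<lparr>carrier := left_nucleus F\<rparr>"
    interpret D: char_two_division_ring ?D by (rule char_two_division_ring_left_nucleus)
    note nc = left_nucleus_carrier[OF n(1)] and rc = right_nucleus_carrier[OF r(1)]
    have pc: "x [^]\<^bsub>?D\<^esub> k \<in> carrier F" if "x \<in> carrier F" for x and k :: nat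
      using D.nat_pow_closed[of x k] that N by simp
    have npow: "\<beta> (n l [^]\<^bsub>?D\<^esub> k \<otimes> e) = (l [^]\<^bsub>L\<^esub> k, l [^]\<^bsub>L\<^esub> k)" if l: "l \<in> carrier L" for l and k :: nat
    proof (induction k)
      case 0
      show ?case using e by (simp add: one_mult)
    next
      case (Suc k)
      let ?x = "n l [^]\<^bsub>?D\<^esub> k"
      have "n l [^]\<^bsub>?D\<^esub> Suc k \<otimes> e = n l \<otimes> (?x \<otimes> e)"
        using D.nat_pow_Suc2[of "n l" k] n(1)[OF l] left_nucleus_assoc[OF n(1)[OF l] pc[OF nc[OF l]] e(2)] by simp
      then show ?case using n(2)[OF l, of "?x \<otimes> e"] Suc pc[OF nc[OF l]] e(2) mult_closed l L.nat_pow_Suc2[OF l, of k] by simp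
    qed
    have rpow: "\<beta> (e \<otimes> r l [^]\<^bsub>?D\<^esub> k) = (\<sigma> l [^]\<^bsub>L\<^esub> k, l [^]\<^bsub>L\<^esub> k)" if l: "l \<in> carrier L" for l and k :: nat
    proof (induction k)
      case 0
      show ?case using e by (simp add: mult_one)
    next
      case (Suc k)
      let ?x = "r l [^]\<^bsub>?D\<^esub> k"
      have "e \<otimes> r l [^]\<^bsub>?D\<^esub> Suc k = (e \<otimes> ?x) \<otimes> r l"
        using right_nucleus_assoc[OF r(1)[OF l] pc[OF rc[OF l]] e(2)] by simp
      then show ?case using r(2)[OF l, of "e \<otimes> ?x"] Suc pc[OF rc[OF l]] e(2) mult_closed l \<sigma>c[OF l]
          L.nat_pow_Suc2[OF l, of k] L.nat_pow_Suc2[OF \<sigma>c[OF l], of k] by simp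
    qed
    \<comment> \<open>In the field \<open>?D\<close> this set has at most q - 1 elements, so the
      injective image of the units of \<open>L\<close> under \<open>n\<close> fills it. Since
      \<open>r\<close> maps there too, \<open>r x = n l\<close> for some l, and commuting with
      \<open>e\<close> forces (\<sigma> x, x) = (l, l).\<close>
    let ?R = "{x \<in> carrier ?D. x [^]\<^bsub>?D\<^esub> (q - 1) = \<one>\<^bsub>?D\<^esub>}" and ?L = "carrier L - {\<zero>\<^bsub>L\<^esub>}"
    have e0: "e \<noteq> \<zero>"
    proof
      assume "e = \<zero>"
      then have "\<beta> (n \<zero>\<^bsub>L\<^esub> \<otimes> e) = \<beta> e" using nc by (simp add: mult_zero)
      then show False using ne[of "\<zero>\<^bsub>L\<^esub>"] by (simp flip: e(1))
    qed
    have nR: "n l \<in> ?R" if l: "l \<in> ?L" for l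
    proof -
      have "\<beta> (n l [^]\<^bsub>?D\<^esub> (q - 1) \<otimes> e) = \<beta> e"
        using npow[of l "q - 1"] l L.pow_card_minus_one[of l] e by (simp add: q_def)
      then have "n l [^]\<^bsub>?D\<^esub> (q - 1) \<otimes> e = \<one> \<otimes> e"
        using \<beta>inj pc nc l e(2) mult_closed by (simp add: one_mult)
      then have "n l [^]\<^bsub>?D\<^esub> (q - 1) = \<one>"
        using mult_right_cancel[of e "n l [^]\<^bsub>?D\<^esub> (q - 1)" \<one>] e(2) e0 pc nc l one_in_carrier by simp
      then show ?thesis using n(1) l by simp
    qed
    have rR: "r l \<in> ?R" if l: "l \<in> ?L" for l
    proof -
      have "\<sigma> l \<noteq> \<zero>\<^bsub>L\<^esub>" using L.pow_nonzero l by (simp add: \<sigma>_def)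
      then have "\<beta> (e \<otimes> r l [^]\<^bsub>?D\<^esub> (q - 1)) = \<beta> e"
        using rpow[of l "q - 1"] l L.pow_card_minus_one[of l] L.pow_card_minus_one[of "\<sigma> l"] \<sigma>c[of l] e
          by (simp add: q_def)
      then have "e \<otimes> r l [^]\<^bsub>?D\<^esub> (q - 1) = e \<otimes> \<one>"
        using \<beta>inj pc rc l e(2) mult_closed by (simp add: mult_one)
      then have "r l [^]\<^bsub>?D\<^esub> (q - 1) = \<one>"
        using mult_left_cancel[of e "r l [^]\<^bsub>?D\<^esub> (q - 1)" \<one>] e(2) e0 pc rc l one_in_carrier by simp
      then show ?thesis using rc l N by simp
    qed
    have "card {\<zero>\<^bsub>L\<^esub>, \<one>\<^bsub>L\<^esub>} \<le> q" unfolding q_def using finL by (intro card_mono) auto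
    then have "q - 1 \<noteq> 0" by simp
    then have Rle: "card ?R \<le> q - 1" by (rule D.num_roots_le_deg[OF D.finite_carrier])
    have "card (n ` ?L) = q - 1"
      using card_image[OF inj_on_subset[OF ninj, of ?L]] finL by (simp add: q_def)
    then have "n ` ?L = ?R"
      using nR Rle D.finite_carrier card_mono[of ?R "n ` ?L"] by (intro card_subset_eq) auto
    obtain x where x: "x \<in> carrier L" "x \<noteq> \<zero>\<^bsub>L\<^esub>" "\<sigma> x \<noteq> x"
      using L.frobenius_power_nontrivial[of m s] s L(2) unfolding \<sigma>_def by (auto simp: order_def)
    have "r x \<in> n ` ?L" using rR x \<open>n ` ?L = ?R\<close> by auto
    then obtain l where l: "l \<in> carrier L" "r x = n l" by auto
    have "e \<otimes> r x = n l \<otimes> e" using left_nucleus_comm[of e "n l"] n(1)[OF l(1)] e(2) N l(2) by simp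
    then have "(\<sigma> x, x) = (l, l)" using re[OF x(1)] ne[OF l(1)] by metis
    then have "\<sigma> x = l" "x = l" by auto
    then show False using x(3) by simp
  qed
  have nonassoc': "left_nucleus (opposite F) \<noteq> carrier (opposite F)"
  proof
    assume "left_nucleus (opposite F) = carrier (opposite F)"
    then have R: "right_nucleus F = carrier F" by (simp add: left_nucleus_opposite)
    have "x \<otimes> (y \<otimes> w) = (x \<otimes> y) \<otimes> w" if "x \<in> carrier F" "y \<in> carrier F" "w \<in> carrier F" for x y w
      by (rule right_nucleus_assoc) (use that R in auto)
    then have "left_nucleus F = carrier F" unfolding left_nucleus_def by blast
    then show False using nonassoc by simp
  qed
  show "quadratic_over_left_nucleus F"
    unfolding quadratic_over_left_nucleus_iff
    using card_left_nucleus_le[OF nonassoc] ql cardF by (intro antisym) (auto intro: power_mono)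
  show "quadratic_over_right_nucleus F"
    unfolding quadratic_over_right_nucleus_iff
    using char_two_semifield.card_left_nucleus_le[OF char_two_semifield_opposite nonassoc'] qr cardF
    by (intro antisym) (auto simp: left_nucleus_opposite intro: power_mono)
qed

text \<open>\<open>\<beta>\<close> identifies the additive group with that of
  \<open>L \<times> L\<close>, which has exponent 2, and which has more than one element, so that 1
  = 0 is excluded.\<close>

lemma (in semifield) isotopic_B_imp_char_two:
  assumes L: "field L" "order L = 2 ^ m"
    and legit: "legitimate L s t" and isot: "isotopic F (B_presemifield L s t)"
  shows "char_two_semifield F"
proof -
  interpret L: field L by (rule L(1))
  have finL: "finite (carrier L)" using L(2) by (intro card_ge_0_finite) (simp add: order_def)
  interpret L: char_two_division_ring L
    by (rule L.char_two_division_ringI[OF finL, of m]) (use L(2) in \<open>simp add: order_def\<close>)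
  obtain p\<^sub>1 p\<^sub>2 p\<^sub>3 p\<^sub>4 where t: "t = (p\<^sub>1, p\<^sub>2, p\<^sub>3, p\<^sub>4)" by (cases t) auto
  let ?B = "B_presemifield L s (p\<^sub>1, p\<^sub>2, p\<^sub>3, p\<^sub>4)" and ?C = "carrier L \<times> carrier L"
  obtain \<beta> where \<beta>: "bij_betw \<beta> (carrier F) ?C"
    and add: "\<And>x y. x \<in> carrier F \<Longrightarrow> y \<in> carrier F \<Longrightarrow> \<beta> (x \<oplus> y) = \<beta> x \<oplus>\<^bsub>?B\<^esub> \<beta> y"
    using isot unfolding t isotopic_def by (auto simp: iso_def hom_def B_presemifield_simps(1))
  have double: "\<beta> (x \<oplus> x) = (\<zero>\<^bsub>L\<^esub>, \<zero>\<^bsub>L\<^esub>)" if x: "x \<in> carrier F" for x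
  proof -
    have "\<beta> x \<in> ?C" using \<beta> x by (auto simp: bij_betw_def)
    then obtain a b where ab: "\<beta> x = (a, b)" "a \<in> carrier L" "b \<in> carrier L" by (cases "\<beta> x") auto
    then show ?thesis using add[OF x x] by (simp add: B_presemifield_simps L.double)
  qed
  have "\<one> \<oplus> \<one> = \<zero>"
    using inj_onD[OF bij_betw_imp_inj_on[OF \<beta>], of "\<one> \<oplus> \<one>" \<zero>] double[of \<one>] double[of \<zero>] one_in_carrier by simp
  moreover have "\<one> \<noteq> \<zero>"
  proof
    assume "\<one> = \<zero>"
    then have "carrier F = {\<zero>}" using one_mult zero_mult by force
    then have "card ?C = 1" using bij_betw_same_card[OF \<beta>] by simp
    moreover have "card {\<zero>\<^bsub>L\<^esub>, \<one>\<^bsub>L\<^esub>} \<le> card (carrier L)" using finL by (intro card_mono) auto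
    ultimately show False by (simp add: card_cartesian_product)
  qed
  ultimately show ?thesis
    by (intro char_two_semifield.intro char_two_semifield_axioms.intro semifield_axioms)
qed

theorem proposition7:
  fixes F :: "('a, 'm) ring_scheme"
  assumes "semifield F"
  shows "isotopic_to_some_B F \<longleftrightarrow>
    characteristic F = 2 \<and> quadratic_over_left_nucleus F \<and> quadratic_over_right_nucleus F"
proof
  interpret semifield F by (rule assms)
  assume "isotopic_to_some_B F"
  then obtain m s t and L :: "nat ring" where L: "field L" "order L = 2 ^ m"
    and s: "s < 2 * m" "s \<noteq> 0" "s \<noteq> m" and t: "legitimate L s t" "isotopic F (B_presemifield L s t)"
    unfolding isotopic_to_some_B_def by auto
  have F: "char_two_semifield F" by (rule isotopic_B_imp_char_two[OF L t])
  then show "characteristic F = 2 \<and> quadratic_over_left_nucleus F \<and> quadratic_over_right_nucleus F"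
    using char_two_semifield.isotopic_imp_quadratic[OF F L s t] characteristic_eq_two_iff by simp
next
  interpret semifield F by (rule assms)
  assume *: "characteristic F = 2 \<and> quadratic_over_left_nucleus F \<and> quadratic_over_right_nucleus F"
  then interpret char_two_semifield F using characteristic_eq_two_iff by simp
  show "isotopic_to_some_B F" using quadratic_imp_isotopic * by simp
qed

end
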